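(* Let $\mu,\nu$ be Borel probability measures on $\mathbb R$ with finite first moments and with $\min\{p_{\mu,\nu},c_{\mu,\nu}\}>0$. Let $\tilde\pi^D,\tilde\pi^I\in\Pi_{Sub}(\eta^-,\chi^-)$ be the decreasing and increasing submartingale couplings, respectively. Let $\pi^D,\pi^I\in\Pi_{Sup}(\eta^+,\chi^+)$ be the decreasing and increasing supermartingale couplings, respectively. Let $\pi^M\in\Pi_M(\eta^0,\chi^0)$ be an arbitrary martingale coupling. Define $$\pi^{min}:=\tilde\pi^D+\pi^M+\pi^I\qquad\text{and}\qquad \pi^{max}:=\tilde\pi^I+\pi^M+\pi^D.$$ Then $\pi^{min}$ and $\pi^{max}$ produce (among the elements of $\Pi^*(\mu,\nu)$) the smallest and largest covariance of $X\sim\mu$ and $Y\sim\nu$, respectively.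
   Context: For a finite Borel measure $\eta$ on $\mathbb R$ with finite first moment: $P_\eta(k)=\int(k-x)^+\eta(dx)$, $C_\eta(k)=\int(x-k)^+\eta(dx)$. For two such measures $\eta,\chi$ of equal mass, $\Pi(\eta,\chi)$ is the set of measures on $\mathbb R^2$ with marginals $\eta,\chi$, disintegrated as $\pi(dx,dy)=\pi_x(dy)\eta(dx)$; $\Pi_M,\Pi_{Sub},\Pi_{Sup}(\eta,\chi)$ are the subsets with $\int y\,\pi_x(dy)=x$, $\ge x$, $\le x$, respectively, for $\eta$-a.e. $x$. Decomposition. Let $p_{\mu,\nu}=\sup_k\{P_\mu(k)-P_\nu(k)\}$, $c_{\mu,\nu}=\sup_k\{C_\mu(k)-C_\nu(k)\}$. If both are $>0$, put $\tilde P=P_\nu+p_{\mu,\nu}$, $x^-=\inf\{k:\tilde P(k)=P_\mu(k)\}$, $x^+=\sup\{k:\tilde P(k)=P_\mu(k)\}$ (real, $x^-\le x^+$), $\Delta^-=P_\mu'(x^--)$ (left derivative), $\Delta^+=P_\mu'(x^++)$ (right derivative), and $$\eta^-=\mu|_{(-\infty,x^-)},\quad \eta^0=\mu|_{[x^-,x^+]},\quad \eta^+=\mu|_{(x^+,\infty)},$$ $$\chi^-=\nu|_{(-\infty,x^-)}+(\Delta^--\tilde P'(x^--))\delta_{x^-},\quad \chi^+=\nu|_{(x^+,\infty)}+(\tilde P'(x^++)-\Delta^+)\delta_{x^+},\quad \chi^0=\nu-\chi^--\chi^+.$$ It is known that $\Pi_{Sub}(\eta^-,\chi^-)$, $\Pi_M(\eta^0,\chi^0)$,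 $\Pi_{Sup}(\eta^+,\chi^+)$ are non-empty. $\Pi^*(\mu,\nu)=\operatorname{argmin}_{\pi\in\Pi(\mu,\nu)}\int|x-\int y\,\pi_x(dy)|\,\mu(dx)$; equivalently, it is the set of $\pi\in\Pi(\mu,\nu)$ of the form $\pi^-+\pi^0+\pi^+$ with $\pi^-\in\Pi_{Sub}(\eta^-,\chi^-)$, $\pi^0\in\Pi_M(\eta^0,\chi^0)$, $\pi^+\in\Pi_{Sup}(\eta^+,\chi^+)$. Since the marginals are fixed, comparing covariances of $(X,Y)\sim\pi$ over $\pi\in\Pi^*(\mu,\nu)$ means comparing the values of $\int xy\,\pi(dx,dy)$. Monotone sets. Let $\Gamma\subseteq\mathbb R^2$, $M\subseteq\mathbb R$ be Borel. $\Gamma$ is second-order left-monotone (resp. right-monotone) if for all $(x,y_1),(x,y_2),(x',y')\in\Gamma$ with $y_1<y_2$ we have $y'\notin(y_1,y_2)$ whenever $x<x'$ (resp. $x>x'$). The pair $(\Gamma,M)$ is supermartingale (resp. submartingale) first-order left-monotone if for all $(x_1,y_1),(x_2,y_2)\in\Gamma$ with $x_1<x_2$ we have $y_1\le y_2$ whenever $x_2\notin M$ (resp. $x_1\notin M$); it is supermartingale (resp. submartingale) first-order right-monotone if for all such points $y_2\le y_1$ whenever $x_1\notin M$ (resp. $x_2\notin M$). In the supermartingale case $(\Gamma,M)$ is nondegenerate if (i) whenever $(x,y)\in\Gamma$ with $y>x$ there is $(x,y')\in\Gamma$ with $y'<x$, and (ii) whenever $x\in M$ and $(x,y)\in\Gamma$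 with $y<x$ there is $(x,y')\in\Gamma$ with $y'>x$; in the submartingale case the inequalities between $y,y'$ and $x$ are reversed. Canonical couplings (existence and uniqueness are known, Nutz–Stebegg and its mirror image). If $\Pi_{Sup}(\eta,\chi)\neq\emptyset$, the increasing (resp. decreasing) supermartingale coupling is the unique $\pi\in\Pi_{Sup}(\eta,\chi)$ for which there is a nondegenerate pair $(\Gamma,M)$ that is supermartingale first-order right-monotone and second-order left-monotone (resp. supermartingale first-order left-monotone and second-order right-monotone), such that $\pi$ is concentrated on $\Gamma$ and $\int y\,\pi_x(dy)=x$ for $\eta$-a.e. $x\in M$. If $\Pi_{Sub}(\eta,\chi)\neq\emptyset$, the increasing (resp. decreasing) submartingale coupling is the unique $\pi\in\Pi_{Sub}(\eta,\chi)$ for which there is a nondegenerate pair $(\Gamma,M)$ that is submartingale first-order left-monotone and second-order left-monotone (resp. submartingale first-order right-monotone and second-order right-monotone), such that $\pi$ is concentrated on $\Gamma$ and $\int y\,\pi_x(dy)=x$ for $\eta$-a.e. $x\in M$. *)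

theory Defs
  imports "HOL-Probability.Probability"
begin

text \<open>Throughout, \<open>\<eta>\<close>, \<open>\<theta>\<close>, \<open>\<mu>\<close>, \<open>\<nu>\<close> stand for finite Borel measures on the real line with finite
  first moment.\<close>

subsection \<open>Put and call functions\<close>

definition put_fun :: "real measure \<Rightarrow> real \<Rightarrow> real" where
  "put_fun \<eta> k = (\<integral>x. max (k - x) 0 \<partial>\<eta>)"

definition call_fun :: "real measure \<Rightarrow> real \<Rightarrow> real" where
  "call_fun \<eta> k = (\<integral>x. max (x - k) 0 \<partial>\<eta>)"

subsection \<open>Couplings\<close>

definition couplings :: "real measure \<Rightarrow> real measure \<Rightarrow> (real \<times> real) measure set" where
  "couplings \<eta> \<theta> = {\<pi>. sets \<pi> = sets borel \<and> distr \<pi> borel fst = \<eta> \<and> distr \<pi> borel snd = \<theta>}"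

text \<open>\<open>\<pi>(dx, dy) = \<kappa>\<^sub>x(dy) \<eta>(dx)\<close> with a probability kernel \<open>\<kappa>\<close>. Every coupling with first marginal \<open>\<eta>\<close>
  admits such a \<open>\<kappa>\<close>, and it is unique up to an \<open>\<eta>\<close>-null set, so in the definitions below it makes no
  difference whether \<open>\<kappa>\<close> is quantified existentially or universally.\<close>

definition disintegrates ::
  "real measure \<Rightarrow> (real \<times> real) measure \<Rightarrow> (real \<Rightarrow> real measure) \<Rightarrow> bool" where
  "disintegrates \<eta> \<pi> \<kappa> \<longleftrightarrow> \<kappa> \<in> borel \<rightarrow>\<^sub>M prob_algebra borel \<and>
     (\<forall>A\<in>sets borel. emeasure \<pi> A = (\<integral>\<^sup>+x. emeasure (\<kappa> x) {y. (x, y) \<in> A} \<partial>\<eta>))"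

text \<open>For a coupling whose second marginal has a finite first moment, \<open>y\<close> is \<open>\<kappa>\<^sub>x\<close>-integrable for
  \<open>\<eta>\<close>-almost every \<open>x\<close>, so the default value of the integral only matters on a null set.\<close>

definition barycenter :: "(real \<Rightarrow> real measure) \<Rightarrow> real \<Rightarrow> real" where
  "barycenter \<kappa> x = (\<integral>y. y \<partial>(\<kappa> x))"

definition martingale_couplings ::
  "real measure \<Rightarrow> real measure \<Rightarrow> (real \<times> real) measure set" where
  "martingale_couplings \<eta> \<theta> =
     {\<pi> \<in> couplings \<eta> \<theta>. \<exists>\<kappa>. disintegrates \<eta> \<pi> \<kappa> \<and> (AE x in \<eta>. barycenter \<kappa> x = x)}"

definition submartingale_couplings ::
  "real measure \<Rightarrow> real measure \<Rightarrow> (real \<times> real) measure set" where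
  "submartingale_couplings \<eta> \<theta> =
     {\<pi> \<in> couplings \<eta> \<theta>. \<exists>\<kappa>. disintegrates \<eta> \<pi> \<kappa> \<and> (AE x in \<eta>. barycenter \<kappa> x \<ge> x)}"

definition supermartingale_couplings ::
  "real measure \<Rightarrow> real measure \<Rightarrow> (real \<times> real) measure set" where
  "supermartingale_couplings \<eta> \<theta> =
     {\<pi> \<in> couplings \<eta> \<theta>. \<exists>\<kappa>. disintegrates \<eta> \<pi> \<kappa> \<and> (AE x in \<eta>. barycenter \<kappa> x \<le> x)}"

text \<open>The couplings minimising \<open>\<integral>\<bar>x - \<integral>y \<pi>\<^sub>x(dy)\<bar> \<mu>(dx)\<close>; the integrand is \<open>\<mu>\<close>-integrable for every
  coupling of measures with finite first moments.\<close>

definition optimal_couplings ::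
  "real measure \<Rightarrow> real measure \<Rightarrow> (real \<times> real) measure set" where
  "optimal_couplings \<mu> \<nu> =
     {\<pi> \<in> couplings \<mu> \<nu>. \<exists>\<kappa>. disintegrates \<mu> \<pi> \<kappa> \<and>
        (\<forall>\<pi>'\<in>couplings \<mu> \<nu>. \<forall>\<kappa>'. disintegrates \<mu> \<pi>' \<kappa>' \<longrightarrow>
           (\<integral>x. \<bar>x - barycenter \<kappa> x\<bar> \<partial>\<mu>) \<le> (\<integral>x. \<bar>x - barycenter \<kappa>' x\<bar> \<partial>\<mu>))}"

subsection \<open>Decomposition of the marginals\<close>

definition add_measure :: "'a measure \<Rightarrow> 'a measure \<Rightarrow> 'a measure" where
  "add_measure M N = measure_of (space M) (sets M) (\<lambda>A. emeasure M A + emeasure N A)"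

definition restr_measure :: "'a measure \<Rightarrow> 'a set \<Rightarrow> 'a measure" where
  "restr_measure M A = density M (indicator A)"

definition left_deriv :: "(real \<Rightarrow> real) \<Rightarrow> real \<Rightarrow> real" where
  "left_deriv f x = vector_derivative f (at_left x)"

definition right_deriv :: "(real \<Rightarrow> real) \<Rightarrow> real \<Rightarrow> real" where
  "right_deriv f x = vector_derivative f (at_right x)"

definition p_gap :: "real measure \<Rightarrow> real measure \<Rightarrow> real" where
  "p_gap \<mu> \<nu> = (SUP k. put_fun \<mu> k - put_fun \<nu> k)"

definition c_gap :: "real measure \<Rightarrow> real measure \<Rightarrow> real" where
  "c_gap \<mu> \<nu> = (SUP k. call_fun \<mu> k - call_fun \<nu> k)"

definition lifted_put :: "real measure \<Rightarrow> real measure \<Rightarrow> real \<Rightarrow> real" where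
  "lifted_put \<mu> \<nu> k = put_fun \<nu> k + p_gap \<mu> \<nu>"

definition x_minus :: "real measure \<Rightarrow> real measure \<Rightarrow> real" where
  "x_minus \<mu> \<nu> = Inf {k. lifted_put \<mu> \<nu> k = put_fun \<mu> k}"

definition x_plus :: "real measure \<Rightarrow> real measure \<Rightarrow> real" where
  "x_plus \<mu> \<nu> = Sup {k. lifted_put \<mu> \<nu> k = put_fun \<mu> k}"

definition eta_minus :: "real measure \<Rightarrow> real measure \<Rightarrow> real measure" where
  "eta_minus \<mu> \<nu> = restr_measure \<mu> {..<x_minus \<mu> \<nu>}"

definition eta_zero :: "real measure \<Rightarrow> real measure \<Rightarrow> real measure" where
  "eta_zero \<mu> \<nu> = restr_measure \<mu> {x_minus \<mu> \<nu>..x_plus \<mu> \<nu>}"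

definition eta_plus :: "real measure \<Rightarrow> real measure \<Rightarrow> real measure" where
  "eta_plus \<mu> \<nu> = restr_measure \<mu> {x_plus \<mu> \<nu><..}"

text \<open>The coefficients of the Dirac masses below are nonnegative, because \<open>lifted_put \<mu> \<nu>\<close> dominates
  \<open>put_fun \<mu>\<close> and touches it at \<open>x_minus \<mu> \<nu>\<close> and \<open>x_plus \<mu> \<nu>\<close>; hence the truncation at \<open>0\<close> in
  \<open>ennreal\<close> is harmless. Likewise \<open>chi_minus \<mu> \<nu>\<close> and \<open>chi_plus \<mu> \<nu>\<close> add up to a measure dominated by
  \<open>\<nu>\<close>, so that \<open>diff_measure\<close> is the setwise difference in \<open>chi_zero\<close>.\<close>

definition chi_minus :: "real measure \<Rightarrow> real measure \<Rightarrow> real measure" where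
  "chi_minus \<mu> \<nu> =
     add_measure (restr_measure \<nu> {..<x_minus \<mu> \<nu>})
       (scale_measure
          (ennreal (left_deriv (put_fun \<mu>) (x_minus \<mu> \<nu>) - left_deriv (lifted_put \<mu> \<nu>) (x_minus \<mu> \<nu>)))
          (return borel (x_minus \<mu> \<nu>)))"

definition chi_plus :: "real measure \<Rightarrow> real measure \<Rightarrow> real measure" where
  "chi_plus \<mu> \<nu> =
     add_measure (restr_measure \<nu> {x_plus \<mu> \<nu><..})
       (scale_measure
          (ennreal (right_deriv (lifted_put \<mu> \<nu>) (x_plus \<mu> \<nu>) - right_deriv (put_fun \<mu>) (x_plus \<mu> \<nu>)))
          (return borel (x_plus \<mu> \<nu>)))"

definition chi_zero :: "real measure \<Rightarrow> real measure \<Rightarrow> real measure" where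
  "chi_zero \<mu> \<nu> = diff_measure (diff_measure \<nu> (chi_minus \<mu> \<nu>)) (chi_plus \<mu> \<nu>)"

subsection \<open>Monotone sets\<close>

definition second_order_left_monotone :: "(real \<times> real) set \<Rightarrow> bool" where
  "second_order_left_monotone \<Gamma> \<longleftrightarrow>
     (\<forall>x y1 y2 x' y'. (x, y1) \<in> \<Gamma> \<and> (x, y2) \<in> \<Gamma> \<and> (x', y') \<in> \<Gamma> \<and> y1 < y2 \<and> x < x' \<longrightarrow>
        y' \<notin> {y1<..<y2})"

definition second_order_right_monotone :: "(real \<times> real) set \<Rightarrow> bool" where
  "second_order_right_monotone \<Gamma> \<longleftrightarrow>
     (\<forall>x y1 y2 x' y'. (x, y1) \<in> \<Gamma> \<and> (x, y2) \<in> \<Gamma> \<and> (x', y') \<in> \<Gamma> \<and> y1 < y2 \<and> x > x' \<longrightarrow>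
        y' \<notin> {y1<..<y2})"

definition super_first_order_left_monotone :: "(real \<times> real) set \<Rightarrow> real set \<Rightarrow> bool" where
  "super_first_order_left_monotone \<Gamma> M \<longleftrightarrow>
     (\<forall>x1 y1 x2 y2. (x1, y1) \<in> \<Gamma> \<and> (x2, y2) \<in> \<Gamma> \<and> x1 < x2 \<and> x2 \<notin> M \<longrightarrow> y1 \<le> y2)"

definition super_first_order_right_monotone :: "(real \<times> real) set \<Rightarrow> real set \<Rightarrow> bool" where
  "super_first_order_right_monotone \<Gamma> M \<longleftrightarrow>
     (\<forall>x1 y1 x2 y2. (x1, y1) \<in> \<Gamma> \<and> (x2, y2) \<in> \<Gamma> \<and> x1 < x2 \<and> x1 \<notin> M \<longrightarrow> y2 \<le> y1)"

definition sub_first_order_left_monotone :: "(real \<times> real) set \<Rightarrow> real set \<Rightarrow> bool" where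
  "sub_first_order_left_monotone \<Gamma> M \<longleftrightarrow>
     (\<forall>x1 y1 x2 y2. (x1, y1) \<in> \<Gamma> \<and> (x2, y2) \<in> \<Gamma> \<and> x1 < x2 \<and> x1 \<notin> M \<longrightarrow> y1 \<le> y2)"

definition sub_first_order_right_monotone :: "(real \<times> real) set \<Rightarrow> real set \<Rightarrow> bool" where
  "sub_first_order_right_monotone \<Gamma> M \<longleftrightarrow>
     (\<forall>x1 y1 x2 y2. (x1, y1) \<in> \<Gamma> \<and> (x2, y2) \<in> \<Gamma> \<and> x1 < x2 \<and> x2 \<notin> M \<longrightarrow> y2 \<le> y1)"

definition super_nondegenerate :: "(real \<times> real) set \<Rightarrow> real set \<Rightarrow> bool" where
  "super_nondegenerate \<Gamma> M \<longleftrightarrow>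
     (\<forall>x y. (x, y) \<in> \<Gamma> \<and> y > x \<longrightarrow> (\<exists>y'. (x, y') \<in> \<Gamma> \<and> y' < x)) \<and>
     (\<forall>x y. x \<in> M \<and> (x, y) \<in> \<Gamma> \<and> y < x \<longrightarrow> (\<exists>y'. (x, y') \<in> \<Gamma> \<and> y' > x))"

definition sub_nondegenerate :: "(real \<times> real) set \<Rightarrow> real set \<Rightarrow> bool" where
  "sub_nondegenerate \<Gamma> M \<longleftrightarrow>
     (\<forall>x y. (x, y) \<in> \<Gamma> \<and> y < x \<longrightarrow> (\<exists>y'. (x, y') \<in> \<Gamma> \<and> y' > x)) \<and>
     (\<forall>x y. x \<in> M \<and> (x, y) \<in> \<Gamma> \<and> y > x \<longrightarrow> (\<exists>y'. (x, y') \<in> \<Gamma> \<and> y' < x))"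

subsection \<open>Canonical couplings\<close>

definition carried_by ::
  "real measure \<Rightarrow> (real \<times> real) measure \<Rightarrow> (real \<times> real) set \<Rightarrow> real set \<Rightarrow> bool" where
  "carried_by \<eta> \<pi> \<Gamma> M \<longleftrightarrow> \<Gamma> \<in> sets borel \<and> M \<in> sets borel \<and> (AE z in \<pi>. z \<in> \<Gamma>) \<and>
     (\<exists>\<kappa>. disintegrates \<eta> \<pi> \<kappa> \<and> (AE x in \<eta>. x \<in> M \<longrightarrow> barycenter \<kappa> x = x))"

text \<open>The four predicates below state the property that characterises the respective coupling
  uniquely (Nutz and Stebegg); existence and uniqueness are not part of the definitions.\<close>

definition increasing_supermartingale_coupling ::
  "real measure \<Rightarrow> real measure \<Rightarrow> (real \<times> real) measure \<Rightarrow> bool" where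
  "increasing_supermartingale_coupling \<eta> \<theta> \<pi> \<longleftrightarrow> \<pi> \<in> supermartingale_couplings \<eta> \<theta> \<and>
     (\<exists>\<Gamma> M. super_nondegenerate \<Gamma> M \<and> super_first_order_right_monotone \<Gamma> M \<and>
        second_order_left_monotone \<Gamma> \<and> carried_by \<eta> \<pi> \<Gamma> M)"

definition decreasing_supermartingale_coupling ::
  "real measure \<Rightarrow> real measure \<Rightarrow> (real \<times> real) measure \<Rightarrow> bool" where
  "decreasing_supermartingale_coupling \<eta> \<theta> \<pi> \<longleftrightarrow> \<pi> \<in> supermartingale_couplings \<eta> \<theta> \<and>
     (\<exists>\<Gamma> M. super_nondegenerate \<Gamma> M \<and> super_first_order_left_monotone \<Gamma> M \<and>
        second_order_right_monotone \<Gamma> \<and> carried_by \<eta> \<pi> \<Gamma> M)"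

definition increasing_submartingale_coupling ::
  "real measure \<Rightarrow> real measure \<Rightarrow> (real \<times> real) measure \<Rightarrow> bool" where
  "increasing_submartingale_coupling \<eta> \<theta> \<pi> \<longleftrightarrow> \<pi> \<in> submartingale_couplings \<eta> \<theta> \<and>
     (\<exists>\<Gamma> M. sub_nondegenerate \<Gamma> M \<and> sub_first_order_left_monotone \<Gamma> M \<and>
        second_order_left_monotone \<Gamma> \<and> carried_by \<eta> \<pi> \<Gamma> M)"

definition decreasing_submartingale_coupling ::
  "real measure \<Rightarrow> real measure \<Rightarrow> (real \<times> real) measure \<Rightarrow> bool" where
  "decreasing_submartingale_coupling \<eta> \<theta> \<pi> \<longleftrightarrow> \<pi> \<in> submartingale_couplings \<eta> \<theta> \<and>
     (\<exists>\<Gamma> M. sub_nondegenerate \<Gamma> M \<and> sub_first_order_right_monotone \<Gamma> M \<and>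
        second_order_right_monotone \<Gamma> \<and> carried_by \<eta> \<pi> \<Gamma> M)"

subsection \<open>Covariance\<close>

text \<open>\<open>E[XY] - E[X] E[Y]\<close> for \<open>(X, Y)\<close> with law \<open>\<pi>\<close>, where \<open>E[XY]\<close> is an extended real: finite first
  moments do not make \<open>xy\<close> integrable. On \<open>optimal_couplings \<mu> \<nu>\<close> with positive \<open>p_gap\<close> and \<open>c_gap\<close> no
  indeterminate \<open>\<infinity> - \<infinity>\<close> occurs: such a coupling lives on the union of \<open>{..x_minus} \<times> {..x_minus}\<close>,
  \<open>{x_minus..x_plus} \<times> {x_minus..x_plus}\<close> and \<open>{x_plus..} \<times> {x_plus..}\<close>, where the negative part of
  \<open>xy\<close> is at most \<open>C * (1 + \<bar>x\<bar> + \<bar>y\<bar>)\<close> for some constant \<open>C\<close>.\<close>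

definition covar :: "(real \<times> real) measure \<Rightarrow> ereal" where
  "covar \<pi> =
     enn2ereal (\<integral>\<^sup>+(x, y). ennreal (x * y) \<partial>\<pi>) - enn2ereal (\<integral>\<^sup>+(x, y). ennreal (- (x * y)) \<partial>\<pi>)
     - ereal ((\<integral>z. fst z \<partial>\<pi>) * (\<integral>z. snd z \<partial>\<pi>))"

end

theory Submission
  imports Defs
begin

text \<open>The three parts of an optimal coupling live on separate sets, and on each of them the covariance is
  governed by the marginals except for one nonnegative integral, which the canonical couplings make
  extremal.

  \<^emph>\<open>Structure of the optimal couplings.\<close> Let \<open>\<beta> x\<close> be the barycenter of \<open>\<pi>\<^sub>x\<close> and let \<open>s x = - 1\<close> for
  \<open>x < k\<close> and \<open>s x = 1\<close> for \<open>x \<ge> k\<close>. Testing \<open>x - \<beta> x\<close> against \<open>s\<close> shows that \<open>\<integral>\<bar>x - \<beta> x\<bar> \<mu>(dx)\<close> is at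
  least \<open>\<integral>\<bar>x - k\<bar> \<mu>(dx) - \<integral>\<bar>y - k\<bar> \<nu>(dy)\<close>, with equality exactly if \<open>\<pi>\<close> keeps both sides of \<open>k\<close>
  apart and has drift towards \<open>k\<close> (\<open>mean_deviation_eq_iff\<close>). The lower bound is
  \<open>2 * (put_fun \<mu> k - put_fun \<nu> k)\<close> plus a constant, so it is largest at every contact point \<open>k\<close>, in
  particular at \<open>x_minus\<close> and \<open>x_plus\<close>. A coupling glued from a submartingale, a martingale and a
  supermartingale part attains it at \<open>x_minus\<close>; conversely, equality at both ends splits an optimal
  coupling into three such parts (\<open>optimal_couplings_eq\<close>). How much mass goes into an end point is
  then forced by the marginals.

  \<^emph>\<open>Covariance.\<close> With \<open>a = x_minus\<close> and \<open>b = x_plus\<close>, the product \<open>x * y\<close> differs from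
  \<open>(a - x) * (a - y) \<ge> 0\<close> on the left part, and from \<open>(x - b) * (y - b) \<ge> 0\<close> on the right part, by an
  affine function, whose integral the marginals determine. On the middle part \<open>x * y\<close> is bounded and
  the martingale property gives \<open>\<integral>x * y = \<integral>x * x\<close>. Only the two nonnegative integrals vary
  (\<open>covar_glued\<close>).

  \<^emph>\<open>Extremality.\<close> By the layer cake formula it suffices to compare \<open>\<integral>_A (y - b)\<close> over the level sets \<open>A\<close>
  of \<open>x\<close>. For the increasing supermartingale coupling and \<open>A = {x. x > t}\<close> take \<open>q\<close> to be the supremum of the
  \<open>y\<close> that are reached from \<open>A\<close>. First-order monotonicity places the mass from outside \<open>A \<union> M\<close> above
  \<open>q\<close>; second-order monotonicity forbids a point of \<open>M\<close> outside \<open>A\<close> to send mass to both sides of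
  \<open>q\<close>. If \<open>B\<close> collects the points of \<open>M\<close> that send it below \<open>q\<close>, then \<open>A \<union> B\<close> fills the part of the
  second marginal below \<open>q\<close>, so that it minimises \<open>\<integral>_(A \<union> B) y\<close>. The supermartingale constraint is
  binding on \<open>B\<close>, whose contribution is therefore maximal, and the one of \<open>A\<close> is minimal
  (\<open>threshold_le\<close>). The other three canonical couplings are handled by the same lemma, with \<open>A\<close>
  replaced by a lower level set or \<open>y\<close> by \<open>- y\<close>.\<close>

section \<open>Sums and restrictions of measures\<close>

lemma space_add_measure [simp]: "space (add_measure M N) = space M"
  and sets_add_measure [simp, measurable_cong]: "sets (add_measure M N) = sets M"
  by (auto simp: add_measure_def)

lemma emeasure_add_measure:
  assumes eq: "sets M = sets N" and A: "A \<in> sets M"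
  shows "emeasure (add_measure M N) A = emeasure M A + emeasure N A"
  unfolding add_measure_def
proof (rule emeasure_measure_of_sigma)
  show "sigma_algebra (space M) (sets M)" ..
  show "positive (sets M) (\<lambda>A. emeasure M A + emeasure N A)"
    by (simp add: positive_def)
  show "countably_additive (sets M) (\<lambda>A. emeasure M A + emeasure N A)"
  proof (rule countably_additiveI)
    fix F :: "nat \<Rightarrow> _" assume "range F \<subseteq> sets M" "disjoint_family F"
    then show "(\<Sum>i. emeasure M (F i) + emeasure N (F i)) =
        emeasure M (\<Union>(range F)) + emeasure N (\<Union>(range F))"
      using eq by (subst suminf_add[symmetric]) (auto intro!: arg_cong2[where f="(+)"] suminf_emeasure)
  qed
qed (fact A)

lemma nn_integral_add_measure:
  assumes eq: "sets M = sets N" and f: "f \<in> borel_measurable M"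
  shows "(\<integral>\<^sup>+x. f x \<partial>add_measure M N) = (\<integral>\<^sup>+x. f x \<partial>M) + (\<integral>\<^sup>+x. f x \<partial>N)"
  using f
proof induction
  case (cong f g)
  moreover have "integral\<^sup>N N f = integral\<^sup>N N g"
    using cong(3) sets_eq_imp_space_eq[OF eq] by (intro nn_integral_cong) auto
  ultimately show ?case by (metis (mono_tags, lifting) nn_integral_cong space_add_measure)
next
  case (set A)
  then show ?case using eq by (simp add: emeasure_add_measure)
next
  case (mult u c)
  have [measurable]: "u \<in> borel_measurable N" "u \<in> borel_measurable (add_measure M N)"
    using mult(2) measurable_cong_sets[OF eq refl] measurable_cong_sets[OF sets_add_measure[of M N] refl] by auto
  show ?case using mult by (simp add: nn_integral_cmult distrib_left)
next
  case (add u v)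
  have [measurable]: "u \<in> borel_measurable N" "u \<in> borel_measurable (add_measure M N)"
    "v \<in> borel_measurable N" "v \<in> borel_measurable (add_measure M N)"
    using \<open>u \<in> borel_measurable M\<close> \<open>v \<in> borel_measurable M\<close>
    unfolding measurable_cong_sets[OF eq refl] measurable_cong_sets[OF sets_add_measure[of M N] refl]
    by auto
  show ?case using add by (simp add: nn_integral_add ac_simps)
next
  case (seq U)
  have [measurable]: "U i \<in> borel_measurable N" "U i \<in> borel_measurable (add_measure M N)" for i
    using seq(1)[of i] 
    unfolding measurable_cong_sets[OF eq refl] measurable_cong_sets[OF sets_add_measure[of M N] refl]
    by auto
  have mono: "incseq (\<lambda>i. integral\<^sup>N M (U i))" "incseq (\<lambda>i. integral\<^sup>N N (U i))"
    using \<open>incseq U\<close> by (auto simp: incseq_def le_fun_def intro!: nn_integral_mono)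
  have sup: "integral\<^sup>N L (SUP i. U i) = (SUP i. integral\<^sup>N L (U i))"
    if "\<And>i. U i \<in> borel_measurable L" for L
  proof -
    have "(\<lambda>x. SUP i. U i x) = (SUP i. U i)" by (simp add: fun_eq_iff image_comp)
    then show ?thesis
      using nn_integral_monotone_convergence_SUP[OF \<open>incseq U\<close> that] by simp
  qed
  show ?case
    using sup[of M] sup[of N] sup[of "add_measure M N"] seq
    by (simp add: ennreal_SUP_add[OF mono] del: Sup_apply SUP_apply)
qed

lemma AE_add_measure:
  assumes eq: "sets M = sets N" and "AE x in M. P x" "AE x in N. P x"
  shows "AE x in add_measure M N. P x"
proof -
  obtain A where A: "{x\<in>space M. \<not> P x} \<subseteq> A" "emeasure M A = 0" "A \<in> sets M"
    using AE_E[OF assms(2)] by blast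
  obtain B where B: "{x\<in>space N. \<not> P x} \<subseteq> B" "emeasure N B = 0" "B \<in> sets N"
    using AE_E[OF assms(3)] by blast
  have "emeasure (add_measure M N) (A \<inter> B) = 0"
  proof -
    have "emeasure M (A \<inter> B) \<le> emeasure M A" "emeasure N (A \<inter> B) \<le> emeasure N B"
      using A(3) B(3) eq by (auto intro!: emeasure_mono)
    then have "emeasure M (A \<inter> B) = 0" "emeasure N (A \<inter> B) = 0"
      using A(2) B(2) by auto
    then show ?thesis using A(3) B(3) eq by (simp add: emeasure_add_measure)
  qed
  then show ?thesis
    using A B eq sets_eq_imp_space_eq[OF eq] by (intro AE_I[where N="A \<inter> B"]) auto
qed

lemma space_restr_measure [simp]: "space (restr_measure M A) = space M"
  and sets_restr_measure [simp, measurable_cong]: "sets (restr_measure M A) = sets M"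
  by (auto simp: restr_measure_def)

lemma emeasure_restr_measure:
  assumes "A \<in> sets M" "B \<in> sets M"
  shows "emeasure (restr_measure M A) B = emeasure M (A \<inter> B)"
  using assms unfolding restr_measure_def
  by (subst emeasure_density) (simp_all flip: indicator_inter_arith)

lemma AE_restr_measure:
  assumes "A \<in> sets M"
  shows "(AE x in restr_measure M A. P x) \<longleftrightarrow> (AE x in M. x \<in> A \<longrightarrow> P x)"
  using assms unfolding restr_measure_def
  by (subst AE_density) (auto intro!: AE_cong simp: indicator_def)

lemma nn_integral_restr_measure:
  assumes "A \<in> sets M" "f \<in> borel_measurable M"
  shows "(\<integral>\<^sup>+x. f x \<partial>restr_measure M A) = (\<integral>\<^sup>+x. indicator A x * f x \<partial>M)"
  using assms unfolding restr_measure_def by (subst nn_integral_density) auto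

section \<open>Couplings and their disintegrations\<close>

lemma
  assumes "\<pi> \<in> couplings \<eta> \<theta>"
  shows couplings_sets: "sets \<pi> = sets (borel \<Otimes>\<^sub>M borel)"
    and couplings_sets_fst: "sets \<eta> = sets borel"
    and couplings_sets_snd: "sets \<theta> = sets borel"
    and couplings_space: "space \<pi> = UNIV"
proof -
  have *: "sets \<pi> = sets borel" "distr \<pi> borel fst = \<eta>" "distr \<pi> borel snd = \<theta>"
    using assms by (auto simp: couplings_def)
  show "sets \<pi> = sets (borel \<Otimes>\<^sub>M borel)" unfolding borel_prod by (rule *)
  show "sets \<eta> = sets borel" unfolding *(2)[symmetric] by simp
  show "sets \<theta> = sets borel" unfolding *(3)[symmetric] by simp
  show "space \<pi> = UNIV" using sets_eq_imp_space_eq[OF *(1)] by simp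
qed

lemma
  assumes "\<pi> \<in> couplings \<eta> \<theta>"
  shows AE_coupling_fst: "AE x in \<eta>. P x \<Longrightarrow> AE z in \<pi>. P (fst z)"
    and AE_coupling_snd: "AE y in \<theta>. P y \<Longrightarrow> AE z in \<pi>. P (snd z)"
proof -
  note [measurable_cong] = couplings_sets[OF assms]
  have m: "fst \<in> \<pi> \<rightarrow>\<^sub>M borel" "snd \<in> \<pi> \<rightarrow>\<^sub>M borel" by measurable
  have d: "distr \<pi> borel fst = \<eta>" "distr \<pi> borel snd = \<theta>"
    using assms by (auto simp: couplings_def)
  show "AE x in \<eta>. P x \<Longrightarrow> AE z in \<pi>. P (fst z)"
    unfolding d(1)[symmetric] by (rule AE_distrD[OF m(1)])
  show "AE y in \<theta>. P y \<Longrightarrow> AE z in \<pi>. P (snd z)"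
    unfolding d(2)[symmetric] by (rule AE_distrD[OF m(2)])
qed

lemma
  fixes f :: "real \<Rightarrow> real"
  assumes "\<pi> \<in> couplings \<eta> \<theta>" and f: "f \<in> borel_measurable borel"
  shows integrable_coupling_fst: "integrable \<pi> (\<lambda>z. f (fst z)) \<longleftrightarrow> integrable \<eta> f"
    and integrable_coupling_snd: "integrable \<pi> (\<lambda>z. f (snd z)) \<longleftrightarrow> integrable \<theta> f"
    and integral_coupling_fst: "(\<integral>z. f (fst z) \<partial>\<pi>) = (\<integral>x. f x \<partial>\<eta>)"
    and integral_coupling_snd: "(\<integral>z. f (snd z) \<partial>\<pi>) = (\<integral>y. f y \<partial>\<theta>)"
proof -
  note [measurable_cong] = couplings_sets[OF assms(1)]
  have d: "\<eta> = distr \<pi> borel fst" "\<theta> = distr \<pi> borel snd"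
    using assms by (auto simp: couplings_def)
  show "integrable \<pi> (\<lambda>z. f (fst z)) \<longleftrightarrow> integrable \<eta> f"
    unfolding d(1) using f by (subst integrable_distr_eq) auto
  show "integrable \<pi> (\<lambda>z. f (snd z)) \<longleftrightarrow> integrable \<theta> f"
    unfolding d(2) using f by (subst integrable_distr_eq) auto
  show "(\<integral>z. f (fst z) \<partial>\<pi>) = (\<integral>x. f x \<partial>\<eta>)"
    unfolding d(1) using f by (subst integral_distr) auto
  show "(\<integral>z. f (snd z) \<partial>\<pi>) = (\<integral>y. f y \<partial>\<theta>)"
    unfolding d(2) using f by (subst integral_distr) auto
qed

lemma
  assumes "\<pi> \<in> couplings \<eta> \<theta>" and A: "A \<in> sets borel"
  shows emeasure_coupling_fst: "emeasure \<pi> {z. fst z \<in> A} = emeasure \<eta> A"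
    and emeasure_coupling_snd: "emeasure \<pi> {z. snd z \<in> A} = emeasure \<theta> A"
proof -
  note [measurable_cong] = couplings_sets[OF assms(1)]
  have d: "\<eta> = distr \<pi> borel fst" "\<theta> = distr \<pi> borel snd"
    using assms by (auto simp: couplings_def)
  show "emeasure \<pi> {z. fst z \<in> A} = emeasure \<eta> A"
    unfolding d(1) using A couplings_space[OF assms(1)]
    by (subst emeasure_distr) (auto simp: vimage_def)
  show "emeasure \<pi> {z. snd z \<in> A} = emeasure \<theta> A"
    unfolding d(2) using A couplings_space[OF assms(1)]
    by (subst emeasure_distr) (auto simp: vimage_def)
qed

lemma couplings_mass_eq:
  assumes "\<pi> \<in> couplings \<eta> \<theta>"
  shows "emeasure \<eta> UNIV = emeasure \<theta> UNIV"
  using emeasure_coupling_fst[OF assms, of UNIV] emeasure_coupling_snd[OF assms, of UNIV] by simp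

lemma couplings_finite_measure:
  assumes "\<pi> \<in> couplings \<eta> \<theta>" "finite_measure \<eta>"
  shows "finite_measure \<pi>"
  using emeasure_coupling_fst[OF assms(1), of UNIV] finite_measure.emeasure_finite[OF assms(2), of UNIV]
    couplings_space[OF assms(1)]
  by (intro finite_measureI) auto

lemma disintegrates_kernel:
  assumes "disintegrates \<eta> \<pi> \<kappa>"
  shows "\<kappa> \<in> borel \<rightarrow>\<^sub>M subprob_algebra borel" "prob_space (\<kappa> x)" "sets (\<kappa> x) = sets borel"
    "space (\<kappa> x) = UNIV"
proof -
  have k: "\<kappa> \<in> borel \<rightarrow>\<^sub>M prob_algebra borel" using assms by (simp add: disintegrates_def)
  then show "\<kappa> \<in> borel \<rightarrow>\<^sub>M subprob_algebra borel" by (rule measurable_prob_algebraD)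
  have "\<kappa> x \<in> space (prob_algebra borel)" using measurable_space[OF k, of x] by simp
  then show "prob_space (\<kappa> x)" "sets (\<kappa> x) = sets borel"
    by (auto simp: space_prob_algebra)
  then show "space (\<kappa> x) = UNIV" using sets_eq_imp_space_eq by fastforce
qed

text \<open>Disintegrations are specified on sets; the next two lemmas carry them over to nonnegative
  integrands and to null sets.\<close>
lemma nn_integral_disintegrates:
  assumes dis: "disintegrates \<eta> \<pi> \<kappa>" and \<pi>: "\<pi> \<in> couplings \<eta> \<theta>"
    and f: "f \<in> borel_measurable (borel \<Otimes>\<^sub>M borel)"
  shows "(\<integral>\<^sup>+z. f z \<partial>\<pi>) = (\<integral>\<^sup>+x. (\<integral>\<^sup>+y. f (x, y) \<partial>\<kappa> x) \<partial>\<eta>)"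
proof -
  note [measurable_cong] = couplings_sets[OF \<pi>] couplings_sets_fst[OF \<pi>] disintegrates_kernel(3)[OF dis]
  note [measurable] = disintegrates_kernel(1)[OF dis]
  show ?thesis using f
  proof induction
    case (cong f g)
    then have "f = g" by (auto simp: space_pair_measure)
    then show ?case using cong by simp
  next
    case (set A)
    then have A: "A \<in> sets borel" unfolding borel_prod .
    have "emeasure (\<kappa> x) {y. (x, y) \<in> A} = (\<integral>\<^sup>+y. indicator A (x, y) \<partial>\<kappa> x)" for x
    proof -
      have "{y. (x, y) \<in> A} \<in> sets (\<kappa> x)" using set by measurable
      moreover have "(\<lambda>y. indicator A (x, y) :: ennreal) = indicator {y. (x, y) \<in> A}"
        by (auto simp: indicator_def)
      ultimately show ?thesis by simp
    qed
    moreover have "(\<integral>\<^sup>+z. indicator A z \<partial>\<pi>) = emeasure \<pi> A"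
      using set couplings_sets[OF \<pi>] by (intro nn_integral_indicator) simp
    ultimately show ?case using dis A by (simp add: disintegrates_def)
  next
    case (mult u c)
    note [measurable] = mult(2)
    have "u \<in> borel_measurable \<pi>" "\<And>x. (\<lambda>y. u (x, y)) \<in> borel_measurable (\<kappa> x)" by measurable
    moreover have "(\<lambda>x. \<integral>\<^sup>+ y. u (x, y) \<partial>\<kappa> x) \<in> borel_measurable \<eta>"
      by (rule nn_integral_measurable_subprob_algebra2[where N=borel]) measurable
    ultimately show ?case using mult by (simp add: nn_integral_cmult)
  next
    case (add u v)
    note [measurable] = \<open>u \<in> borel_measurable (borel \<Otimes>\<^sub>M borel)\<close> \<open>v \<in> borel_measurable (borel \<Otimes>\<^sub>M borel)\<close>
    have "u \<in> borel_measurable \<pi>" "\<And>x. (\<lambda>y. u (x, y)) \<in> borel_measurable (\<kappa> x)"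
      "v \<in> borel_measurable \<pi>" "\<And>x. (\<lambda>y. v (x, y)) \<in> borel_measurable (\<kappa> x)" by measurable
    moreover have "(\<lambda>x. \<integral>\<^sup>+ y. u (x, y) \<partial>\<kappa> x) \<in> borel_measurable \<eta>"
      by (rule nn_integral_measurable_subprob_algebra2[where N=borel]) measurable
    moreover have "(\<lambda>x. \<integral>\<^sup>+ y. v (x, y) \<partial>\<kappa> x) \<in> borel_measurable \<eta>"
      by (rule nn_integral_measurable_subprob_algebra2[where N=borel]) measurable
    ultimately show ?case using add by (simp add: nn_integral_add)
  next
    case (seq U)
    note [measurable] = \<open>\<And>i. U i \<in> borel_measurable (borel \<Otimes>\<^sub>M borel)\<close>
    have mU: "\<And>i. U i \<in> borel_measurable \<pi>"
      and mUk: "\<And>i x. (\<lambda>y. U i (x, y)) \<in> borel_measurable (\<kappa> x)" by measurable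
    have mUe: "(\<lambda>x. \<integral>\<^sup>+ y. U i (x, y) \<partial>\<kappa> x) \<in> borel_measurable \<eta>" for i
      by (rule nn_integral_measurable_subprob_algebra2[where N=borel]) measurable
    have inc: "incseq (\<lambda>i y. U i (x, y))" for x
      using \<open>incseq U\<close> by (auto simp: incseq_def le_fun_def)
    have inc2: "incseq (\<lambda>i x. \<integral>\<^sup>+ y. U i (x, y) \<partial>\<kappa> x)"
      using inc by (auto simp: incseq_def le_fun_def intro!: nn_integral_mono)
    have "(\<integral>\<^sup>+z. (SUP i. U i) z \<partial>\<pi>) = (SUP i. integral\<^sup>N \<pi> (U i))"
      using nn_integral_monotone_convergence_SUP[OF \<open>incseq U\<close> mU] by (simp add: image_comp)
    also have "\<dots> = (SUP i. \<integral>\<^sup>+x. \<integral>\<^sup>+ y. U i (x, y) \<partial>\<kappa> x \<partial>\<eta>)" using seq by simp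
    also have "\<dots> = (\<integral>\<^sup>+x. (SUP i. \<integral>\<^sup>+ y. U i (x, y) \<partial>\<kappa> x) \<partial>\<eta>)"
      using nn_integral_monotone_convergence_SUP[OF inc2 mUe] by simp
    also have "\<dots> = (\<integral>\<^sup>+x. \<integral>\<^sup>+ y. (SUP i. U i) (x, y) \<partial>\<kappa> x \<partial>\<eta>)"
      using nn_integral_monotone_convergence_SUP[OF inc mUk] by (simp add: image_comp)
    finally show ?case .
  qed
qed

lemma AE_disintegrates:
  assumes dis: "disintegrates \<eta> \<pi> \<kappa>" and \<pi>: "\<pi> \<in> couplings \<eta> \<theta>" and ae: "AE z in \<pi>. P z"
  shows "AE x in \<eta>. AE y in \<kappa> x. P (x, y)"
proof -
  note [measurable_cong] = couplings_sets[OF \<pi>] couplings_sets_fst[OF \<pi>] disintegrates_kernel(3)[OF dis]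
  note [measurable] = disintegrates_kernel(1)[OF dis]
  obtain N where N: "{z \<in> space \<pi>. \<not> P z} \<subseteq> N" "emeasure \<pi> N = 0" "N \<in> sets \<pi>"
    using AE_E[OF ae] by blast
  have [measurable]: "N \<in> sets (borel \<Otimes>\<^sub>M borel)" using N(3) couplings_sets[OF \<pi>] by simp
  have m: "(\<lambda>x. \<integral>\<^sup>+ y. indicator N (x, y) \<partial>\<kappa> x) \<in> borel_measurable \<eta>"
    by (rule nn_integral_measurable_subprob_algebra2[where N=borel]) measurable
  have "(\<integral>\<^sup>+x. (\<integral>\<^sup>+y. indicator N (x, y) \<partial>\<kappa> x) \<partial>\<eta>) = (\<integral>\<^sup>+z. indicator N z \<partial>\<pi>)"
    by (rule nn_integral_disintegrates[OF dis \<pi>, symmetric]) measurable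
  also have "\<dots> = 0" using N by simp
  finally have *: "AE x in \<eta>. (\<integral>\<^sup>+y. indicator N (x, y) \<partial>\<kappa> x) = 0"
    using m by (subst (asm) nn_integral_0_iff_AE) auto
  show ?thesis
  proof (rule AE_mp[OF *], rule AE_I2, rule impI)
    fix x assume "(\<integral>\<^sup>+y. indicator N (x, y) \<partial>\<kappa> x) = 0"
    then have "AE y in \<kappa> x. indicator N (x, y) = (0::ennreal)"
      by (subst (asm) nn_integral_0_iff_AE) auto
    then show "AE y in \<kappa> x. P (x, y)"
      by (rule AE_mp) (use N(1) couplings_space[OF \<pi>] in \<open>auto simp: indicator_def split: if_splits\<close>)
  qed
qed

lemma borel_measurable_barycenter:
  assumes "disintegrates \<eta> \<pi> \<kappa>"
  shows "barycenter \<kappa> \<in> borel_measurable borel"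
  unfolding barycenter_def[abs_def]
  using disintegrates_kernel(1)[OF assms] integral_measurable_subprob_algebra[of "\<lambda>y. y" borel]
  by (intro measurable_compose[OF disintegrates_kernel(1)[OF assms]]) auto

text \<open>Integrability of \<open>y\<close> under \<open>\<kappa> x\<close> holds only for almost every \<open>x\<close>, so the iterated integral is
  computed separately for the positive and the negative part of \<open>g x * y\<close>, where it always makes
  sense.\<close>
lemma
  fixes g :: "real \<Rightarrow> real"
  assumes dis: "disintegrates \<eta> \<pi> \<kappa>" and \<pi>: "\<pi> \<in> couplings \<eta> \<theta>"
    and int: "integrable \<theta> (\<lambda>y. y)"
    and g [measurable]: "g \<in> borel_measurable borel" and bdd: "\<And>x. \<bar>g x\<bar> \<le> C"
  shows integrable_barycenter_mult: "integrable \<eta> (\<lambda>x. g x * barycenter \<kappa> x)"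
    and integral_barycenter_mult: "(\<integral>x. g x * barycenter \<kappa> x \<partial>\<eta>) = (\<integral>z. g (fst z) * snd z \<partial>\<pi>)"
    and integrable_coupling_mult_snd: "integrable \<pi> (\<lambda>z. g (fst z) * snd z)"
proof -
  note [measurable_cong] = couplings_sets[OF \<pi>] couplings_sets_fst[OF \<pi>] disintegrates_kernel(3)[OF dis]
  note [measurable] = disintegrates_kernel(1)[OF dis] borel_measurable_barycenter[OF dis]
  have C: "0 \<le> C" using bdd[of 0] by linarith
  have intz: "integrable \<pi> (\<lambda>z. snd z)"
    using integrable_coupling_snd[OF \<pi> measurable_ident] int unfolding id_def by blast
  show int\<pi>: "integrable \<pi> (\<lambda>z. g (fst z) * snd z)"
  proof (rule Bochner_Integration.integrable_bound[of _ "\<lambda>z. C * snd z"])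
    show "AE z in \<pi>. norm (g (fst z) * snd z) \<le> norm (C * snd z)"
      using bdd C by (auto simp: abs_mult intro!: mult_right_mono)
  qed (use intz in auto)
  define p where "p x = (\<integral>\<^sup>+y. ennreal (g x * y) \<partial>\<kappa> x)" for x
  define n where "n x = (\<integral>\<^sup>+y. ennreal (- (g x * y)) \<partial>\<kappa> x)" for x
  have [measurable]: "p \<in> borel_measurable \<eta>" "n \<in> borel_measurable \<eta>"
    unfolding p_def n_def
    by (rule nn_integral_measurable_subprob_algebra2[where N=borel]; measurable)+
  have P: "(\<integral>\<^sup>+x. p x \<partial>\<eta>) = (\<integral>\<^sup>+z. ennreal (g (fst z) * snd z) \<partial>\<pi>)"
    unfolding p_def by (subst nn_integral_disintegrates[OF dis \<pi>]) auto
  have N: "(\<integral>\<^sup>+x. n x \<partial>\<eta>) = (\<integral>\<^sup>+z. ennreal (- (g (fst z) * snd z)) \<partial>\<pi>)"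
    unfolding n_def by (subst nn_integral_disintegrates[OF dis \<pi>]) auto
  have fin: "(\<integral>\<^sup>+x. p x \<partial>\<eta>) \<noteq> \<infinity>" "(\<integral>\<^sup>+x. n x \<partial>\<eta>) \<noteq> \<infinity>"
    using int\<pi> unfolding P N real_integrable_def by auto
  have aefin: "AE x in \<eta>. p x \<noteq> \<infinity>" "AE x in \<eta>. n x \<noteq> \<infinity>"
    using nn_integral_PInf_AE[OF _ fin(1)] nn_integral_PInf_AE[OF _ fin(2)] by auto
  have eq: "AE x in \<eta>. g x * barycenter \<kappa> x = enn2real (p x) - enn2real (n x)"
    using aefin
  proof eventually_elim
    case (elim x)
    have m: "(\<lambda>y. g x * y) \<in> borel_measurable (\<kappa> x)" by measurable
    have int\<kappa>: "integrable (\<kappa> x) (\<lambda>y. g x * y)"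
      unfolding real_integrable_def using elim m unfolding p_def n_def infinity_ennreal_def by blast
    have "g x * barycenter \<kappa> x = (\<integral>y. g x * y \<partial>\<kappa> x)"
      by (simp add: barycenter_def)
    also have "\<dots> = enn2real (p x) - enn2real (n x)"
      unfolding p_def n_def by (rule real_lebesgue_integral_def[OF int\<kappa>])
    finally show ?case .
  qed
  have ep: "(\<integral>\<^sup>+x. ennreal (enn2real (p x)) \<partial>\<eta>) = (\<integral>\<^sup>+x. p x \<partial>\<eta>)"
    using aefin(1) by (intro nn_integral_cong_AE) (auto simp: less_top elim!: AE_mp)
  have en: "(\<integral>\<^sup>+x. ennreal (enn2real (n x)) \<partial>\<eta>) = (\<integral>\<^sup>+x. n x \<partial>\<eta>)"
    using aefin(2) by (intro nn_integral_cong_AE) (auto simp: less_top elim!: AE_mp)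
  have ip: "integrable \<eta> (\<lambda>x. enn2real (p x))" "integrable \<eta> (\<lambda>x. enn2real (n x))"
    using fin ep en by (auto intro!: integrableI_nonneg simp: less_top)
  have vp: "(\<integral>x. enn2real (p x) \<partial>\<eta>) = enn2real (\<integral>\<^sup>+x. p x \<partial>\<eta>)"
    "(\<integral>x. enn2real (n x) \<partial>\<eta>) = enn2real (\<integral>\<^sup>+x. n x \<partial>\<eta>)"
    using ep en by (auto simp: integral_eq_nn_integral)
  show "integrable \<eta> (\<lambda>x. g x * barycenter \<kappa> x)"
  proof (subst integrable_cong_AE[OF _ _ eq])
    show "integrable \<eta> (\<lambda>x. enn2real (p x) - enn2real (n x))" using ip by auto
  qed auto
  have "(\<integral>x. g x * barycenter \<kappa> x \<partial>\<eta>) = (\<integral>x. enn2real (p x) - enn2real (n x) \<partial>\<eta>)"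
    by (rule integral_cong_AE[OF _ _ eq]) auto
  also have "\<dots> = enn2real (\<integral>\<^sup>+x. p x \<partial>\<eta>) - enn2real (\<integral>\<^sup>+x. n x \<partial>\<eta>)"
    using ip vp by simp
  also have "\<dots> = (\<integral>z. g (fst z) * snd z \<partial>\<pi>)"
    unfolding P N by (rule real_lebesgue_integral_def[OF int\<pi>, symmetric])
  finally show "(\<integral>x. g x * barycenter \<kappa> x \<partial>\<eta>) = (\<integral>z. g (fst z) * snd z \<partial>\<pi>)" .
qed

section \<open>Comparing couplings threshold by threshold\<close>

lemma nn_integral_layer_cake:
  fixes u :: "'a \<Rightarrow> real" and v :: "'a \<Rightarrow> ennreal"
  assumes "sigma_finite_measure M"
    and [measurable]: "u \<in> borel_measurable M" "v \<in> borel_measurable M"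
  shows "(\<integral>\<^sup>+z. ennreal (u z) * v z \<partial>M) =
    (\<integral>\<^sup>+t. indicator {0..} t * (\<integral>\<^sup>+z. indicator {z. t < u z} z * v z \<partial>M) \<partial>lborel)"
proof -
  interpret M: sigma_finite_measure M by fact
  interpret pair_sigma_finite M lborel ..
  have level: "ennreal (u z) = (\<integral>\<^sup>+t. indicator {0..} t * indicator {z. t < u z} z \<partial>lborel)" for z
  proof -
    have "(\<integral>\<^sup>+t. indicator {0..} t * indicator {z. t < u z} z \<partial>lborel) = (\<integral>\<^sup>+t. indicator {0..<u z} t \<partial>lborel)"
      by (intro nn_integral_cong) (auto simp: indicator_def)
    also have "\<dots> = ennreal (u z)"
      by (cases "0 \<le> u z") (auto simp: ennreal_neg)
    finally show ?thesis by simp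
  qed
  have ind: "indicator {z. t < u z} z = (if t < u z then 1 else 0 :: ennreal)" for t z
    by (simp add: indicator_def)
  have "(\<integral>\<^sup>+z. ennreal (u z) * v z \<partial>M) =
    (\<integral>\<^sup>+z. (\<integral>\<^sup>+t. indicator {0..} t * indicator {z. t < u z} z * v z \<partial>lborel) \<partial>M)"
    unfolding level ind by (intro nn_integral_cong nn_integral_multc[symmetric]) measurable
  also have "\<dots> = (\<integral>\<^sup>+t. (\<integral>\<^sup>+z. indicator {0..} t * indicator {z. t < u z} z * v z \<partial>M) \<partial>lborel)"
    unfolding ind by (rule Fubini'[symmetric]) measurable
  also have "\<dots> = (\<integral>\<^sup>+t. indicator {0..} t * (\<integral>\<^sup>+z. indicator {z. t < u z} z * v z \<partial>M) \<partial>lborel)"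
    unfolding ind mult.assoc by (intro nn_integral_cong nn_integral_cmult) measurable
  finally show ?thesis .
qed

lemma integrable_coupling_indicator:
  fixes w :: "real \<Rightarrow> real"
  assumes \<pi>: "\<pi> \<in> couplings \<eta> \<theta>" and int: "integrable \<theta> w"
    and w: "w \<in> borel_measurable borel" and A: "A \<in> sets borel"
  shows "integrable \<pi> (\<lambda>z. indicator A (fst z) * w (snd z))"
proof -
  note [measurable_cong] = couplings_sets[OF \<pi>]
  note [measurable] = w A
  have "integrable \<pi> (\<lambda>z. w (snd z))" using integrable_coupling_snd[OF \<pi> w] int by blast
  then show ?thesis
    by (rule Bochner_Integration.integrable_bound) (measurable, auto simp: indicator_def)
qed

text \<open>The product \<open>u x * w y\<close> need not be integrable. Slicing along \<open>u\<close> reduces the comparison to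
  integrals of \<open>w\<close> over level sets, which are finite.\<close>
lemma layer_cake_mono:
  fixes u w :: "real \<Rightarrow> real"
  assumes \<pi>: "\<pi> \<in> couplings \<eta> \<theta>" and \<pi>': "\<pi>' \<in> couplings \<eta> \<theta>" and fin: "finite_measure \<eta>"
    and u: "u \<in> borel_measurable borel" and w: "w \<in> borel_measurable borel"
    and int: "integrable \<theta> w" and nonneg: "AE y in \<theta>. 0 \<le> w y"
    and le: "\<And>t. (\<integral>z. indicator {x. t < u x} (fst z) * w (snd z) \<partial>\<pi>)
               \<le> (\<integral>z. indicator {x. t < u x} (fst z) * w (snd z) \<partial>\<pi>')"
  shows "(\<integral>\<^sup>+z. ennreal (u (fst z) * w (snd z)) \<partial>\<pi>) \<le> (\<integral>\<^sup>+z. ennreal (u (fst z) * w (snd z)) \<partial>\<pi>')"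
proof -
  note [measurable] = u w
  have levels: "(\<integral>\<^sup>+z. ennreal (u (fst z) * w (snd z)) \<partial>\<rho>) =
    (\<integral>\<^sup>+t. indicator {0..} t * ennreal (\<integral>z. indicator {x. t < u x} (fst z) * w (snd z) \<partial>\<rho>) \<partial>lborel)"
    if \<rho>: "\<rho> \<in> couplings \<eta> \<theta>" for \<rho>
  proof -
    note [measurable_cong] = couplings_sets[OF \<rho>]
    interpret finite_measure \<rho> using couplings_finite_measure[OF \<rho> fin] .
    have nn: "AE z in \<rho>. 0 \<le> w (snd z)" using AE_coupling_snd[OF \<rho> nonneg] .
    have inner: "(\<integral>\<^sup>+z. indicator {z. t < u (fst z)} z * ennreal (w (snd z)) \<partial>\<rho>) =
      ennreal (\<integral>z. indicator {x. t < u x} (fst z) * w (snd z) \<partial>\<rho>)" for t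
    proof -
      have "(\<integral>\<^sup>+z. indicator {z. t < u (fst z)} z * ennreal (w (snd z)) \<partial>\<rho>) =
        (\<integral>\<^sup>+z. ennreal (indicator {x. t < u x} (fst z) * w (snd z)) \<partial>\<rho>)"
        by (intro nn_integral_cong) (auto simp: indicator_def)
      also have "\<dots> = ennreal (\<integral>z. indicator {x. t < u x} (fst z) * w (snd z) \<partial>\<rho>)"
        using nn by (intro nn_integral_eq_integral integrable_coupling_indicator[OF \<rho> int w])
          (measurable, auto elim!: AE_mp)
      finally show ?thesis .
    qed
    have "(\<integral>\<^sup>+z. ennreal (u (fst z) * w (snd z)) \<partial>\<rho>) = (\<integral>\<^sup>+z. ennreal (u (fst z)) * ennreal (w (snd z)) \<partial>\<rho>)"
      using nn by (intro nn_integral_cong_AE) (auto simp: ennreal_mult'' elim!: AE_mp)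
    also have "\<dots> = (\<integral>\<^sup>+t. indicator {0..} t *
        (\<integral>\<^sup>+z. indicator {z. t < u (fst z)} z * ennreal (w (snd z)) \<partial>\<rho>) \<partial>lborel)"
      by (rule nn_integral_layer_cake) (unfold_locales, measurable)
    finally show ?thesis unfolding inner .
  qed
  show ?thesis unfolding levels[OF \<pi>] levels[OF \<pi>']
    by (intro nn_integral_mono mult_left_mono ennreal_leI le) auto
qed

text \<open>The common core of the four extremality results. In the applications \<open>v\<close> is an increasing or
  a decreasing affine function of \<open>y\<close>, so that sub- and supermartingales are covered at once, and \<open>on_M\<close>
  holds because the barycenters of \<open>\<pi>\<close> reach the bound \<open>x\<close> on \<open>M\<close>. Let \<open>q\<close> be the supremum of
  \<open>v\<close> over the points reached from \<open>A\<close>, and let \<open>B\<close> be the set of those \<open>x \<in> M - A\<close> from which \<open>\<pi>\<close>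
  reaches only values \<open>v y \<le> q\<close>. Then \<open>\<pi>\<close> sends \<open>A \<union> B\<close> below \<open>q\<close> and the complement above \<open>q\<close>, so
  \<open>\<integral>_(A \<union> B) (v y - q)\<close> equals \<open>\<integral>min (v y - q) 0 \<theta>(dy)\<close>, a lower bound for every coupling. Subtracting
  the contribution of \<open>B\<close>, which is maximal for \<open>\<pi>\<close>, gives the claim for \<open>A\<close>. The set \<open>B\<close> is
  described by the kernel and not by \<open>\<Gamma>\<close>, because projections of Borel sets need not be Borel.\<close>
lemma
  fixes v :: "real \<Rightarrow> real" and \<Gamma> :: "(real \<times> real) set"
  assumes \<pi>: "\<pi> \<in> couplings \<eta> \<theta>" and \<pi>': "\<pi>' \<in> couplings \<eta> \<theta>" and fin: "finite_measure \<eta>"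
    and v: "v \<in> borel_measurable borel" and int: "integrable \<theta> v"
    and dis: "disintegrates \<eta> \<pi> \<kappa>" and \<Gamma>: "AE z in \<pi>. z \<in> \<Gamma>"
    and M: "M \<in> sets borel" and A: "A \<in> sets borel"
    and on_M: "\<And>B. B \<in> sets borel \<Longrightarrow> B \<subseteq> M \<Longrightarrow>
      (\<integral>z. indicator B (fst z) * v (snd z) \<partial>\<pi>') \<le> (\<integral>z. indicator B (fst z) * v (snd z) \<partial>\<pi>)"
    and first: "\<And>x1 y1 x2 y2. (x1, y1) \<in> \<Gamma> \<Longrightarrow> (x2, y2) \<in> \<Gamma> \<Longrightarrow> x1 \<in> A \<Longrightarrow> x2 \<notin> A \<Longrightarrow> x2 \<notin> M \<Longrightarrow>
      v y1 \<le> v y2"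
    and second: "\<And>x y1 y2 x' y'. (x, y1) \<in> \<Gamma> \<Longrightarrow> (x, y2) \<in> \<Gamma> \<Longrightarrow> (x', y') \<in> \<Gamma> \<Longrightarrow> x \<notin> A \<Longrightarrow> x' \<in> A \<Longrightarrow>
      \<not> (v y1 < v y' \<and> v y' < v y2)"
  shows threshold_le:
      "(\<integral>z. indicator A (fst z) * v (snd z) \<partial>\<pi>) \<le> (\<integral>z. indicator A (fst z) * v (snd z) \<partial>\<pi>')"
    and threshold_complement_ge:
      "(\<integral>z. indicator (- A) (fst z) * v (snd z) \<partial>\<pi>') \<le> (\<integral>z. indicator (- A) (fst z) * v (snd z) \<partial>\<pi>)"
proof -
  note [measurable_cong] = couplings_sets[OF \<pi>] couplings_sets[OF \<pi>'] couplings_sets_fst[OF \<pi>]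
    disintegrates_kernel(3)[OF dis]
  note [measurable] = v A M disintegrates_kernel(1)[OF dis]
  interpret \<pi>: finite_measure \<pi> using couplings_finite_measure[OF \<pi> fin] .
  interpret \<pi>': finite_measure \<pi>' using couplings_finite_measure[OF \<pi>' fin] .
  let ?I = "\<lambda>\<rho> B. \<integral>z. indicator B (fst z) * v (snd z) \<partial>\<rho>"
  have i: "integrable \<rho> (\<lambda>z. indicator B (fst z) * v (snd z))"
    if "\<rho> \<in> couplings \<eta> \<theta>" "B \<in> sets borel" for \<rho> B
    using integrable_coupling_indicator[OF that(1) int v that(2)] .
  have iv: "integrable \<rho> (\<lambda>z. v (snd z))" "(\<integral>z. v (snd z) \<partial>\<rho>) = (\<integral>y. v y \<partial>\<theta>)"
    if "\<rho> \<in> couplings \<eta> \<theta>" for \<rho>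
    using integrable_coupling_snd[OF that v] int integral_coupling_snd[OF that v] by blast+
  have compl: "?I \<rho> (- B) = (\<integral>y. v y \<partial>\<theta>) - ?I \<rho> B" if "\<rho> \<in> couplings \<eta> \<theta>" "B \<in> sets borel" for \<rho> B
  proof -
    have "?I \<rho> (- B) = (\<integral>z. v (snd z) - indicator B (fst z) * v (snd z) \<partial>\<rho>)"
      by (intro Bochner_Integration.integral_cong) (auto simp: indicator_def)
    also have "\<dots> = (\<integral>y. v y \<partial>\<theta>) - ?I \<rho> B"
      using i[OF that] iv[OF that(1)] by (subst Bochner_Integration.integral_diff) auto
    finally show ?thesis .
  qed
  show le: "?I \<pi> A \<le> ?I \<pi>' A"
  proof -
    define S where "S = {v y | x y. (x, y) \<in> \<Gamma> \<and> x \<in> A}"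
    have SI: "v y \<in> S" if "(x, y) \<in> \<Gamma>" "x \<in> A" for x y using that by (auto simp: S_def)
    show ?thesis
    proof (cases "S \<noteq> {} \<and> bdd_above S")
      case False
      \<comment> \<open>Then almost surely \<open>x \<notin> A\<close>, or almost surely \<open>x \<in> A \<union> M\<close>.\<close>
      have transfer: "AE z in \<pi>'. P (fst z)" if "AE z in \<pi>. P (fst z)" "Measurable.pred borel P" for P
      proof -
        have [measurable]: "Measurable.pred borel P" by fact
        have d: "distr \<pi> borel fst = \<eta>" using \<pi> by (simp add: couplings_def)
        have "AE x in distr \<pi> borel fst. P x"
          using that(1) by (subst AE_distr_iff) (auto simp: pred_def)
        then have "AE x in \<eta>. P x" unfolding d .
        then show ?thesis by (rule AE_coupling_fst[OF \<pi>'])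
      qed
      show ?thesis
      proof (cases "S = {}")
        case True
        have ae: "AE z in \<pi>. fst z \<notin> A" using \<Gamma>
          by eventually_elim (metis SI True empty_iff prod.collapse)
        have "?I \<pi> A = 0" using ae by (intro integral_eq_zero_AE) (auto elim!: AE_mp)
        moreover have "?I \<pi>' A = 0" using transfer[OF ae]
          by (intro integral_eq_zero_AE) (auto elim!: AE_mp)
        ultimately show ?thesis by simp
      next
        case False
        with \<open>\<not> (S \<noteq> {} \<and> bdd_above S)\<close> have unb: "\<not> bdd_above S" by simp
        have AM: "fst z \<in> A \<union> M" if "z \<in> \<Gamma>" for z
        proof (rule ccontr)
          assume "fst z \<notin> A \<union> M"
          then have "\<forall>s\<in>S. s \<le> v (snd z)"
            using first[of _ _ "fst z" "snd z"] that by (auto simp: S_def)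
          then show False using unb by (auto simp: bdd_above_def)
        qed
        have ae: "AE z in \<pi>. fst z \<in> A \<union> M" using \<Gamma> by eventually_elim (rule AM)
        have "?I \<pi> (- A) = ?I \<pi> (M - A)"
          using ae by (intro integral_cong_AE) (auto simp: indicator_def elim!: AE_mp)
        moreover have "?I \<pi>' (- A) = ?I \<pi>' (M - A)"
          using transfer[OF ae] by (intro integral_cong_AE) (auto simp: indicator_def elim!: AE_mp)
        moreover have "?I \<pi>' (M - A) \<le> ?I \<pi> (M - A)" by (intro on_M) auto
        ultimately show ?thesis using compl[OF \<pi> A] compl[OF \<pi>' A] by linarith
      qed
    next
      case True
      define q where "q = Sup S"
      define B where "B = {x \<in> M - A. (\<integral>\<^sup>+y. indicator {y. q < v y} y \<partial>\<kappa> x) = 0}"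
      have q: "v y \<le> q" if "(x, y) \<in> \<Gamma>" "x \<in> A" for x y
        using cSup_upper[OF SI[OF that]] True by (simp add: q_def)
      have q_least: "q \<le> c" if "\<And>x y. (x, y) \<in> \<Gamma> \<Longrightarrow> x \<in> A \<Longrightarrow> v y \<le> c" for c
        unfolding q_def using True that by (intro cSup_least) (auto simp: S_def)
      have [measurable]: "(\<lambda>x. \<integral>\<^sup>+y. indicator {y. q < v y} y \<partial>\<kappa> x) \<in> borel_measurable borel"
        by (rule nn_integral_measurable_subprob_algebra2[where N=borel]) measurable
      have [measurable]: "B \<in> sets borel" unfolding B_def by measurable
      have AB: "A \<inter> B = {}" "B \<subseteq> M" by (auto simp: B_def)
      \<comment> \<open>Almost surely the level \<open>q\<close> separates \<open>v y\<close> according to whether \<open>x \<in> A \<union> B\<close>.\<close>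
      have sep: "AE x in \<eta>. AE y in \<kappa> x. (x \<in> A \<union> B \<longrightarrow> v y \<le> q) \<and> (x \<notin> A \<union> B \<longrightarrow> q \<le> v y)"
        using AE_disintegrates[OF dis \<pi> \<Gamma>]
      proof (rule AE_mp, intro AE_I2[of \<eta>] impI)
        fix x assume \<Gamma>x: "AE y in \<kappa> x. (x, y) \<in> \<Gamma>"
        have B_ae: "(\<integral>\<^sup>+y. indicator {y. q < v y} y \<partial>\<kappa> x) = 0 \<longleftrightarrow> (AE y in \<kappa> x. v y \<le> q)"
          by (subst nn_integral_0_iff_AE) (auto simp: indicator_def not_less intro!: AE_cong)
        consider "x \<in> A" | "x \<in> B" | "x \<notin> A" "x \<notin> M" | "x \<notin> A" "x \<in> M" "x \<notin> B" by (auto simp: B_def)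
        then show "AE y in \<kappa> x. (x \<in> A \<union> B \<longrightarrow> v y \<le> q) \<and> (x \<notin> A \<union> B \<longrightarrow> q \<le> v y)"
        proof cases
          case 1
          then show ?thesis using \<Gamma>x q by (auto elim!: AE_mp)
        next
          case 2
          then have "AE y in \<kappa> x. v y \<le> q" using B_ae by (simp add: B_def)
          then show ?thesis using 2 by (auto elim!: AE_mp)
        next
          case 3
          then have "x \<notin> A \<union> B" by (auto simp: B_def)
          moreover have "q \<le> v y" if "(x, y) \<in> \<Gamma>" for y
            using first[OF _ that] 3 by (intro q_least) auto
          ultimately show ?thesis using \<Gamma>x by (auto elim!: AE_mp)
        next
          case 4
          then have "\<not> (AE y in \<kappa> x. v y \<le> q)" using B_ae by (auto simp: B_def)
          obtain y2 where y2: "(x, y2) \<in> \<Gamma>" "q < v y2"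
          proof (rule ccontr)
            assume "\<not> thesis"
            then have below: "v y \<le> q" if "(x, y) \<in> \<Gamma>" for y
              using \<open>\<And>y2. (x, y2) \<in> \<Gamma> \<Longrightarrow> q < v y2 \<Longrightarrow> thesis\<close> that by force
            have "AE y in \<kappa> x. v y \<le> q"
              using \<Gamma>x by eventually_elim (rule below)
            then show False using \<open>\<not> (AE y in \<kappa> x. v y \<le> q)\<close> by simp
          qed
          \<comment> \<open>A value \<open>v y < q\<close> would leave some \<open>v y'\<close> with \<open>x' \<in> A\<close> strictly between \<open>v y\<close> and \<open>v y2\<close>.\<close>
          have "q \<le> v y" if "(x, y) \<in> \<Gamma>" for y
          proof (rule q_least, rule ccontr)
            fix x' y' assume *: "(x', y') \<in> \<Gamma>" "x' \<in> A" "\<not> v y' \<le> v y"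
            then show False using second[OF that y2(1) *(1) _ *(2)] 4 q[OF *(1,2)] y2(2) by auto
          qed
          then show ?thesis using 4 \<Gamma>x by (auto elim!: AE_mp)
        qed
      qed
      \<comment> \<open>The exceptional set is Borel, so the separation passes from the kernels to \<open>\<pi>\<close>.\<close>
      have sep\<pi>: "AE z in \<pi>. (fst z \<in> A \<union> B \<longrightarrow> v (snd z) \<le> q) \<and> (fst z \<notin> A \<union> B \<longrightarrow> q \<le> v (snd z))"
        (is "AE z in \<pi>. ?Q z")
      proof -
        have "{z \<in> space (borel \<Otimes>\<^sub>M borel). \<not> ?Q z} \<in> sets (borel \<Otimes>\<^sub>M borel)" by measurable
        then have m: "{z. \<not> ?Q z} \<in> sets (borel \<Otimes>\<^sub>M borel)" by (simp add: space_pair_measure)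
        have "(\<integral>\<^sup>+z. indicator {z. \<not> ?Q z} z \<partial>\<pi>) = (\<integral>\<^sup>+x. (\<integral>\<^sup>+y. indicator {z. \<not> ?Q z} (x, y) \<partial>\<kappa> x) \<partial>\<eta>)"
          by (rule nn_integral_disintegrates[OF dis \<pi>]) (use m in measurable)
        also have "\<dots> = (\<integral>\<^sup>+x. 0 \<partial>\<eta>)"
        proof (rule nn_integral_cong_AE, rule AE_mp[OF sep], rule AE_I2, rule impI)
          fix x assume "AE y in \<kappa> x. (x \<in> A \<union> B \<longrightarrow> v y \<le> q) \<and> (x \<notin> A \<union> B \<longrightarrow> q \<le> v y)"
          then have "AE y in \<kappa> x. indicator {z. \<not> ?Q z} (x, y) = (0 :: ennreal)"
            by (rule AE_mp) (auto simp: indicator_def)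
          then show "(\<integral>\<^sup>+y. indicator {z. \<not> ?Q z} (x, y) \<partial>\<kappa> x) = (0::ennreal)"
            by (simp add: nn_integral_cong_AE)
        qed
        finally have "(\<integral>\<^sup>+z. indicator {z. \<not> ?Q z} z \<partial>\<pi>) = 0" by simp
        moreover have m': "{z. \<not> ?Q z} \<in> sets \<pi>" unfolding couplings_sets[OF \<pi>] by (rule m)
        ultimately have "emeasure \<pi> {z. \<not> ?Q z} = 0" by (simp only: nn_integral_indicator)
        then show ?thesis by (intro AE_I[OF _ _ m']) auto
      qed
      have shift: "(\<integral>z. indicator (A \<union> B) (fst z) * (v (snd z) - q) \<partial>\<rho>) =
          ?I \<rho> A + ?I \<rho> B - q * measure \<eta> (A \<union> B)"
        if \<rho>: "\<rho> \<in> couplings \<eta> \<theta>" for \<rho>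
      proof -
        have "(\<integral>z. indicator (A \<union> B) (fst z) * (v (snd z) - q) \<partial>\<rho>) =
          (\<integral>z. (indicator A (fst z) * v (snd z) + indicator B (fst z) * v (snd z)) - q * indicator (A \<union> B) (fst z) \<partial>\<rho>)"
          using AB(1) by (intro Bochner_Integration.integral_cong) (auto simp: indicator_def)
        also have "\<dots> = ?I \<rho> A + ?I \<rho> B - q * (\<integral>z. indicator (A \<union> B) (fst z) \<partial>\<rho>)"
        proof -
          have "integrable \<rho> (\<lambda>z. indicator (A \<union> B) (fst z) :: real)"
            using integrable_coupling_fst[OF \<rho>, of "indicator (A \<union> B)"] fin
            by (simp add: couplings_sets_fst[OF \<pi>] finite_measure.emeasure_eq_measure)
          then show ?thesis using i[OF \<rho>, of A] i[OF \<rho>, of B] by simp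
        qed
        also have "(\<integral>z. indicator (A \<union> B) (fst z) \<partial>\<rho>) = measure \<eta> (A \<union> B)"
          using integral_coupling_fst[OF \<rho>, of "indicator (A \<union> B)"] sets_eq_imp_space_eq[OF couplings_sets_fst[OF \<pi>]]
          by simp
        finally show ?thesis .
      qed
      have imin: "integrable \<rho> (\<lambda>z. min (v (snd z) - q) 0)"
        "(\<integral>z. min (v (snd z) - q) 0 \<partial>\<rho>) = (\<integral>y. min (v y - q) 0 \<partial>\<theta>)"
        and iAB: "integrable \<rho> (\<lambda>z. indicator (A \<union> B) (fst z) * (v (snd z) - q))"
        if \<rho>: "\<rho> \<in> couplings \<eta> \<theta>" for \<rho>
      proof -
        note [measurable_cong] = couplings_sets[OF \<rho>]
        interpret finite_measure \<rho> using couplings_finite_measure[OF \<rho> fin] .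
        have iq: "integrable \<rho> (\<lambda>z. v (snd z) - q)" using iv(1)[OF \<rho>] by auto
        show "integrable \<rho> (\<lambda>z. min (v (snd z) - q) 0)"
          using iq by (rule Bochner_Integration.integrable_bound) auto
        show "integrable \<rho> (\<lambda>z. indicator (A \<union> B) (fst z) * (v (snd z) - q))"
          using iq by (rule Bochner_Integration.integrable_bound) (auto simp: indicator_def)
        show "(\<integral>z. min (v (snd z) - q) 0 \<partial>\<rho>) = (\<integral>y. min (v y - q) 0 \<partial>\<theta>)"
          using integral_coupling_snd[OF \<rho>, of "\<lambda>y. min (v y - q) 0"] by simp
      qed
      have "(\<integral>z. indicator (A \<union> B) (fst z) * (v (snd z) - q) \<partial>\<pi>) = (\<integral>z. min (v (snd z) - q) 0 \<partial>\<pi>)"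
        using sep\<pi> by (intro integral_cong_AE) (auto simp: indicator_def elim!: AE_mp)
      also have "\<dots> = (\<integral>z. min (v (snd z) - q) 0 \<partial>\<pi>')"
        using imin(2)[OF \<pi>] imin(2)[OF \<pi>'] by simp
      also have "\<dots> \<le> (\<integral>z. indicator (A \<union> B) (fst z) * (v (snd z) - q) \<partial>\<pi>')"
        using imin(1)[OF \<pi>'] iAB[OF \<pi>'] by (intro integral_mono) (auto simp: indicator_def)
      finally have "?I \<pi> A + ?I \<pi> B \<le> ?I \<pi>' A + ?I \<pi>' B"
        using shift[OF \<pi>] shift[OF \<pi>'] by simp
      moreover have "?I \<pi>' B \<le> ?I \<pi> B" using AB(2) by (intro on_M) auto
      ultimately show ?thesis by simp
    qed
  qed
  show "?I \<pi>' (- A) \<le> ?I \<pi> (- A)"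
    using le compl[OF \<pi> A] compl[OF \<pi>' A] by simp
qed

section \<open>Extremality of the canonical couplings\<close>

lemma integral_indicator_snd:
  assumes dis: "disintegrates \<eta> \<pi> \<kappa>" and \<pi>: "\<pi> \<in> couplings \<eta> \<theta>"
    and int: "integrable \<theta> (\<lambda>y. y)" and B: "B \<in> sets borel"
  shows "(\<integral>z. indicator B (fst z) * snd z \<partial>\<pi>) = (\<integral>x. indicator B x * barycenter \<kappa> x \<partial>\<eta>)"
    and "integrable \<eta> (\<lambda>x. indicator B x * barycenter \<kappa> x)"
  using integral_barycenter_mult[OF dis \<pi> int, of "indicator B" 1]
    integrable_barycenter_mult[OF dis \<pi> int, of "indicator B" 1] B
  by (auto simp: indicator_def)

lemma integrable_indicator_ident:
  assumes "integrable \<eta> (\<lambda>x. x)" "sets \<eta> = sets borel" "B \<in> sets borel"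
  shows "integrable \<eta> (\<lambda>x. indicator B x * x :: real)"
  using integrable_real_mult_indicator[of B \<eta> "\<lambda>x. x"] assms by (simp add: mult.commute)

lemma supermartingale_couplings_integral_le:
  assumes \<pi>: "\<pi> \<in> supermartingale_couplings \<eta> \<theta>"
    and int: "integrable \<eta> (\<lambda>x. x)" "integrable \<theta> (\<lambda>y. y)" and B: "B \<in> sets borel"
  shows "(\<integral>z. indicator B (fst z) * snd z \<partial>\<pi>) \<le> (\<integral>x. indicator B x * x \<partial>\<eta>)"
proof -
  obtain \<kappa> where c: "\<pi> \<in> couplings \<eta> \<theta>" and d: "disintegrates \<eta> \<pi> \<kappa>"
    and ae: "AE x in \<eta>. barycenter \<kappa> x \<le> x"
    using \<pi> by (auto simp: supermartingale_couplings_def)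
  show ?thesis unfolding integral_indicator_snd(1)[OF d c int(2) B]
    using ae by (intro integral_mono_AE integral_indicator_snd(2)[OF d c int(2) B]
      integrable_indicator_ident int(1) B couplings_sets_fst[OF c]) (auto elim!: AE_mp simp: indicator_def)
qed

lemma submartingale_couplings_integral_ge:
  assumes \<pi>: "\<pi> \<in> submartingale_couplings \<eta> \<theta>"
    and int: "integrable \<eta> (\<lambda>x. x)" "integrable \<theta> (\<lambda>y. y)" and B: "B \<in> sets borel"
  shows "(\<integral>x. indicator B x * x \<partial>\<eta>) \<le> (\<integral>z. indicator B (fst z) * snd z \<partial>\<pi>)"
proof -
  obtain \<kappa> where c: "\<pi> \<in> couplings \<eta> \<theta>" and d: "disintegrates \<eta> \<pi> \<kappa>"
    and ae: "AE x in \<eta>. x \<le> barycenter \<kappa> x"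
    using \<pi> by (auto simp: submartingale_couplings_def)
  show ?thesis unfolding integral_indicator_snd(1)[OF d c int(2) B]
    using ae by (intro integral_mono_AE integral_indicator_snd(2)[OF d c int(2) B]
      integrable_indicator_ident int(1) B couplings_sets_fst[OF c]) (auto elim!: AE_mp simp: indicator_def)
qed

lemma carried_by_integral_eq:
  assumes \<pi>: "\<pi> \<in> couplings \<eta> \<theta>" and car: "carried_by \<eta> \<pi> \<Gamma> M"
    and int: "integrable \<theta> (\<lambda>y. y)" and B: "B \<in> sets borel" "B \<subseteq> M"
  shows "(\<integral>z. indicator B (fst z) * snd z \<partial>\<pi>) = (\<integral>x. indicator B x * x \<partial>\<eta>)"
proof -
  obtain \<kappa> where d: "disintegrates \<eta> \<pi> \<kappa>" and ae: "AE x in \<eta>. x \<in> M \<longrightarrow> barycenter \<kappa> x = x"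
    using car by (auto simp: carried_by_def)
  note [measurable_cong] = couplings_sets_fst[OF \<pi>]
  note [measurable] = borel_measurable_barycenter[OF d] B(1)
  show ?thesis unfolding integral_indicator_snd(1)[OF d \<pi> int B(1)]
    using ae B(2) by (intro integral_cong_AE) (auto elim!: AE_mp simp: indicator_def)
qed

lemma integral_indicator_affine:
  fixes c d :: real
  assumes \<pi>: "\<pi> \<in> couplings \<eta> \<theta>" and fin: "finite_measure \<eta>"
    and int: "integrable \<theta> (\<lambda>y. y)" and B: "B \<in> sets borel"
  shows "(\<integral>z. indicator B (fst z) * (c * snd z + d) \<partial>\<pi>) =
    c * (\<integral>z. indicator B (fst z) * snd z \<partial>\<pi>) + d * measure \<eta> B"
proof -
  have i1: "integrable \<pi> (\<lambda>z. indicator B (fst z) * snd z)"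
    using integrable_coupling_indicator[OF \<pi> int _ B] by simp
  have i2: "integrable \<pi> (\<lambda>z. indicator B (fst z) :: real)"
    using integrable_coupling_fst[OF \<pi>, of "indicator B"] fin B
    by (simp add: couplings_sets_fst[OF \<pi>] finite_measure.emeasure_eq_measure)
  have m: "(\<integral>z. indicator B (fst z) \<partial>\<pi>) = measure \<eta> B"
    using integral_coupling_fst[OF \<pi>, of "indicator B"] B
      sets_eq_imp_space_eq[OF couplings_sets_fst[OF \<pi>]] by simp
  have "(\<integral>z. indicator B (fst z) * (c * snd z + d) \<partial>\<pi>) =
    (\<integral>z. c * (indicator B (fst z) * snd z) + d * indicator B (fst z) \<partial>\<pi>)"
    by (simp add: algebra_simps)
  also have "\<dots> = c * (\<integral>z. indicator B (fst z) * snd z \<partial>\<pi>) + d * measure \<eta> B"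
    using i1 i2 m by simp
  finally show ?thesis .
qed

text \<open>With \<open>v y = y - b\<close>, the increasing coupling is compared on the upper level sets \<open>{x. x > b + t}\<close>
  directly. For the decreasing coupling the monotonicity conditions fit the lower level sets, and
  the complementary form of the comparison yields the reverse inequality on the upper ones. Both
  need \<open>y \<ge> b\<close> for the layer cake formula.\<close>
lemma
  fixes b :: real
  assumes fin: "finite_measure \<eta>" "finite_measure \<theta>"
    and int: "integrable \<eta> (\<lambda>x. x)" "integrable \<theta> (\<lambda>y. y)" and above: "AE y in \<theta>. b \<le> y"
    and \<pi>': "\<pi>' \<in> supermartingale_couplings \<eta> \<theta>"
  shows increasing_supermartingale_coupling_le:
    "increasing_supermartingale_coupling \<eta> \<theta> \<pi> \<Longrightarrow>
      (\<integral>\<^sup>+z. ennreal ((fst z - b) * (snd z - b)) \<partial>\<pi>) \<le> (\<integral>\<^sup>+z. ennreal ((fst z - b) * (snd z - b)) \<partial>\<pi>')"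
    and decreasing_supermartingale_coupling_ge:
    "decreasing_supermartingale_coupling \<eta> \<theta> \<pi> \<Longrightarrow>
      (\<integral>\<^sup>+z. ennreal ((fst z - b) * (snd z - b)) \<partial>\<pi>') \<le> (\<integral>\<^sup>+z. ennreal ((fst z - b) * (snd z - b)) \<partial>\<pi>)"
proof -
  have c': "\<pi>' \<in> couplings \<eta> \<theta>" using \<pi>' by (simp add: supermartingale_couplings_def)
  have iv: "integrable \<theta> (\<lambda>y. y - b)" using int(2) fin(2) by (auto simp: finite_measure.integrable_const)
  have on_M: "(\<integral>z. indicator B (fst z) * (snd z - b) \<partial>\<pi>') \<le> (\<integral>z. indicator B (fst z) * (snd z - b) \<partial>\<pi>)"
    if "\<pi> \<in> couplings \<eta> \<theta>" "carried_by \<eta> \<pi> \<Gamma> M" "B \<in> sets borel" "B \<subseteq> M" for \<pi> \<Gamma> M B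
    using supermartingale_couplings_integral_le[OF \<pi>' int that(3)]
      carried_by_integral_eq[OF that(1,2) int(2) that(3,4)]
      integral_indicator_affine[OF c' fin(1) int(2) that(3), of 1 "-b"]
      integral_indicator_affine[OF that(1) fin(1) int(2) that(3), of 1 "-b"] by simp
  show "(\<integral>\<^sup>+z. ennreal ((fst z - b) * (snd z - b)) \<partial>\<pi>) \<le> (\<integral>\<^sup>+z. ennreal ((fst z - b) * (snd z - b)) \<partial>\<pi>')"
    if inc: "increasing_supermartingale_coupling \<eta> \<theta> \<pi>"
  proof -
    obtain \<Gamma> M where c: "\<pi> \<in> couplings \<eta> \<theta>" and m: "super_first_order_right_monotone \<Gamma> M"
      "second_order_left_monotone \<Gamma>" and car: "carried_by \<eta> \<pi> \<Gamma> M"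
      using inc by (auto simp: increasing_supermartingale_coupling_def supermartingale_couplings_def)
    obtain \<kappa> where k: "disintegrates \<eta> \<pi> \<kappa>" "AE z in \<pi>. z \<in> \<Gamma>" "M \<in> sets borel"
      using car by (auto simp: carried_by_def)
    show ?thesis
    proof (rule layer_cake_mono[OF c c' fin(1) _ _ iv])
      fix t
      show "(\<integral>z. indicator {x. t < x - b} (fst z) * (snd z - b) \<partial>\<pi>)
        \<le> (\<integral>z. indicator {x. t < x - b} (fst z) * (snd z - b) \<partial>\<pi>')"
      proof (rule threshold_le[OF c c' fin(1) _ iv k])
        fix x1 y1 x2 y2 assume "(x1, y1) \<in> \<Gamma>" "(x2, y2) \<in> \<Gamma>" "x1 \<in> {x. t < x - b}" "x2 \<notin> {x. t < x - b}" "x2 \<notin> M"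
        then show "y1 - b \<le> y2 - b"
          using m(1)[unfolded super_first_order_right_monotone_def, rule_format, of x2 y2 x1 y1] by auto
      next
        fix x y1 y2 x' y' assume "(x, y1) \<in> \<Gamma>" "(x, y2) \<in> \<Gamma>" "(x', y') \<in> \<Gamma>"
          "x \<notin> {x. t < x - b}" "x' \<in> {x. t < x - b}"
        then show "\<not> (y1 - b < y' - b \<and> y' - b < y2 - b)"
          using m(2)[unfolded second_order_left_monotone_def, rule_format, of x y1 y2 x' y'] by auto
      qed (use on_M[OF c car] in auto)
    qed (use above in auto)
  qed
  show "(\<integral>\<^sup>+z. ennreal ((fst z - b) * (snd z - b)) \<partial>\<pi>') \<le> (\<integral>\<^sup>+z. ennreal ((fst z - b) * (snd z - b)) \<partial>\<pi>)"
    if dec: "decreasing_supermartingale_coupling \<eta> \<theta> \<pi>"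
  proof -
    obtain \<Gamma> M where c: "\<pi> \<in> couplings \<eta> \<theta>" and m: "super_first_order_left_monotone \<Gamma> M"
      "second_order_right_monotone \<Gamma>" and car: "carried_by \<eta> \<pi> \<Gamma> M"
      using dec by (auto simp: decreasing_supermartingale_coupling_def supermartingale_couplings_def)
    obtain \<kappa> where k: "disintegrates \<eta> \<pi> \<kappa>" "AE z in \<pi>. z \<in> \<Gamma>" "M \<in> sets borel"
      using car by (auto simp: carried_by_def)
    show ?thesis
    proof (rule layer_cake_mono[OF c' c fin(1) _ _ iv])
      fix t
      have "(\<integral>z. indicator (- {x. x - b \<le> t}) (fst z) * (snd z - b) \<partial>\<pi>')
        \<le> (\<integral>z. indicator (- {x. x - b \<le> t}) (fst z) * (snd z - b) \<partial>\<pi>)"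
      proof (rule threshold_complement_ge[OF c c' fin(1) _ iv k])
        fix x1 y1 x2 y2 assume "(x1, y1) \<in> \<Gamma>" "(x2, y2) \<in> \<Gamma>" "x1 \<in> {x. x - b \<le> t}" "x2 \<notin> {x. x - b \<le> t}" "x2 \<notin> M"
        then show "y1 - b \<le> y2 - b"
          using m(1)[unfolded super_first_order_left_monotone_def, rule_format, of x1 y1 x2 y2] by auto
      next
        fix x y1 y2 x' y' assume "(x, y1) \<in> \<Gamma>" "(x, y2) \<in> \<Gamma>" "(x', y') \<in> \<Gamma>"
          "x \<notin> {x. x - b \<le> t}" "x' \<in> {x. x - b \<le> t}"
        then show "\<not> (y1 - b < y' - b \<and> y' - b < y2 - b)"
          using m(2)[unfolded second_order_right_monotone_def, rule_format, of x y1 y2 x' y'] by auto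
      qed (use on_M[OF c car] in auto)
      moreover have "- {x. x - b \<le> t} = {x. t < x - b}" by auto
      ultimately show "(\<integral>z. indicator {x. t < x - b} (fst z) * (snd z - b) \<partial>\<pi>')
        \<le> (\<integral>z. indicator {x. t < x - b} (fst z) * (snd z - b) \<partial>\<pi>)" by simp
    qed (use above in auto)
  qed
qed

text \<open>The mirror image, with \<open>v y = a - y\<close> and level sets of \<open>a - x\<close>. Reflection exchanges left and
  right monotonicity, which is why here the decreasing coupling is the minimal one.\<close>
lemma
  fixes a :: real
  assumes fin: "finite_measure \<eta>" "finite_measure \<theta>"
    and int: "integrable \<eta> (\<lambda>x. x)" "integrable \<theta> (\<lambda>y. y)" and below: "AE y in \<theta>. y \<le> a"
    and \<pi>': "\<pi>' \<in> submartingale_couplings \<eta> \<theta>"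
  shows decreasing_submartingale_coupling_le:
    "decreasing_submartingale_coupling \<eta> \<theta> \<pi> \<Longrightarrow>
      (\<integral>\<^sup>+z. ennreal ((a - fst z) * (a - snd z)) \<partial>\<pi>) \<le> (\<integral>\<^sup>+z. ennreal ((a - fst z) * (a - snd z)) \<partial>\<pi>')"
    and increasing_submartingale_coupling_ge:
    "increasing_submartingale_coupling \<eta> \<theta> \<pi> \<Longrightarrow>
      (\<integral>\<^sup>+z. ennreal ((a - fst z) * (a - snd z)) \<partial>\<pi>') \<le> (\<integral>\<^sup>+z. ennreal ((a - fst z) * (a - snd z)) \<partial>\<pi>)"
proof -
  have c': "\<pi>' \<in> couplings \<eta> \<theta>" using \<pi>' by (simp add: submartingale_couplings_def)
  have iv: "integrable \<theta> (\<lambda>y. a - y)" using int(2) fin(2) by (auto simp: finite_measure.integrable_const)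
  have on_M: "(\<integral>z. indicator B (fst z) * (a - snd z) \<partial>\<pi>') \<le> (\<integral>z. indicator B (fst z) * (a - snd z) \<partial>\<pi>)"
    if "\<pi> \<in> couplings \<eta> \<theta>" "carried_by \<eta> \<pi> \<Gamma> M" "B \<in> sets borel" "B \<subseteq> M" for \<pi> \<Gamma> M B
    using submartingale_couplings_integral_ge[OF \<pi>' int that(3)]
      carried_by_integral_eq[OF that(1,2) int(2) that(3,4)]
      integral_indicator_affine[OF c' fin(1) int(2) that(3), of "-1" a]
      integral_indicator_affine[OF that(1) fin(1) int(2) that(3), of "-1" a] by simp
  show "(\<integral>\<^sup>+z. ennreal ((a - fst z) * (a - snd z)) \<partial>\<pi>) \<le> (\<integral>\<^sup>+z. ennreal ((a - fst z) * (a - snd z)) \<partial>\<pi>')"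
    if dec: "decreasing_submartingale_coupling \<eta> \<theta> \<pi>"
  proof -
    obtain \<Gamma> M where c: "\<pi> \<in> couplings \<eta> \<theta>" and m: "sub_first_order_right_monotone \<Gamma> M"
      "second_order_right_monotone \<Gamma>" and car: "carried_by \<eta> \<pi> \<Gamma> M"
      using dec by (auto simp: decreasing_submartingale_coupling_def submartingale_couplings_def)
    obtain \<kappa> where k: "disintegrates \<eta> \<pi> \<kappa>" "AE z in \<pi>. z \<in> \<Gamma>" "M \<in> sets borel"
      using car by (auto simp: carried_by_def)
    show ?thesis
    proof (rule layer_cake_mono[OF c c' fin(1) _ _ iv])
      fix t
      show "(\<integral>z. indicator {x. t < a - x} (fst z) * (a - snd z) \<partial>\<pi>)
        \<le> (\<integral>z. indicator {x. t < a - x} (fst z) * (a - snd z) \<partial>\<pi>')"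
      proof (rule threshold_le[OF c c' fin(1) _ iv k])
        fix x1 y1 x2 y2 assume "(x1, y1) \<in> \<Gamma>" "(x2, y2) \<in> \<Gamma>" "x1 \<in> {x. t < a - x}" "x2 \<notin> {x. t < a - x}" "x2 \<notin> M"
        then show "a - y1 \<le> a - y2"
          using m(1)[unfolded sub_first_order_right_monotone_def, rule_format, of x1 y1 x2 y2] by auto
      next
        fix x y1 y2 x' y' assume "(x, y1) \<in> \<Gamma>" "(x, y2) \<in> \<Gamma>" "(x', y') \<in> \<Gamma>"
          "x \<notin> {x. t < a - x}" "x' \<in> {x. t < a - x}"
        then show "\<not> (a - y1 < a - y' \<and> a - y' < a - y2)"
          using m(2)[unfolded second_order_right_monotone_def, rule_format, of x y2 y1 x' y'] by auto
      qed (use on_M[OF c car] in auto)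
    qed (use below in auto)
  qed
  show "(\<integral>\<^sup>+z. ennreal ((a - fst z) * (a - snd z)) \<partial>\<pi>') \<le> (\<integral>\<^sup>+z. ennreal ((a - fst z) * (a - snd z)) \<partial>\<pi>)"
    if inc: "increasing_submartingale_coupling \<eta> \<theta> \<pi>"
  proof -
    obtain \<Gamma> M where c: "\<pi> \<in> couplings \<eta> \<theta>" and m: "sub_first_order_left_monotone \<Gamma> M"
      "second_order_left_monotone \<Gamma>" and car: "carried_by \<eta> \<pi> \<Gamma> M"
      using inc by (auto simp: increasing_submartingale_coupling_def submartingale_couplings_def)
    obtain \<kappa> where k: "disintegrates \<eta> \<pi> \<kappa>" "AE z in \<pi>. z \<in> \<Gamma>" "M \<in> sets borel"
      using car by (auto simp: carried_by_def)
    show ?thesis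
    proof (rule layer_cake_mono[OF c' c fin(1) _ _ iv])
      fix t
      have "(\<integral>z. indicator (- {x. a - x \<le> t}) (fst z) * (a - snd z) \<partial>\<pi>')
        \<le> (\<integral>z. indicator (- {x. a - x \<le> t}) (fst z) * (a - snd z) \<partial>\<pi>)"
      proof (rule threshold_complement_ge[OF c c' fin(1) _ iv k])
        fix x1 y1 x2 y2 assume "(x1, y1) \<in> \<Gamma>" "(x2, y2) \<in> \<Gamma>" "x1 \<in> {x. a - x \<le> t}" "x2 \<notin> {x. a - x \<le> t}" "x2 \<notin> M"
        then show "a - y1 \<le> a - y2"
          using m(1)[unfolded sub_first_order_left_monotone_def, rule_format, of x2 y2 x1 y1] by auto
      next
        fix x y1 y2 x' y' assume "(x, y1) \<in> \<Gamma>" "(x, y2) \<in> \<Gamma>" "(x', y') \<in> \<Gamma>"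
          "x \<notin> {x. a - x \<le> t}" "x' \<in> {x. a - x \<le> t}"
        then show "\<not> (a - y1 < a - y' \<and> a - y' < a - y2)"
          using m(2)[unfolded second_order_left_monotone_def, rule_format, of x y2 y1 x' y'] by auto
      qed (use on_M[OF c car] in auto)
      moreover have "- {x. a - x \<le> t} = {x. t < a - x}" by auto
      ultimately show "(\<integral>z. indicator {x. t < a - x} (fst z) * (a - snd z) \<partial>\<pi>')
        \<le> (\<integral>z. indicator {x. t < a - x} (fst z) * (a - snd z) \<partial>\<pi>)" by simp
    qed (use below in auto)
  qed
qed

section \<open>The mean deviation of barycenters\<close>

text \<open>With \<open>s\<close> the sign of \<open>x - k\<close> and \<open>\<beta>\<close> the barycenter, \<open>\<integral>s x * \<beta> x \<mu>(dx) = \<integral>s x * y \<pi>(dx, dy)\<close>. Hence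
  the difference of both sides of the inequality is the sum of the integrals of the nonnegative
  functions \<open>\<bar>x - \<beta> x\<bar> - s x * (x - \<beta> x)\<close> and \<open>\<bar>y - k\<bar> - s x * (y - k)\<close>. Equality means that both vanish
  almost everywhere.\<close>
lemma
  fixes k :: real
  assumes \<pi>: "\<pi> \<in> couplings \<mu> \<nu>" and dis: "disintegrates \<mu> \<pi> \<kappa>" and fin: "finite_measure \<mu>"
    and int: "integrable \<mu> (\<lambda>x. x)" "integrable \<nu> (\<lambda>y. y)"
  shows mean_deviation_ge:
      "(\<integral>x. \<bar>x - k\<bar> \<partial>\<mu>) - (\<integral>y. \<bar>y - k\<bar> \<partial>\<nu>) \<le> (\<integral>x. \<bar>x - barycenter \<kappa> x\<bar> \<partial>\<mu>)"
    and mean_deviation_eq_iff: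
      "(\<integral>x. \<bar>x - barycenter \<kappa> x\<bar> \<partial>\<mu>) = (\<integral>x. \<bar>x - k\<bar> \<partial>\<mu>) - (\<integral>y. \<bar>y - k\<bar> \<partial>\<nu>) \<longleftrightarrow>
        (AE x in \<mu>. (x < k \<longrightarrow> x \<le> barycenter \<kappa> x) \<and> (k \<le> x \<longrightarrow> barycenter \<kappa> x \<le> x)) \<and>
        (AE z in \<pi>. (fst z < k \<longrightarrow> snd z \<le> k) \<and> (k \<le> fst z \<longrightarrow> k \<le> snd z))"
proof -
  note [measurable_cong] = couplings_sets[OF \<pi>] couplings_sets_fst[OF \<pi>] couplings_sets_snd[OF \<pi>]
  note [measurable] = borel_measurable_barycenter[OF dis]
  interpret \<mu>: finite_measure \<mu> by fact
  interpret \<pi>: finite_measure \<pi> using couplings_finite_measure[OF \<pi> fin] .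
  define s where "s x = (if x < k then - 1 else 1 :: real)" for x
  have [measurable]: "s \<in> borel_measurable borel" unfolding s_def by measurable
  have s: "\<bar>s x\<bar> \<le> 1" for x by (simp add: s_def)
  let ?\<beta> = "barycenter \<kappa>"
  have i\<beta>: "integrable \<mu> ?\<beta>"
    using integrable_barycenter_mult[OF dis \<pi> int(2), of "\<lambda>_. 1" 1] by simp
  have is\<beta>: "integrable \<mu> (\<lambda>x. s x * ?\<beta> x)"
    and is\<beta>_eq: "(\<integral>x. s x * ?\<beta> x \<partial>\<mu>) = (\<integral>z. s (fst z) * snd z \<partial>\<pi>)"
    and isy: "integrable \<pi> (\<lambda>z. s (fst z) * snd z)"
    using integrable_barycenter_mult[OF dis \<pi> int(2), of s 1] integral_barycenter_mult[OF dis \<pi> int(2), of s 1]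
      integrable_coupling_mult_snd[OF dis \<pi> int(2), of s 1] s by auto
  have isx: "integrable \<mu> (\<lambda>x. s x * x)"
    using int(1) by (rule Bochner_Integration.integrable_bound) (auto simp: s_def)
  have int_s: "integrable \<mu> s"
    by (rule \<mu>.integrable_const_bound[of _ 1]) (auto simp: s_def)
  have is\<pi>: "integrable \<pi> (\<lambda>z. s (fst z))" "(\<integral>z. s (fst z) \<partial>\<pi>) = (\<integral>x. s x \<partial>\<mu>)"
    using integrable_coupling_fst[OF \<pi>, of s] integral_coupling_fst[OF \<pi>, of s] int_s by auto
  have ik: "integrable \<mu> (\<lambda>x. \<bar>x - k\<bar>)" using int(1) by auto
  have iyk: "integrable \<pi> (\<lambda>z. \<bar>snd z - k\<bar>)" "(\<integral>z. \<bar>snd z - k\<bar> \<partial>\<pi>) = (\<integral>y. \<bar>y - k\<bar> \<partial>\<nu>)"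
  proof -
    show "(\<integral>z. \<bar>snd z - k\<bar> \<partial>\<pi>) = (\<integral>y. \<bar>y - k\<bar> \<partial>\<nu>)"
      using integral_coupling_snd[OF \<pi>, of "\<lambda>y. \<bar>y - k\<bar>"] by simp
    have "integrable \<pi> (\<lambda>z. snd z)"
      using integrable_coupling_mult_snd[OF dis \<pi> int(2), of "\<lambda>_. 1" 1] by simp
    then show "integrable \<pi> (\<lambda>z. \<bar>snd z - k\<bar>)" by auto
  qed
  have abs_s: "\<bar>x - k\<bar> = s x * x - k * s x" for x by (auto simp: s_def)
  let ?f = "\<lambda>x. \<bar>x - ?\<beta> x\<bar> - (s x * x - s x * ?\<beta> x)"
  let ?g = "\<lambda>z. \<bar>snd z - k\<bar> - (s (fst z) * snd z - k * s (fst z))"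
  have f: "integrable \<mu> ?f" "0 \<le> ?f x" for x
    using int(1) i\<beta> isx is\<beta> by (auto simp: s_def)
  have g: "integrable \<pi> ?g" "0 \<le> ?g z" for z
    using iyk(1) isy is\<pi>(1) by (auto simp: s_def)
  have intf: "(\<integral>x. ?f x \<partial>\<mu>) = (\<integral>x. \<bar>x - ?\<beta> x\<bar> \<partial>\<mu>) - ((\<integral>x. s x * x \<partial>\<mu>) - (\<integral>x. s x * ?\<beta> x \<partial>\<mu>))"
    using int(1) i\<beta> isx is\<beta> by simp
  have intg: "(\<integral>z. ?g z \<partial>\<pi>) = (\<integral>y. \<bar>y - k\<bar> \<partial>\<nu>) - ((\<integral>z. s (fst z) * snd z \<partial>\<pi>) - k * (\<integral>x. s x \<partial>\<mu>))"
    using iyk isy is\<pi> by simp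
  have intk: "(\<integral>x. \<bar>x - k\<bar> \<partial>\<mu>) = (\<integral>x. s x * x \<partial>\<mu>) - k * (\<integral>x. s x \<partial>\<mu>)"
    unfolding abs_s using isx int_s by simp
  have split: "(\<integral>x. \<bar>x - ?\<beta> x\<bar> \<partial>\<mu>) - ((\<integral>x. \<bar>x - k\<bar> \<partial>\<mu>) - (\<integral>y. \<bar>y - k\<bar> \<partial>\<nu>)) =
      (\<integral>x. ?f x \<partial>\<mu>) + (\<integral>z. ?g z \<partial>\<pi>)"
    using intf intg intk is\<beta>_eq by simp
  have nn: "0 \<le> (\<integral>x. ?f x \<partial>\<mu>)" "0 \<le> (\<integral>z. ?g z \<partial>\<pi>)"
    using f(2) g(2) by (auto intro!: integral_nonneg_AE)
  show "(\<integral>x. \<bar>x - k\<bar> \<partial>\<mu>) - (\<integral>y. \<bar>y - k\<bar> \<partial>\<nu>) \<le> (\<integral>x. \<bar>x - ?\<beta> x\<bar> \<partial>\<mu>)"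
    using split nn by simp
  have f0: "?f x = 0 \<longleftrightarrow> (x < k \<longrightarrow> x \<le> ?\<beta> x) \<and> (k \<le> x \<longrightarrow> ?\<beta> x \<le> x)" for x
    by (auto simp: s_def)
  have g0: "?g z = 0 \<longleftrightarrow> (fst z < k \<longrightarrow> snd z \<le> k) \<and> (k \<le> fst z \<longrightarrow> k \<le> snd z)" for z
    by (auto simp: s_def)
  have "(\<integral>x. \<bar>x - ?\<beta> x\<bar> \<partial>\<mu>) = (\<integral>x. \<bar>x - k\<bar> \<partial>\<mu>) - (\<integral>y. \<bar>y - k\<bar> \<partial>\<nu>) \<longleftrightarrow>
      (\<integral>x. ?f x \<partial>\<mu>) = 0 \<and> (\<integral>z. ?g z \<partial>\<pi>) = 0"
    using split nn by auto
  also have "\<dots> \<longleftrightarrow> (AE x in \<mu>. ?f x = 0) \<and> (AE z in \<pi>. ?g z = 0)"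
    using f g by (subst (1 2) integral_nonneg_eq_0_iff_AE) auto
  finally show "(\<integral>x. \<bar>x - ?\<beta> x\<bar> \<partial>\<mu>) = (\<integral>x. \<bar>x - k\<bar> \<partial>\<mu>) - (\<integral>y. \<bar>y - k\<bar> \<partial>\<nu>) \<longleftrightarrow>
        (AE x in \<mu>. (x < k \<longrightarrow> x \<le> ?\<beta> x) \<and> (k \<le> x \<longrightarrow> ?\<beta> x \<le> x)) \<and>
        (AE z in \<pi>. (fst z < k \<longrightarrow> snd z \<le> k) \<and> (k \<le> fst z \<longrightarrow> k \<le> snd z))"
    unfolding f0 g0 .
qed

section \<open>Where the put gap is attained\<close>

context real_distribution
begin

context
  assumes int: "integrable M (\<lambda>x. x)"
begin

lemma put_fun_integrable: "integrable M (\<lambda>x. max (k - x) 0)"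
  using int by auto

lemma call_fun_eq: "call_fun M k = put_fun M k + (\<integral>x. x \<partial>M) - k"
proof -
  have "call_fun M k = (\<integral>x. max (k - x) 0 + x - k \<partial>M)"
    unfolding call_fun_def by (intro Bochner_Integration.integral_cong) auto
  then show ?thesis using put_fun_integrable int prob_space by (simp add: put_fun_def)
qed

lemma integral_abs_diff_eq: "(\<integral>x. \<bar>x - k\<bar> \<partial>M) = 2 * put_fun M k + (\<integral>x. x \<partial>M) - k"
proof -
  have "(\<integral>x. \<bar>x - k\<bar> \<partial>M) = (\<integral>x. 2 * max (k - x) 0 + x - k \<partial>M)"
    by (intro Bochner_Integration.integral_cong) (auto simp: max_def)
  also have "\<dots> = (\<integral>x. 2 * max (k - x) 0 + x \<partial>M) - (\<integral>x. k \<partial>M)"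
    by (intro Bochner_Integration.integral_diff Bochner_Integration.integrable_add
      integrable_mult_right put_fun_integrable int integrable_const)
  also have "(\<integral>x. 2 * max (k - x) 0 + x \<partial>M) = 2 * put_fun M k + (\<integral>x. x \<partial>M)"
    unfolding put_fun_def integral_mult_right_zero[symmetric]
    by (intro Bochner_Integration.integral_add integrable_mult_right put_fun_integrable int)
  finally show ?thesis using prob_space by simp
qed

text \<open>A difference quotient form of the fact that the one-sided derivatives of \<open>put_fun M\<close> are the left
  and right limits of the distribution function.\<close>
lemma put_fun_increment:
  assumes "k \<le> l"
  shows "(l - k) * measure M {..k} \<le> put_fun M l - put_fun M k"
    and "put_fun M l - put_fun M k \<le> (l - k) * measure M {..<l}"
proof -
  have diff: "put_fun M l - put_fun M k = (\<integral>x. max (l - x) 0 - max (k - x) 0 \<partial>M)"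
    unfolding put_fun_def using put_fun_integrable by simp
  have i: "integrable M (\<lambda>x. max (l - x) 0 - max (k - x) 0)"
    using put_fun_integrable by auto
  have ind: "integrable M (\<lambda>x. (l - k) * indicator A x)" if "A \<in> sets borel" for A
    using that by (intro integrable_mult_right) (auto simp: less_top[symmetric])
  have "(l - k) * measure M {..k} = (\<integral>x. (l - k) * indicator {..k} x \<partial>M)" by simp
  also have "\<dots> \<le> put_fun M l - put_fun M k" unfolding diff
    using assms by (intro integral_mono ind i) (auto simp: indicator_def)
  finally show "(l - k) * measure M {..k} \<le> put_fun M l - put_fun M k" .
  have "put_fun M l - put_fun M k \<le> (\<integral>x. (l - k) * indicator {..<l} x \<partial>M)" unfolding diff
    using assms by (intro integral_mono ind i) (auto simp: indicator_def)
  then show "put_fun M l - put_fun M k \<le> (l - k) * measure M {..<l}" by simp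
qed

lemma put_fun_lipschitz: "\<bar>put_fun M l - put_fun M k\<bar> \<le> \<bar>l - k\<bar>"
proof -
  have *: "0 \<le> put_fun M l - put_fun M k \<and> put_fun M l - put_fun M k \<le> l - k" if "k \<le> l" for k l
  proof -
    have "0 \<le> (l - k) * measure M {..k}" "(l - k) * measure M {..<l} \<le> l - k"
      using that by (auto intro!: mult_left_le)
    then show ?thesis using put_fun_increment[OF that] by simp
  qed
  show ?thesis using *[of k l] *[of l k] by (cases "k \<le> l") auto
qed

lemma continuous_on_put_fun: "continuous_on A (put_fun M)"
  by (rule lipschitz_on_continuous_on[of 1], rule lipschitz_onI)
     (simp_all add: dist_real_def put_fun_lipschitz)

lemma put_fun_at_bot: "(put_fun M \<longlongrightarrow> 0) at_bot"
proof -
  have "((\<lambda>t. \<integral>x. max (- t - x) 0 \<partial>M) \<longlongrightarrow> (\<integral>x. 0 \<partial>M)) at_top"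
  proof (rule integral_dominated_convergence_at_top[where w="\<lambda>x. \<bar>x\<bar>"])
    show "AE x in M. ((\<lambda>t. max (- t - x) 0) \<longlongrightarrow> 0) at_top"
    proof (rule AE_I2, rule tendsto_eventually)
      fix x :: real show "\<forall>\<^sub>F t in at_top. max (- t - x) 0 = 0"
        using eventually_ge_at_top[of "-x"] by eventually_elim auto
    qed
    show "\<forall>\<^sub>F t in at_top. AE x in M. norm (max (- t - x) 0) \<le> \<bar>x\<bar>"
      using eventually_ge_at_top[of 0] by eventually_elim auto
    show "integrable M (\<lambda>x. \<bar>x\<bar>)" using int by (rule integrable_abs)
  qed measurable
  then show ?thesis
    unfolding filterlim_at_bot_mirror put_fun_def by simp
qed

lemma call_fun_at_top: "(call_fun M \<longlongrightarrow> 0) at_top"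
proof -
  have "((\<lambda>t. \<integral>x. max (x - t) 0 \<partial>M) \<longlongrightarrow> (\<integral>x. 0 \<partial>M)) at_top"
  proof (rule integral_dominated_convergence_at_top[where w="\<lambda>x. \<bar>x\<bar>"])
    show "AE x in M. ((\<lambda>t. max (x - t) 0) \<longlongrightarrow> 0) at_top"
    proof (rule AE_I2, rule tendsto_eventually)
      fix x :: real show "\<forall>\<^sub>F t in at_top. max (x - t) 0 = 0"
        using eventually_ge_at_top[of "x"] by eventually_elim auto
    qed
    show "\<forall>\<^sub>F t in at_top. AE x in M. norm (max (x - t) 0) \<le> \<bar>x\<bar>"
      using eventually_ge_at_top[of 0] by eventually_elim auto
    show "integrable M (\<lambda>x. \<bar>x\<bar>)" using int by (rule integrable_abs)
  qed measurable
  then show ?thesis unfolding call_fun_def[abs_def] by simp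
qed

end

end

locale positive_gaps =
  \<mu>: real_distribution \<mu> + \<nu>: real_distribution \<nu> for \<mu> \<nu> +
  assumes int\<mu>: "integrable \<mu> (\<lambda>x. x)" and int\<nu>: "integrable \<nu> (\<lambda>x. x)"
    and p_pos: "0 < p_gap \<mu> \<nu>" and c_pos: "0 < c_gap \<mu> \<nu>"
begin

abbreviation "a \<equiv> x_minus \<mu> \<nu>"
abbreviation "b \<equiv> x_plus \<mu> \<nu>"

definition put_excess :: "real \<Rightarrow> real" where
  "put_excess k = put_fun \<mu> k - put_fun \<nu> k"

lemma continuous_on_put_excess: "continuous_on A put_excess"
  unfolding put_excess_def[abs_def]
  by (intro continuous_on_diff \<mu>.continuous_on_put_fun \<nu>.continuous_on_put_fun int\<mu> int\<nu>)

lemma call_gap_eq: "call_fun \<mu> k - call_fun \<nu> k = put_excess k + ((\<integral>x. x \<partial>\<mu>) - (\<integral>x. x \<partial>\<nu>))"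
  using \<mu>.call_fun_eq[OF int\<mu>, of k] \<nu>.call_fun_eq[OF int\<nu>, of k] by (simp add: put_excess_def)

text \<open>The difference tends to \<open>0\<close> on the left and, being the difference of the call functions up to
  a constant, to \<open>\<integral>x \<partial>\<nu> - \<integral>x \<partial>\<mu>\<close> on the right. Positivity of the two gaps says that it exceeds both
  limits somewhere, so its maximum is attained, and only within a bounded set.\<close>
lemma put_excess_attains_maximum: "\<exists>k0 R. (\<forall>k. put_excess k \<le> put_excess k0) \<and> (\<forall>k. put_excess k = put_excess k0 \<longrightarrow> \<bar>k\<bar> \<le> R)"
proof -
  have "\<exists>k. 0 < put_excess k"
  proof (rule ccontr)
    assume "\<nexists>k. 0 < put_excess k"
    then have "put_excess k \<le> 0" for k by (auto simp: not_less)
    then have "p_gap \<mu> \<nu> \<le> 0" unfolding p_gap_def put_excess_def by (intro cSUP_least) auto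
    then show False using p_pos by simp
  qed
  then obtain k1 where k1: "0 < put_excess k1" ..
  have "\<exists>k. 0 < call_fun \<mu> k - call_fun \<nu> k"
  proof (rule ccontr)
    assume "\<nexists>k. 0 < call_fun \<mu> k - call_fun \<nu> k"
    then have "call_fun \<mu> k - call_fun \<nu> k \<le> 0" for k by (auto simp: not_less)
    then have "c_gap \<mu> \<nu> \<le> 0" unfolding c_gap_def by (intro cSUP_least) auto
    then show False using c_pos by simp
  qed
  then obtain k2 where k2: "0 < call_fun \<mu> k2 - call_fun \<nu> k2" ..
  have "(put_excess \<longlongrightarrow> 0 - 0) at_bot" unfolding put_excess_def[abs_def]
    by (intro tendsto_diff \<mu>.put_fun_at_bot \<nu>.put_fun_at_bot int\<mu> int\<nu>)
  then have "\<forall>\<^sub>F k in at_bot. put_excess k < put_excess k1" using k1 by (intro order_tendstoD) auto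
  then obtain L where L: "\<And>k. k \<le> L \<Longrightarrow> put_excess k < put_excess k1" by (auto simp: eventually_at_bot_linorder)
  have "((\<lambda>k. call_fun \<mu> k - call_fun \<nu> k) \<longlongrightarrow> 0 - 0) at_top"
    by (intro tendsto_diff \<mu>.call_fun_at_top \<nu>.call_fun_at_top int\<mu> int\<nu>)
  then have "\<forall>\<^sub>F k in at_top. call_fun \<mu> k - call_fun \<nu> k < call_fun \<mu> k2 - call_fun \<nu> k2"
    using k2 by (intro order_tendstoD) auto
  then obtain U where U: "\<And>k. U \<le> k \<Longrightarrow> put_excess k < put_excess k2"
    by (auto simp: eventually_at_top_linorder call_gap_eq)
  define R where "R = max \<bar>L\<bar> \<bar>U\<bar>"
  have out: "put_excess k < max (put_excess k1) (put_excess k2)" if "R < \<bar>k\<bar>" for k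
  proof -
    have "k \<le> L \<or> U \<le> k" using that unfolding R_def by linarith
    then show ?thesis using L U by (auto simp: less_max_iff_disj)
  qed
  define R' where "R' = max R (max \<bar>k1\<bar> \<bar>k2\<bar>)"
  have k12: "k1 \<in> {-R'..R'}" "k2 \<in> {-R'..R'}" and "R \<le> R'"
    unfolding R'_def by auto
  then have "{-R'..R'} \<noteq> {}" by blast
  then obtain k0 where k0: "k0 \<in> {-R'..R'}" "\<forall>k\<in>{-R'..R'}. put_excess k \<le> put_excess k0"
    using continuous_attains_sup[OF compact_Icc _ continuous_on_put_excess] by blast
  have ge: "max (put_excess k1) (put_excess k2) \<le> put_excess k0" using k0(2) k12 by simp
  have "put_excess k \<le> put_excess k0" for k
  proof (cases "\<bar>k\<bar> \<le> R'")
    case True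
    then have "k \<in> {-R'..R'}" by auto
    then show ?thesis using k0(2) by blast
  next
    case False
    then show ?thesis using out[of k] ge \<open>R \<le> R'\<close> by linarith
  qed
  moreover have "\<bar>k\<bar> \<le> R" if "put_excess k = put_excess k0" for k
    using out[of k] ge that by linarith
  ultimately show ?thesis by blast
qed

lemma
  shows put_excess_le_a: "put_excess k \<le> put_excess a" and put_excess_b: "put_excess b = put_excess a" and a_le_b: "a \<le> b"
proof -
  obtain k0 R where k0: "\<And>k. put_excess k \<le> put_excess k0" "\<And>k. put_excess k = put_excess k0 \<Longrightarrow> \<bar>k\<bar> \<le> R"
    using put_excess_attains_maximum by metis
  have "p_gap \<mu> \<nu> = put_excess k0"
    unfolding p_gap_def put_excess_def[symmetric] by (intro cSup_eq_maximum) (use k0(1) in blast)+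
  then have K: "{k. lifted_put \<mu> \<nu> k = put_fun \<mu> k} = {k. put_excess k = put_excess k0}"
    by (auto simp: lifted_put_def put_excess_def)
  have cl: "closed {k. put_excess k = put_excess k0}"
    by (intro closed_Collect_eq continuous_on_put_excess continuous_on_const)
  have bdd: "bdd_below {k. put_excess k = put_excess k0}" "bdd_above {k. put_excess k = put_excess k0}"
  proof -
    have "- R \<le> k" "k \<le> R" if "put_excess k = put_excess k0" for k using k0(2)[OF that] by auto
    then show "bdd_below {k. put_excess k = put_excess k0}" "bdd_above {k. put_excess k = put_excess k0}"
      unfolding bdd_below_def bdd_above_def by blast+
  qed
  have ne: "{k. put_excess k = put_excess k0} \<noteq> {}" by blast
  have "a \<in> {k. put_excess k = put_excess k0}" "b \<in> {k. put_excess k = put_excess k0}"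
    unfolding x_minus_def x_plus_def K
    using closed_contains_Inf[OF ne bdd(1) cl] closed_contains_Sup[OF ne bdd(2) cl] by blast+
  moreover have "a \<le> b" unfolding x_minus_def x_plus_def K by (intro cInf_le_cSup ne bdd)
  ultimately show "put_excess k \<le> put_excess a" "put_excess b = put_excess a" "a \<le> b" using k0(1) by auto
qed

text \<open>The next two lemmas are the first order conditions at the maximum points \<open>a\<close> (from the right) and \<open>b\<close>
  (from the left). They ensure that the Dirac masses moved to \<open>chi_minus\<close> and \<open>chi_plus\<close> are not larger
  than the atoms of \<open>\<nu>\<close>.\<close>
lemma measure_atMost_a_le: "measure \<mu> {..a} \<le> measure \<nu> {..a}"
proof (rule tendsto_lowerbound)
  have "(cdf \<nu> \<longlongrightarrow> cdf \<nu> a) (at_right a)"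
    using \<nu>.cdf_is_right_cont[of a] by (simp add: continuous_within)
  then show "((\<lambda>l. measure \<nu> {..l}) \<longlongrightarrow> measure \<nu> {..a}) (at_right a)" by (simp add: cdf_def[abs_def])
  show "\<forall>\<^sub>F l in at_right a. measure \<mu> {..a} \<le> measure \<nu> {..l}"
    unfolding eventually_at_right_field
  proof (intro exI[of _ "a + 1"] conjI allI impI)
    fix l assume l: "a < l"
    have "(l - a) * measure \<mu> {..a} \<le> (l - a) * measure \<nu> {..<l}"
      using \<mu>.put_fun_increment(1)[OF int\<mu> less_imp_le[OF l]]
        \<nu>.put_fun_increment(2)[OF int\<nu> less_imp_le[OF l]] put_excess_le_a[of l] unfolding put_excess_def by linarith
    then have "measure \<mu> {..a} \<le> measure \<nu> {..<l}" using l by simp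
    also have "\<dots> \<le> measure \<nu> {..l}" by (intro \<nu>.finite_measure_mono) auto
    finally show "measure \<mu> {..a} \<le> measure \<nu> {..l}" .
  qed auto
qed auto

lemma measure_lessThan_b_ge: "measure \<nu> {..<b} \<le> measure \<mu> {..<b}"
proof (rule tendsto_upperbound)
  show "((\<lambda>l. measure \<nu> {..l}) \<longlongrightarrow> measure \<nu> {..<b}) (at_left b)"
    using \<nu>.cdf_at_left[of b] by (simp add: cdf_def[abs_def])
  show "\<forall>\<^sub>F l in at_left b. measure \<nu> {..l} \<le> measure \<mu> {..<b}"
    unfolding eventually_at_left_field
  proof (intro exI[of _ "b - 1"] conjI allI impI)
    fix l assume l: "l < b"
    have "(b - l) * measure \<nu> {..l} \<le> (b - l) * measure \<mu> {..<b}"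
      using \<nu>.put_fun_increment(1)[OF int\<nu> less_imp_le[OF l]]
        \<mu>.put_fun_increment(2)[OF int\<mu> less_imp_le[OF l]] put_excess_le_a[of l] put_excess_b unfolding put_excess_def by linarith
    then show "measure \<nu> {..l} \<le> measure \<mu> {..<b}" using l by simp
  qed auto
qed auto

text \<open>The lower bound for the mean deviation is the same at both ends, so an optimal coupling has
  the equality structure of \<open>mean_deviation_eq_iff\<close> at \<open>a\<close> and at \<open>b\<close> simultaneously.\<close>
lemma deviation_bound_eq:
  "(\<integral>x. \<bar>x - b\<bar> \<partial>\<mu>) - (\<integral>y. \<bar>y - b\<bar> \<partial>\<nu>) = (\<integral>x. \<bar>x - a\<bar> \<partial>\<mu>) - (\<integral>y. \<bar>y - a\<bar> \<partial>\<nu>)"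
  using put_excess_b \<mu>.integral_abs_diff_eq[OF int\<mu>] \<nu>.integral_abs_diff_eq[OF int\<nu>] by (simp add: put_excess_def)

end

section \<open>Optimal couplings split at the ends of the contact interval\<close>

lemma distr_add_measure:
  assumes eq: "sets M = sets N" and f: "f \<in> M \<rightarrow>\<^sub>M L"
  shows "distr (add_measure M N) L f = add_measure (distr M L f) (distr N L f)"
proof (rule measure_eqI)
  fix A assume "A \<in> sets (distr (add_measure M N) L f)"
  then have A: "A \<in> sets L" by simp
  have f': "f \<in> N \<rightarrow>\<^sub>M L" "f \<in> add_measure M N \<rightarrow>\<^sub>M L"
    using f measurable_cong_sets[OF eq refl] measurable_cong_sets[OF sets_add_measure[of M N] refl] by auto
  show "emeasure (distr (add_measure M N) L f) A = emeasure (add_measure (distr M L f) (distr N L f)) A"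
    using A f f' measurable_sets[OF f A] sets_eq_imp_space_eq[OF eq]
    by (simp add: emeasure_distr emeasure_add_measure[OF eq] emeasure_add_measure)
qed simp

lemma integrable_add_measureD:
  fixes f :: "'a \<Rightarrow> real"
  assumes eq: "sets M = sets N" and int: "integrable (add_measure M N) f"
  shows "integrable M f" "integrable N f"
proof -
  have m: "f \<in> borel_measurable M" "f \<in> borel_measurable N"
    using borel_measurable_integrable[OF int] measurable_cong_sets[OF eq refl]
      measurable_cong_sets[OF sets_add_measure[of M N] refl] by auto
  have "(\<integral>\<^sup>+x. ennreal (norm (f x)) \<partial>M) + (\<integral>\<^sup>+x. ennreal (norm (f x)) \<partial>N) < \<infinity>"
    using int m(1) by (simp add: integrable_iff_bounded nn_integral_add_measure[OF eq])
  then show "integrable M f" "integrable N f"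
    using m by (auto simp: integrable_iff_bounded)
qed

lemma finite_measure_add_measureD:
  assumes eq: "sets M = sets N" and fin: "finite_measure (add_measure M N)"
  shows "finite_measure M" "finite_measure N"
proof -
  have "emeasure M (space M) + emeasure N (space M) \<noteq> \<infinity>"
    using finite_measure.emeasure_finite[OF fin] emeasure_add_measure[OF eq sets.top] by auto
  then have "emeasure M (space M) \<noteq> \<infinity>" "emeasure N (space N) \<noteq> \<infinity>"
    using sets_eq_imp_space_eq[OF eq] by auto
  then show "finite_measure M" "finite_measure N" by (auto intro: finite_measureI)
qed

lemma borel_measurable_disintegration:
  assumes dis: "disintegrates \<eta> \<pi> \<kappa>" and A: "A \<in> sets borel"
  shows "(\<lambda>x. emeasure (\<kappa> x) {y. (x, y) \<in> A}) \<in> borel_measurable borel"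
proof (rule emeasure_measurable_subprob_algebra2[where N=borel])
  have "(SIGMA x:UNIV. {y. (x, y) \<in> A}) = A" by auto
  moreover have "A \<in> sets (borel \<Otimes>\<^sub>M borel)" unfolding borel_prod by (rule A)
  ultimately show "(SIGMA x:space borel. {y. (x, y) \<in> A}) \<in> sets (borel \<Otimes>\<^sub>M borel)" by simp
qed (rule disintegrates_kernel(1)[OF dis])

lemma
  assumes \<pi>: "\<pi> \<in> couplings \<mu> \<nu>" and S: "S \<in> sets borel"
  shows restr_coupling_fst: "distr (restr_measure \<pi> {z. fst z \<in> S}) borel fst = restr_measure \<mu> S"
    and restr_coupling_disintegrates:
      "disintegrates \<mu> \<pi> \<kappa> \<Longrightarrow> disintegrates (restr_measure \<mu> S) (restr_measure \<pi> {z. fst z \<in> S}) \<kappa>"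
    and restr_coupling_snd: "E \<in> sets borel \<Longrightarrow>
      emeasure (distr (restr_measure \<pi> {z. fst z \<in> S}) borel snd) E = emeasure \<pi> {z. fst z \<in> S \<and> snd z \<in> E}"
proof -
  note [measurable_cong] = couplings_sets[OF \<pi>]
  note [measurable] = S
  have SP: "{z. fst z \<in> S} \<in> sets \<pi>"
  proof -
    have "{z \<in> space \<pi>. fst z \<in> S} \<in> sets \<pi>" by measurable
    then show ?thesis by (simp add: couplings_space[OF \<pi>])
  qed
  show "distr (restr_measure \<pi> {z. fst z \<in> S}) borel fst = restr_measure \<mu> S"
  proof (rule measure_eqI)
    fix E assume "E \<in> sets (distr (restr_measure \<pi> {z. fst z \<in> S}) borel fst)"
    then have E[measurable]: "E \<in> sets borel" by simp
    have "fst -` E \<inter> space \<pi> \<in> sets \<pi>" by measurable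
    then have "emeasure (distr (restr_measure \<pi> {z. fst z \<in> S}) borel fst) E
        = emeasure \<pi> ({z. fst z \<in> S} \<inter> fst -` E)"
      using SP couplings_space[OF \<pi>] by (subst emeasure_distr) (auto simp: emeasure_restr_measure)
    also have "{z. fst z \<in> S} \<inter> fst -` E = {z. fst z \<in> S \<inter> E}" by auto
    finally show "emeasure (distr (restr_measure \<pi> {z. fst z \<in> S}) borel fst) E = emeasure (restr_measure \<mu> S) E"
      using S E emeasure_coupling_fst[OF \<pi>, of "S \<inter> E"]
      by (simp add: emeasure_restr_measure couplings_sets_fst[OF \<pi>])
  qed (simp add: couplings_sets_fst[OF \<pi>])
  show "emeasure (distr (restr_measure \<pi> {z. fst z \<in> S}) borel snd) E = emeasure \<pi> {z. fst z \<in> S \<and> snd z \<in> E}"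
    if E[measurable]: "E \<in> sets borel"
  proof -
    have "snd -` E \<inter> space \<pi> \<in> sets \<pi>" by measurable
    then have "emeasure (distr (restr_measure \<pi> {z. fst z \<in> S}) borel snd) E
        = emeasure \<pi> ({z. fst z \<in> S} \<inter> snd -` E)"
      using SP couplings_space[OF \<pi>] by (subst emeasure_distr) (auto simp: emeasure_restr_measure)
    also have "{z. fst z \<in> S} \<inter> snd -` E = {z. fst z \<in> S \<and> snd z \<in> E}" by auto
    finally show ?thesis .
  qed
  show "disintegrates (restr_measure \<mu> S) (restr_measure \<pi> {z. fst z \<in> S}) \<kappa>"
    if dis: "disintegrates \<mu> \<pi> \<kappa>"
    unfolding disintegrates_def
  proof (intro conjI ballI)
    show "\<kappa> \<in> borel \<rightarrow>\<^sub>M prob_algebra borel" using dis by (simp add: disintegrates_def)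
    fix A :: "(real \<times> real) set" assume A: "A \<in> sets borel"
    then have A': "A \<in> sets \<pi>" unfolding couplings_sets[OF \<pi>] borel_prod .
    have int: "{z. fst z \<in> S} \<inter> A \<in> sets borel" using sets.Int[OF SP A'] unfolding couplings_sets[OF \<pi>] borel_prod .
    have "emeasure (restr_measure \<pi> {z. fst z \<in> S}) A = emeasure \<pi> ({z. fst z \<in> S} \<inter> A)"
      by (rule emeasure_restr_measure[OF SP A'])
    also have "\<dots> = (\<integral>\<^sup>+x. emeasure (\<kappa> x) {y. (x, y) \<in> {z. fst z \<in> S} \<inter> A} \<partial>\<mu>)"
      using dis int unfolding disintegrates_def by blast
    also have "\<dots> = (\<integral>\<^sup>+x. indicator S x * emeasure (\<kappa> x) {y. (x, y) \<in> A} \<partial>\<mu>)"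
      by (intro nn_integral_cong) (auto simp: indicator_def)
    also have "\<dots> = (\<integral>\<^sup>+x. emeasure (\<kappa> x) {y. (x, y) \<in> A} \<partial>restr_measure \<mu> S)"
      using S borel_measurable_disintegration[OF dis A]
      by (intro nn_integral_restr_measure[symmetric])
        (simp_all add: couplings_sets_fst[OF \<pi>] measurable_cong_sets[OF couplings_sets_fst[OF \<pi>] refl])
    finally show "emeasure (restr_measure \<pi> {z. fst z \<in> S}) A =
      (\<integral>\<^sup>+x. emeasure (\<kappa> x) {y. (x, y) \<in> A} \<partial>restr_measure \<mu> S)" .
  qed
qed

text \<open>Balance of masses is a consequence of the existence of couplings between the outer pieces. It
  identifies the Dirac masses in \<open>chi_minus\<close> and \<open>chi_plus\<close> as differences of values of \<open>\<mu>\<close> and \<open>\<nu>\<close>,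
  without differentiating the put functions.\<close>
locale balanced_gaps = positive_gaps +
  assumes balance_minus: "emeasure (eta_minus \<mu> \<nu>) UNIV = emeasure (chi_minus \<mu> \<nu>) UNIV"
    and balance_plus: "emeasure (eta_plus \<mu> \<nu>) UNIV = emeasure (chi_plus \<mu> \<nu>) UNIV"
begin

definition atom_a :: real where
  "atom_a = max 0 (left_deriv (put_fun \<mu>) a - left_deriv (lifted_put \<mu> \<nu>) a)"

definition atom_b :: real where
  "atom_b = max 0 (right_deriv (lifted_put \<mu> \<nu>) b - right_deriv (put_fun \<mu>) b)"

lemma atom_nonneg: "0 \<le> atom_a" "0 \<le> atom_b"
  by (auto simp: atom_a_def atom_b_def)

lemma chi_minus_eq: "chi_minus \<mu> \<nu> =
    add_measure (restr_measure \<nu> {..<a}) (scale_measure (ennreal atom_a) (return borel a))"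
  by (simp add: chi_minus_def atom_a_def ennreal_max_0)

lemma chi_plus_eq: "chi_plus \<mu> \<nu> =
    add_measure (restr_measure \<nu> {b<..}) (scale_measure (ennreal atom_b) (return borel b))"
  by (simp add: chi_plus_def atom_b_def ennreal_max_0)

lemma sets_chi [simp, measurable_cong]:
  "sets (chi_minus \<mu> \<nu>) = sets borel" "sets (chi_plus \<mu> \<nu>) = sets borel" "sets (chi_zero \<mu> \<nu>) = sets borel"
  by (simp_all add: chi_minus_eq chi_plus_eq chi_zero_def)

lemma sets_eta [simp, measurable_cong]:
  "sets (eta_minus \<mu> \<nu>) = sets borel" "sets (eta_plus \<mu> \<nu>) = sets borel" "sets (eta_zero \<mu> \<nu>) = sets borel"
  by (simp_all add: eta_minus_def eta_plus_def eta_zero_def)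

lemma emeasure_chi_minus:
  assumes "E \<in> sets borel"
  shows "emeasure (chi_minus \<mu> \<nu>) E = ennreal (measure \<nu> (E \<inter> {..<a}) + atom_a * indicator E a)"
  unfolding chi_minus_eq using assms atom_nonneg
  by (simp add: emeasure_add_measure emeasure_restr_measure \<nu>.emeasure_eq_measure ennreal_plus
    ennreal_mult Int_commute flip: ennreal_indicator)

lemma emeasure_chi_plus:
  assumes "E \<in> sets borel"
  shows "emeasure (chi_plus \<mu> \<nu>) E = ennreal (measure \<nu> (E \<inter> {b<..}) + atom_b * indicator E b)"
  unfolding chi_plus_eq using assms atom_nonneg
  by (simp add: emeasure_add_measure emeasure_restr_measure \<nu>.emeasure_eq_measure ennreal_plus
    ennreal_mult Int_commute flip: ennreal_indicator)

lemma atom_a_eq: "measure \<mu> {..<a} = measure \<nu> {..<a} + atom_a"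
proof -
  have "ennreal (measure \<mu> {..<a}) = emeasure (eta_minus \<mu> \<nu>) UNIV"
    by (simp add: eta_minus_def emeasure_restr_measure \<mu>.emeasure_eq_measure)
  also have "\<dots> = ennreal (measure \<nu> {..<a} + atom_a)"
    using emeasure_chi_minus[of UNIV] balance_minus by (simp del: ennreal_plus)
  finally show ?thesis by (subst (asm) ennreal_inj) (use atom_nonneg in auto)
qed

lemma atom_b_eq: "measure \<mu> {b<..} = measure \<nu> {b<..} + atom_b"
proof -
  have "ennreal (measure \<mu> {b<..}) = emeasure (eta_plus \<mu> \<nu>) UNIV"
    by (simp add: eta_plus_def emeasure_restr_measure \<mu>.emeasure_eq_measure)
  also have "\<dots> = ennreal (measure \<nu> {b<..} + atom_b)"
    using emeasure_chi_plus[of UNIV] balance_plus by (simp del: ennreal_plus)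
  finally show ?thesis by (subst (asm) ennreal_inj) (use atom_nonneg in auto)
qed

lemma measure_\<nu>_split:
  assumes E [measurable]: "E \<in> sets borel"
  shows "measure \<nu> E = measure \<nu> (E \<inter> {..<a}) + measure \<nu> (E \<inter> {a..b}) + measure \<nu> (E \<inter> {b<..})"
proof -
  have "measure \<nu> (E \<inter> {..<a}) + measure \<nu> (E \<inter> {a..b}) = measure \<nu> ((E \<inter> {..<a}) \<union> (E \<inter> {a..b}))"
    by (intro \<nu>.finite_measure_Union[symmetric]) auto
  also have "\<dots> + measure \<nu> (E \<inter> {b<..}) = measure \<nu> ((E \<inter> {..<a}) \<union> (E \<inter> {a..b}) \<union> (E \<inter> {b<..}))"
    using a_le_b by (intro \<nu>.finite_measure_Union[symmetric]) auto
  also have "(E \<inter> {..<a}) \<union> (E \<inter> {a..b}) \<union> (E \<inter> {b<..}) = E" using a_le_b by auto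
  finally show ?thesis by simp
qed

text \<open>If \<open>a < b\<close>, each Dirac mass is bounded by the atom of \<open>\<nu>\<close> at its own location, by the first order
  conditions. If \<open>a = b\<close>, both are taken from the same atom, and counting the total mass bounds
  their sum. This is what makes the measure differences in \<open>chi_zero\<close> setwise differences.\<close>
lemma atoms_le:
  assumes E [measurable]: "E \<in> sets borel"
  shows "atom_a * indicator E a + atom_b * indicator E b \<le> measure \<nu> (E \<inter> {a..b})"
proof (cases "a < b")
  case True
  have "measure \<mu> {..<a} \<le> measure \<mu> {..a}" by (intro \<mu>.finite_measure_mono) auto
  also have "\<dots> \<le> measure \<nu> {..a}" by (rule measure_atMost_a_le)
  also have "\<dots> = measure \<nu> ({..<a} \<union> {a})" by (rule arg_cong[where f="measure \<nu>"]) auto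
  also have "\<dots> = measure \<nu> {..<a} + measure \<nu> {a}" by (intro \<nu>.finite_measure_Union) auto
  finally have A: "atom_a \<le> measure \<nu> {a}" using atom_a_eq by simp
  have U: "{..<b} \<union> {b..} = (UNIV :: real set)" by auto
  have \<mu>1: "1 = measure \<mu> {..<b} + measure \<mu> {b..}"
    using \<mu>.prob_space by (subst \<mu>.finite_measure_Union[symmetric]) (auto simp: U)
  have \<nu>1: "1 = measure \<nu> {..<b} + measure \<nu> {b..}"
    using \<nu>.prob_space by (subst \<nu>.finite_measure_Union[symmetric]) (auto simp: U)
  have "measure \<mu> {b<..} \<le> measure \<mu> {b..}" by (intro \<mu>.finite_measure_mono) auto
  also have "\<dots> \<le> measure \<nu> {b..}" using \<mu>1 \<nu>1 measure_lessThan_b_ge by linarith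
  also have "\<dots> = measure \<nu> ({b<..} \<union> {b})" by (rule arg_cong[where f="measure \<nu>"]) auto
  also have "\<dots> = measure \<nu> {b<..} + measure \<nu> {b}" by (intro \<nu>.finite_measure_Union) auto
  finally have B: "atom_b \<le> measure \<nu> {b}" using atom_b_eq by simp
  have "atom_a * indicator E a + atom_b * indicator E b \<le> measure \<nu> (E \<inter> {a}) + measure \<nu> (E \<inter> {b})"
    using A B by (auto simp: indicator_def)
  also have "\<dots> = measure \<nu> (E \<inter> {a} \<union> E \<inter> {b})"
    using True by (intro \<nu>.finite_measure_Union[symmetric]) auto
  also have "\<dots> \<le> measure \<nu> (E \<inter> {a..b})" using True by (intro \<nu>.finite_measure_mono) auto
  finally show ?thesis .
next
  case False
  then have ab: "b = a" using a_le_b by simp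
  have "measure \<mu> {..<a} + measure \<mu> {a<..} = measure \<mu> ({..<a} \<union> {a<..})"
    by (intro \<mu>.finite_measure_Union[symmetric]) auto
  then have "measure \<mu> {..<a} + measure \<mu> {a<..} \<le> 1" using \<mu>.prob_le_1 by simp
  moreover have "1 = measure \<nu> {..<a} + measure \<nu> {a} + measure \<nu> {a<..}"
    using measure_\<nu>_split[of UNIV] ab \<nu>.prob_space by simp
  ultimately have "atom_a + atom_b \<le> measure \<nu> {a}"
    using atom_a_eq atom_b_eq ab by simp
  then show ?thesis using ab by (auto simp: indicator_def)
qed

lemma emeasure_chi_zero:
  assumes E: "E \<in> sets borel"
  shows "emeasure (chi_zero \<mu> \<nu>) E =
    ennreal (measure \<nu> (E \<inter> {a..b}) - atom_a * indicator E a - atom_b * indicator E b)"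
proof -
  have finp: "finite_measure (chi_plus \<mu> \<nu>)" "finite_measure (chi_minus \<mu> \<nu>)"
    by (auto intro!: finite_measureI simp: sets_eq_imp_space_eq[OF sets_chi(1)]
      sets_eq_imp_space_eq[OF sets_chi(2)] emeasure_chi_plus emeasure_chi_minus)
  have n: "0 \<le> atom_a * indicator F a" "0 \<le> atom_b * indicator F b" for F :: "real set"
    using atom_nonneg by (auto simp: indicator_def)
  have diff1: "emeasure (diff_measure \<nu> (chi_minus \<mu> \<nu>)) F =
      ennreal (measure \<nu> (F \<inter> {a..b}) + measure \<nu> (F \<inter> {b<..}) - atom_a * indicator F a)"
    if F: "F \<in> sets borel" for F
  proof -
    have "emeasure (diff_measure \<nu> (chi_minus \<mu> \<nu>)) F = emeasure \<nu> F - emeasure (chi_minus \<mu> \<nu>) F"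
    proof (rule emeasure_diff_measure[OF \<nu>.finite_measure_axioms finp(2)])
      fix A assume "A \<in> sets \<nu>"
      then have A: "A \<in> sets borel" by simp
      show "emeasure (chi_minus \<mu> \<nu>) A \<le> emeasure \<nu> A"
        unfolding emeasure_chi_minus[OF A] \<nu>.emeasure_eq_measure measure_\<nu>_split[OF A]
        using atoms_le[OF A] n[of A] by (intro ennreal_leI) (simp add: add_increasing2)
    qed (use F in auto)
    then show ?thesis
      unfolding emeasure_chi_minus[OF F] \<nu>.emeasure_eq_measure
      using n[of F] measure_\<nu>_split[OF F] by (simp add: ennreal_minus add_diff_eq del: ennreal_plus)
  qed
  have fin1: "finite_measure (diff_measure \<nu> (chi_minus \<mu> \<nu>))"
    by (auto intro!: finite_measureI simp: diff1)
  have "emeasure (chi_zero \<mu> \<nu>) E = emeasure (diff_measure \<nu> (chi_minus \<mu> \<nu>)) E - emeasure (chi_plus \<mu> \<nu>) E"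
    unfolding chi_zero_def
  proof (rule emeasure_diff_measure[OF fin1 finp(1)])
    fix A assume "A \<in> sets (diff_measure \<nu> (chi_minus \<mu> \<nu>))"
    then have A: "A \<in> sets borel" by simp
    show "emeasure (chi_plus \<mu> \<nu>) A \<le> emeasure (diff_measure \<nu> (chi_minus \<mu> \<nu>)) A"
      unfolding emeasure_chi_plus[OF A] diff1[OF A]
      using atoms_le[OF A] by (intro ennreal_leI) simp
  qed (use E in auto)
  then show ?thesis
    unfolding emeasure_chi_plus[OF E] diff1[OF E]
    using n[of E] by (simp add: ennreal_minus algebra_simps del: ennreal_plus)
qed

lemma chi_sum: "add_measure (add_measure (chi_minus \<mu> \<nu>) (chi_zero \<mu> \<nu>)) (chi_plus \<mu> \<nu>) = \<nu>"
proof (rule measure_eqI)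
  fix E assume "E \<in> sets (add_measure (add_measure (chi_minus \<mu> \<nu>) (chi_zero \<mu> \<nu>)) (chi_plus \<mu> \<nu>))"
  then have E: "E \<in> sets borel" by simp
  have n: "0 \<le> atom_a * indicator E a" "0 \<le> atom_b * indicator E b"
    using atom_nonneg by (auto simp: indicator_def)
  show "emeasure (add_measure (add_measure (chi_minus \<mu> \<nu>) (chi_zero \<mu> \<nu>)) (chi_plus \<mu> \<nu>)) E = emeasure \<nu> E"
    using E n atoms_le[OF E] measure_\<nu>_split[OF E]
    by (simp add: emeasure_add_measure emeasure_chi_minus emeasure_chi_plus emeasure_chi_zero
      \<nu>.emeasure_eq_measure flip: ennreal_plus)
qed simp

lemma eta_sum: "add_measure (add_measure (eta_minus \<mu> \<nu>) (eta_zero \<mu> \<nu>)) (eta_plus \<mu> \<nu>) = \<mu>"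
proof (rule measure_eqI)
  fix E assume "E \<in> sets (add_measure (add_measure (eta_minus \<mu> \<nu>) (eta_zero \<mu> \<nu>)) (eta_plus \<mu> \<nu>))"
  then have E: "E \<in> sets borel" by simp
  have "emeasure \<mu> ({..<a} \<inter> E) + emeasure \<mu> ({a..b} \<inter> E) = emeasure \<mu> (({..<a} \<inter> E) \<union> ({a..b} \<inter> E))"
    using E by (intro plus_emeasure) auto
  also have "\<dots> + emeasure \<mu> ({b<..} \<inter> E) = emeasure \<mu> (({..<a} \<inter> E) \<union> ({a..b} \<inter> E) \<union> ({b<..} \<inter> E))"
    using a_le_b E by (intro plus_emeasure) auto
  also have "({..<a} \<inter> E) \<union> ({a..b} \<inter> E) \<union> ({b<..} \<inter> E) = E" using a_le_b by auto
  finally show "emeasure (add_measure (add_measure (eta_minus \<mu> \<nu>) (eta_zero \<mu> \<nu>)) (eta_plus \<mu> \<nu>)) E = emeasure \<mu> E"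
    using E by (simp add: emeasure_add_measure eta_minus_def eta_zero_def eta_plus_def emeasure_restr_measure)
qed simp

lemma finite_measure_pieces:
  "finite_measure (eta_minus \<mu> \<nu>)" "finite_measure (eta_zero \<mu> \<nu>)" "finite_measure (eta_plus \<mu> \<nu>)"
  "finite_measure (chi_minus \<mu> \<nu>)" "finite_measure (chi_zero \<mu> \<nu>)" "finite_measure (chi_plus \<mu> \<nu>)"
  using finite_measure_add_measureD[of "add_measure (eta_minus \<mu> \<nu>) (eta_zero \<mu> \<nu>)" "eta_plus \<mu> \<nu>"]
    finite_measure_add_measureD[of "eta_minus \<mu> \<nu>" "eta_zero \<mu> \<nu>"]
    finite_measure_add_measureD[of "add_measure (chi_minus \<mu> \<nu>) (chi_zero \<mu> \<nu>)" "chi_plus \<mu> \<nu>"]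
    finite_measure_add_measureD[of "chi_minus \<mu> \<nu>" "chi_zero \<mu> \<nu>"]
  by (simp_all add: chi_sum eta_sum \<mu>.finite_measure_axioms \<nu>.finite_measure_axioms)

lemma integrable_pieces:
  "integrable (eta_minus \<mu> \<nu>) (\<lambda>x. x)" "integrable (eta_zero \<mu> \<nu>) (\<lambda>x. x)" "integrable (eta_plus \<mu> \<nu>) (\<lambda>x. x)"
  "integrable (chi_minus \<mu> \<nu>) (\<lambda>x. x)" "integrable (chi_zero \<mu> \<nu>) (\<lambda>x. x)" "integrable (chi_plus \<mu> \<nu>) (\<lambda>x. x)"
  using integrable_add_measureD[of "add_measure (eta_minus \<mu> \<nu>) (eta_zero \<mu> \<nu>)" "eta_plus \<mu> \<nu>" "\<lambda>x. x"]
    integrable_add_measureD[of "eta_minus \<mu> \<nu>" "eta_zero \<mu> \<nu>" "\<lambda>x. x"]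
    integrable_add_measureD[of "add_measure (chi_minus \<mu> \<nu>) (chi_zero \<mu> \<nu>)" "chi_plus \<mu> \<nu>" "\<lambda>x. x"]
    integrable_add_measureD[of "chi_minus \<mu> \<nu>" "chi_zero \<mu> \<nu>" "\<lambda>x. x"]
  by (simp_all add: chi_sum eta_sum int\<mu> int\<nu>)

lemma AE_eta:
  "AE x in eta_minus \<mu> \<nu>. x < a" "AE x in eta_zero \<mu> \<nu>. a \<le> x \<and> x \<le> b" "AE x in eta_plus \<mu> \<nu>. b < x"
  unfolding eta_minus_def eta_zero_def eta_plus_def by (subst AE_restr_measure; simp)+

lemma AE_chi:
  "AE y in chi_minus \<mu> \<nu>. y \<le> a" "AE y in chi_zero \<mu> \<nu>. a \<le> y \<and> y \<le> b" "AE y in chi_plus \<mu> \<nu>. b \<le> y"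
proof -
  have "emeasure (chi_minus \<mu> \<nu>) {a<..} = 0" 
  proof -
    have "{a<..} \<inter> {..<a} = {}" by auto
    then show ?thesis by (subst emeasure_chi_minus) auto
  qed
  then show "AE y in chi_minus \<mu> \<nu>. y \<le> a" by (intro AE_I[where N="{a<..}"]) auto
  have "emeasure (chi_plus \<mu> \<nu>) {..<b} = 0" 
  proof -
    have "{..<b} \<inter> {b<..} = {}" by auto
    then show ?thesis by (subst emeasure_chi_plus) auto
  qed
  then show "AE y in chi_plus \<mu> \<nu>. b \<le> y" by (intro AE_I[where N="{..<b}"]) auto
  have "(- {a..b}) \<inter> {a..b} = {}" by auto
  then have "emeasure (chi_zero \<mu> \<nu>) (- {a..b}) = 0"
    using a_le_b by (subst emeasure_chi_zero) auto
  then show "AE y in chi_zero \<mu> \<nu>. a \<le> y \<and> y \<le> b" by (intro AE_I[where N="- {a..b}"]) auto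
qed

end

context balanced_gaps
begin

lemma add_pieces_coupling:
  assumes m: "\<pi>m \<in> couplings (eta_minus \<mu> \<nu>) (chi_minus \<mu> \<nu>)"
    and z: "\<pi>z \<in> couplings (eta_zero \<mu> \<nu>) (chi_zero \<mu> \<nu>)"
    and p: "\<pi>p \<in> couplings (eta_plus \<mu> \<nu>) (chi_plus \<mu> \<nu>)"
  shows "add_measure (add_measure \<pi>m \<pi>z) \<pi>p \<in> couplings \<mu> \<nu>"
proof -
  note [measurable_cong] = couplings_sets[OF m] couplings_sets[OF z] couplings_sets[OF p]
  have sets: "sets \<pi>m = sets borel" "sets \<pi>z = sets borel" "sets \<pi>p = sets borel"
    and d: "distr \<pi>m borel fst = eta_minus \<mu> \<nu>" "distr \<pi>z borel fst = eta_zero \<mu> \<nu>"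
      "distr \<pi>p borel fst = eta_plus \<mu> \<nu>" "distr \<pi>m borel snd = chi_minus \<mu> \<nu>"
      "distr \<pi>z borel snd = chi_zero \<mu> \<nu>" "distr \<pi>p borel snd = chi_plus \<mu> \<nu>"
    using m z p by (auto simp: couplings_def)
  have s1: "sets \<pi>m = sets \<pi>z" and s2: "sets (add_measure \<pi>m \<pi>z) = sets \<pi>p" using sets by auto
  have me: "fst \<in> \<pi>m \<rightarrow>\<^sub>M (borel :: real measure)" "fst \<in> add_measure \<pi>m \<pi>z \<rightarrow>\<^sub>M (borel :: real measure)"
    "snd \<in> \<pi>m \<rightarrow>\<^sub>M (borel :: real measure)" "snd \<in> add_measure \<pi>m \<pi>z \<rightarrow>\<^sub>M (borel :: real measure)"
    by measurable
  have "distr (add_measure (add_measure \<pi>m \<pi>z) \<pi>p) borel fst = \<mu>"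
    unfolding distr_add_measure[OF s2 me(2)] distr_add_measure[OF s1 me(1)] d by (rule eta_sum)
  moreover have "distr (add_measure (add_measure \<pi>m \<pi>z) \<pi>p) borel snd = \<nu>"
    unfolding distr_add_measure[OF s2 me(4)] distr_add_measure[OF s1 me(3)] d by (rule chi_sum)
  ultimately show ?thesis using sets by (simp add: couplings_def)
qed

lemma add_pieces_disintegrates:
  assumes m: "disintegrates (eta_minus \<mu> \<nu>) \<pi>m \<kappa>m" "sets \<pi>m = sets borel"
    and z: "disintegrates (eta_zero \<mu> \<nu>) \<pi>z \<kappa>z" "sets \<pi>z = sets borel"
    and p: "disintegrates (eta_plus \<mu> \<nu>) \<pi>p \<kappa>p" "sets \<pi>p = sets borel"
  shows "disintegrates \<mu> (add_measure (add_measure \<pi>m \<pi>z) \<pi>p)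
    (\<lambda>x. if x < a then \<kappa>m x else if x \<le> b then \<kappa>z x else \<kappa>p x)" (is "disintegrates _ _ ?\<kappa>")
  unfolding disintegrates_def
proof (intro conjI ballI)
  have k [measurable]: "\<kappa>m \<in> borel \<rightarrow>\<^sub>M prob_algebra borel" "\<kappa>z \<in> borel \<rightarrow>\<^sub>M prob_algebra borel" "\<kappa>p \<in> borel \<rightarrow>\<^sub>M prob_algebra borel"
    using m z p by (auto simp: disintegrates_def)
  show "?\<kappa> \<in> borel \<rightarrow>\<^sub>M prob_algebra borel" by measurable
  fix A :: "(real \<times> real) set" assume A: "A \<in> sets borel"
  let ?e = "\<lambda>\<kappa> x. emeasure (\<kappa> x) {y. (x, y) \<in> A}"
  have [measurable]: "?e \<kappa>m \<in> borel_measurable borel" "?e \<kappa>z \<in> borel_measurable borel" "?e \<kappa>p \<in> borel_measurable borel"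
    using borel_measurable_disintegration[OF m(1) A] borel_measurable_disintegration[OF z(1) A]
      borel_measurable_disintegration[OF p(1) A] by auto
  have e: "emeasure \<pi>m A = (\<integral>\<^sup>+x. ?e \<kappa>m x \<partial>eta_minus \<mu> \<nu>)"
    "emeasure \<pi>z A = (\<integral>\<^sup>+x. ?e \<kappa>z x \<partial>eta_zero \<mu> \<nu>)"
    "emeasure \<pi>p A = (\<integral>\<^sup>+x. ?e \<kappa>p x \<partial>eta_plus \<mu> \<nu>)"
    using m(1) z(1) p(1) A by (auto simp: disintegrates_def)
  have "emeasure (add_measure (add_measure \<pi>m \<pi>z) \<pi>p) A = emeasure \<pi>m A + emeasure \<pi>z A + emeasure \<pi>p A"
    using m z p A by (simp add: emeasure_add_measure)
  also have "\<dots> = (\<integral>\<^sup>+x. indicator {..<a} x * ?e \<kappa>m x \<partial>\<mu>) + (\<integral>\<^sup>+x. indicator {a..b} x * ?e \<kappa>z x \<partial>\<mu>) +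
      (\<integral>\<^sup>+x. indicator {b<..} x * ?e \<kappa>p x \<partial>\<mu>)"
    unfolding e eta_minus_def eta_zero_def eta_plus_def
    by (intro arg_cong2[where f="(+)"] nn_integral_restr_measure) measurable
  also have "\<dots> = (\<integral>\<^sup>+x. indicator {..<a} x * ?e \<kappa>m x + indicator {a..b} x * ?e \<kappa>z x +
      indicator {b<..} x * ?e \<kappa>p x \<partial>\<mu>)"
    by (subst nn_integral_add, measurable, subst nn_integral_add, measurable)
  also have "\<dots> = (\<integral>\<^sup>+x. ?e ?\<kappa> x \<partial>\<mu>)"
    using a_le_b by (intro nn_integral_cong) (auto simp: indicator_def)
  finally show "emeasure (add_measure (add_measure \<pi>m \<pi>z) \<pi>p) A = (\<integral>\<^sup>+x. ?e ?\<kappa> x \<partial>\<mu>)" .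
qed

text \<open>Once a glued coupling exists, these are precisely the optimal couplings.\<close>
definition glued_couplings :: "(real \<times> real) measure set" where
  "glued_couplings = {add_measure (add_measure \<pi>m \<pi>z) \<pi>p | \<pi>m \<pi>z \<pi>p.
     \<pi>m \<in> submartingale_couplings (eta_minus \<mu> \<nu>) (chi_minus \<mu> \<nu>) \<and>
     \<pi>z \<in> martingale_couplings (eta_zero \<mu> \<nu>) (chi_zero \<mu> \<nu>) \<and>
     \<pi>p \<in> supermartingale_couplings (eta_plus \<mu> \<nu>) (chi_plus \<mu> \<nu>)}"

abbreviation "min_deviation \<equiv> (\<integral>x. \<bar>x - a\<bar> \<partial>\<mu>) - (\<integral>y. \<bar>y - a\<bar> \<partial>\<nu>)"

text \<open>Gluing the three kernels at \<open>a\<close> and \<open>b\<close> gives a coupling with drift towards \<open>a\<close> on both sides of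
  \<open>a\<close>, which does not cross \<open>a\<close>. This is the equality case of the lower bound at \<open>k = a\<close>.\<close>
lemma glued_coupling_deviation:
  assumes "\<pi> \<in> glued_couplings"
  shows "\<pi> \<in> couplings \<mu> \<nu>" "\<exists>\<kappa>. disintegrates \<mu> \<pi> \<kappa> \<and> (\<integral>x. \<bar>x - barycenter \<kappa> x\<bar> \<partial>\<mu>) = min_deviation"
proof -
  obtain \<pi>m \<pi>z \<pi>p \<kappa>m \<kappa>z \<kappa>p where \<pi>: "\<pi> = add_measure (add_measure \<pi>m \<pi>z) \<pi>p"
    and m: "\<pi>m \<in> couplings (eta_minus \<mu> \<nu>) (chi_minus \<mu> \<nu>)" "disintegrates (eta_minus \<mu> \<nu>) \<pi>m \<kappa>m"
      "AE x in eta_minus \<mu> \<nu>. x \<le> barycenter \<kappa>m x"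
    and z: "\<pi>z \<in> couplings (eta_zero \<mu> \<nu>) (chi_zero \<mu> \<nu>)" "disintegrates (eta_zero \<mu> \<nu>) \<pi>z \<kappa>z"
      "AE x in eta_zero \<mu> \<nu>. barycenter \<kappa>z x = x"
    and p: "\<pi>p \<in> couplings (eta_plus \<mu> \<nu>) (chi_plus \<mu> \<nu>)" "disintegrates (eta_plus \<mu> \<nu>) \<pi>p \<kappa>p"
      "AE x in eta_plus \<mu> \<nu>. barycenter \<kappa>p x \<le> x"
    using assms unfolding glued_couplings_def submartingale_couplings_def supermartingale_couplings_def
      martingale_couplings_def by blast
  show c: "\<pi> \<in> couplings \<mu> \<nu>" unfolding \<pi> by (rule add_pieces_coupling[OF m(1) z(1) p(1)])
  have sets: "sets \<pi>m = sets borel" "sets \<pi>z = sets borel" "sets \<pi>p = sets borel"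
    using m(1) z(1) p(1) by (auto simp: couplings_def)
  define \<kappa> where "\<kappa> = (\<lambda>x. if x < a then \<kappa>m x else if x \<le> b then \<kappa>z x else \<kappa>p x)"
  have d: "disintegrates \<mu> \<pi> \<kappa>"
    unfolding \<pi> \<kappa>_def by (rule add_pieces_disintegrates[OF m(2) sets(1) z(2) sets(2) p(2) sets(3)])
  have "AE x in \<mu>. x < a \<longrightarrow> x \<le> barycenter \<kappa>m x"
    using m(3) unfolding eta_minus_def by (subst (asm) AE_restr_measure) auto
  moreover have "AE x in \<mu>. a \<le> x \<and> x \<le> b \<longrightarrow> barycenter \<kappa>z x = x"
    using z(3) unfolding eta_zero_def by (subst (asm) AE_restr_measure) auto
  moreover have "AE x in \<mu>. b < x \<longrightarrow> barycenter \<kappa>p x \<le> x"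
    using p(3) unfolding eta_plus_def by (subst (asm) AE_restr_measure) auto
  ultimately have bary: "AE x in \<mu>. (x < a \<longrightarrow> x \<le> barycenter \<kappa> x) \<and> (a \<le> x \<longrightarrow> barycenter \<kappa> x \<le> x)"
    by eventually_elim (auto simp: \<kappa>_def barycenter_def)
  have "AE w in \<pi>. (fst w < a \<longrightarrow> snd w \<le> a) \<and> (a \<le> fst w \<longrightarrow> a \<le> snd w)"
    unfolding \<pi>
  proof (intro AE_add_measure)
    show "AE w in \<pi>m. (fst w < a \<longrightarrow> snd w \<le> a) \<and> (a \<le> fst w \<longrightarrow> a \<le> snd w)"
      using AE_coupling_fst[OF m(1) AE_eta(1)] AE_coupling_snd[OF m(1) AE_chi(1)] by eventually_elim auto
    show "AE w in \<pi>z. (fst w < a \<longrightarrow> snd w \<le> a) \<and> (a \<le> fst w \<longrightarrow> a \<le> snd w)"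
      using AE_coupling_fst[OF z(1) AE_eta(2)] AE_coupling_snd[OF z(1) AE_chi(2)] by eventually_elim auto
    show "AE w in \<pi>p. (fst w < a \<longrightarrow> snd w \<le> a) \<and> (a \<le> fst w \<longrightarrow> a \<le> snd w)"
      using AE_coupling_fst[OF p(1) AE_eta(3)] AE_coupling_snd[OF p(1) AE_chi(3)]
      by eventually_elim (use a_le_b in auto)
  qed (simp_all add: sets)
  with bary have "(\<integral>x. \<bar>x - barycenter \<kappa> x\<bar> \<partial>\<mu>) = min_deviation"
    using mean_deviation_eq_iff[OF c d \<mu>.finite_measure_axioms int\<mu> int\<nu>, of a] by blast
  with d show "\<exists>\<kappa>. disintegrates \<mu> \<pi> \<kappa> \<and> (\<integral>x. \<bar>x - barycenter \<kappa> x\<bar> \<partial>\<mu>) = min_deviation" by blast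
qed

lemma glued_imp_optimal:
  assumes "\<pi> \<in> glued_couplings"
  shows "\<pi> \<in> optimal_couplings \<mu> \<nu>"
proof -
  obtain \<kappa> where \<kappa>: "disintegrates \<mu> \<pi> \<kappa>" "(\<integral>x. \<bar>x - barycenter \<kappa> x\<bar> \<partial>\<mu>) = min_deviation"
    using glued_coupling_deviation(2)[OF assms] by blast
  show ?thesis
    unfolding optimal_couplings_def mem_Collect_eq
  proof (intro conjI exI ballI allI impI)
    show "\<pi> \<in> couplings \<mu> \<nu>" by (rule glued_coupling_deviation(1)[OF assms])
    show "disintegrates \<mu> \<pi> \<kappa>" by (rule \<kappa>)
    fix \<pi>' \<kappa>' assume "\<pi>' \<in> couplings \<mu> \<nu>" "disintegrates \<mu> \<pi>' \<kappa>'"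
    then show "(\<integral>x. \<bar>x - barycenter \<kappa> x\<bar> \<partial>\<mu>) \<le> (\<integral>x. \<bar>x - barycenter \<kappa>' x\<bar> \<partial>\<mu>)"
      unfolding \<kappa>(2) by (rule mean_deviation_ge[OF _ _ \<mu>.finite_measure_axioms int\<mu> int\<nu>])
  qed
qed

text \<open>Equality in the lower bound at \<open>a\<close> and at \<open>b\<close> confines the coupling to the three diagonal blocks
  and fixes the sign of the drift in each: upwards left of \<open>a\<close>, downwards right of \<open>b\<close>, and both, hence
  none, in between. Inside \<open>{..<a}\<close> all of \<open>\<nu>\<close> is reached from the left block only; the rest of the
  mass of that block must sit at \<open>a\<close>, which gives it the second marginal \<open>chi_minus\<close>. The right block is
  symmetric, and the middle block gets the remainder \<open>chi_zero\<close>.\<close>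
lemma minimal_deviation_imp_glued:
  assumes c: "\<pi> \<in> couplings \<mu> \<nu>" and d: "disintegrates \<mu> \<pi> \<kappa>"
    and bound: "(\<integral>x. \<bar>x - barycenter \<kappa> x\<bar> \<partial>\<mu>) = min_deviation"
  shows "\<pi> \<in> glued_couplings"
proof -
  note [measurable_cong] = couplings_sets[OF c]
  note eqI = mean_deviation_eq_iff[OF c d \<mu>.finite_measure_axioms int\<mu> int\<nu>]
  have ae_a: "AE x in \<mu>. (x < a \<longrightarrow> x \<le> barycenter \<kappa> x) \<and> (a \<le> x \<longrightarrow> barycenter \<kappa> x \<le> x)"
      "AE w in \<pi>. (fst w < a \<longrightarrow> snd w \<le> a) \<and> (a \<le> fst w \<longrightarrow> a \<le> snd w)"
    using eqI[of a] bound by auto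
  have ae_b: "AE x in \<mu>. (x < b \<longrightarrow> x \<le> barycenter \<kappa> x) \<and> (b \<le> x \<longrightarrow> barycenter \<kappa> x \<le> x)"
      "AE w in \<pi>. (fst w < b \<longrightarrow> snd w \<le> b) \<and> (b \<le> fst w \<longrightarrow> b \<le> snd w)"
    using eqI[of b] bound deviation_bound_eq by auto
  have at_b: "AE w in \<pi>. fst w = b \<longrightarrow> snd w = b"
  proof -
    \<comment> \<open>At \<open>x = b\<close> the barycenter is at most \<open>b\<close> while \<open>y \<ge> b\<close>.\<close>
    have "integrable \<nu> (\<lambda>y. y - b)"
      by (intro Bochner_Integration.integrable_diff int\<nu> \<nu>.integrable_const)
    then have "integrable \<pi> (\<lambda>w. indicator {b} (fst w) * (snd w - b))"
      by (rule integrable_coupling_indicator[OF c]) measurable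
    moreover have nn: "AE w in \<pi>. 0 \<le> indicator {b} (fst w) * (snd w - b)"
      using ae_b(2) by eventually_elim (auto simp: indicator_def)
    moreover have "(\<integral>w. indicator {b} (fst w) * (snd w - b) \<partial>\<pi>) = 0"
    proof (rule antisym)
      have "(\<integral>w. indicator {b} (fst w) * (snd w - b) \<partial>\<pi>) =
          (\<integral>x. indicator {b} x * barycenter \<kappa> x \<partial>\<mu>) - b * measure \<mu> {b}"
        using integral_indicator_affine[OF c \<mu>.finite_measure_axioms int\<nu>, of "{b}" 1 "-b"]
          integral_indicator_snd(1)[OF d c int\<nu>, of "{b}"] by simp
      also have "(\<integral>x. indicator {b} x * barycenter \<kappa> x \<partial>\<mu>) \<le> (\<integral>x. b * indicator {b} x \<partial>\<mu>)"
      proof (rule integral_mono_AE[OF integral_indicator_snd(2)[OF d c int\<nu>]])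
        show "integrable \<mu> (\<lambda>x. b * indicator {b} x)"
          by (intro integrable_mult_right) (auto simp: less_top[symmetric])
        show "AE x in \<mu>. indicator {b} x * barycenter \<kappa> x \<le> b * indicator {b} x"
          using ae_b(1) by eventually_elim (auto simp: indicator_def)
      qed simp
      finally show "(\<integral>w. indicator {b} (fst w) * (snd w - b) \<partial>\<pi>) \<le> 0" by simp
    qed (use nn in \<open>rule integral_nonneg_AE\<close>)
    ultimately have "AE w in \<pi>. indicator {b} (fst w) * (snd w - b) = 0"
      using integral_nonneg_eq_0_iff_AE by blast
    then show ?thesis by eventually_elim auto
  qed
  define piece where "piece S = restr_measure \<pi> {w. fst w \<in> S}" for S
  note piece_d = restr_coupling_disintegrates[OF c _ d, folded piece_def]
  note piece_fst = restr_coupling_fst[OF c, folded piece_def]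
  note piece_snd = restr_coupling_snd[OF c, folded piece_def]
  have sets_\<pi>: "sets \<pi> = sets borel" using c by (simp add: couplings_def)
  have sets_piece: "sets (piece S) = sets borel" for S using sets_\<pi> by (simp add: piece_def)
  have setP: "{w. P w} \<in> sets \<pi>" if "Measurable.pred (borel \<Otimes>\<^sub>M borel) P" for P
  proof -
    have "{w \<in> space \<pi>. P w} \<in> sets \<pi>" using that by measurable
    then show ?thesis by (simp add: couplings_space[OF c])
  qed
  interpret \<pi>: finite_measure \<pi> using couplings_finite_measure[OF c \<mu>.finite_measure_axioms] .
  have m\<mu>: "measure \<pi> {w. fst w \<in> S} = measure \<mu> S" and m\<nu>: "measure \<pi> {w. snd w \<in> S} = measure \<nu> S"
    if "S \<in> sets borel" for S
    using emeasure_coupling_fst[OF c that] emeasure_coupling_snd[OF c that] by (auto simp: measure_def)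
  \<comment> \<open>The mass that \<open>\<pi>\<close> sends from the left of \<open>a\<close> to the point \<open>a\<close> is the deficit of \<open>\<nu>\<close> on the left of \<open>a\<close>.\<close>
  have snd_m: "distr (piece {..<a}) borel snd = chi_minus \<mu> \<nu>"
  proof (rule measure_eqI)
    fix E assume "E \<in> sets (distr (piece {..<a}) borel snd)"
    then have E[measurable]: "E \<in> sets borel" by simp
    have part: "measure \<pi> {w. fst w < a \<and> snd w \<in> F} = measure \<nu> (F \<inter> {..<a}) + measure \<pi> {w. fst w < a \<and> snd w = a \<and> a \<in> F}"
      if [measurable]: "F \<in> sets borel" for F
    proof -
      have "measure \<pi> {w. fst w < a \<and> snd w \<in> F} =
          measure \<pi> ({w. snd w \<in> F \<inter> {..<a}} \<union> {w. fst w < a \<and> snd w = a \<and> a \<in> F})"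
        using ae_a(2) by (intro measure_eq_AE) (auto intro!: setP sets.Un elim!: AE_mp)
      also have "\<dots> = measure \<pi> {w. snd w \<in> F \<inter> {..<a}} + measure \<pi> {w. fst w < a \<and> snd w = a \<and> a \<in> F}"
        by (intro \<pi>.finite_measure_Union setP) auto
      finally show ?thesis using m\<nu>[of "F \<inter> {..<a}"] by simp
    qed
    have "measure \<mu> {..<a} = measure \<nu> {..<a} + measure \<pi> {w. fst w < a \<and> snd w = a}"
      using part[of UNIV] m\<mu>[of "{..<a}"] by simp
    then have "measure \<pi> {w. fst w < a \<and> snd w = a} = atom_a" using atom_a_eq by simp
    then have "measure \<pi> {w. fst w < a \<and> snd w \<in> E} = measure \<nu> (E \<inter> {..<a}) + atom_a * indicator E a"
      using part[OF E] by (cases "a \<in> E") auto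
    then show "emeasure (distr (piece {..<a}) borel snd) E = emeasure (chi_minus \<mu> \<nu>) E"
      using piece_snd[of "{..<a}" E] emeasure_chi_minus[OF E] \<pi>.emeasure_eq_measure by simp
  qed simp
  have snd_p: "distr (piece {b<..}) borel snd = chi_plus \<mu> \<nu>"
  proof (rule measure_eqI)
    fix E assume "E \<in> sets (distr (piece {b<..}) borel snd)"
    then have E[measurable]: "E \<in> sets borel" by simp
    \<comment> \<open>Mass above \<open>b\<close> comes from \<open>x > b\<close> only: for \<open>x < b\<close> by separation at \<open>b\<close>, for \<open>x = b\<close> by \<open>at_b\<close>.\<close>
    have part: "measure \<pi> {w. b < fst w \<and> snd w \<in> F} = measure \<nu> (F \<inter> {b<..}) + measure \<pi> {w. b < fst w \<and> snd w = b \<and> b \<in> F}"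
      if [measurable]: "F \<in> sets borel" for F
    proof -
      have "measure \<pi> {w. b < fst w \<and> snd w \<in> F} =
          measure \<pi> ({w. snd w \<in> F \<inter> {b<..}} \<union> {w. b < fst w \<and> snd w = b \<and> b \<in> F})"
      proof (intro measure_eq_AE)
        show "AE w in \<pi>. (w \<in> {w. b < fst w \<and> snd w \<in> F}) =
            (w \<in> {w. snd w \<in> F \<inter> {b<..}} \<union> {w. b < fst w \<and> snd w = b \<and> b \<in> F})"
          using ae_b(2) at_b by eventually_elim force
      qed (auto intro!: setP sets.Un)
      also have "\<dots> = measure \<pi> {w. snd w \<in> F \<inter> {b<..}} + measure \<pi> {w. b < fst w \<and> snd w = b \<and> b \<in> F}"
        by (intro \<pi>.finite_measure_Union setP) auto
      finally show ?thesis using m\<nu>[of "F \<inter> {b<..}"] by simp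
    qed
    have "measure \<mu> {b<..} = measure \<nu> {b<..} + measure \<pi> {w. b < fst w \<and> snd w = b}"
      using part[of UNIV] m\<mu>[of "{b<..}"] by simp
    then have "measure \<pi> {w. b < fst w \<and> snd w = b} = atom_b" using atom_b_eq by simp
    then have "measure \<pi> {w. b < fst w \<and> snd w \<in> E} = measure \<nu> (E \<inter> {b<..}) + atom_b * indicator E b"
      using part[OF E] by (cases "b \<in> E") auto
    then show "emeasure (distr (piece {b<..}) borel snd) E = emeasure (chi_plus \<mu> \<nu>) E"
      using piece_snd[of "{b<..}" E] emeasure_chi_plus[OF E] \<pi>.emeasure_eq_measure by simp
  qed simp
  have split: "measure \<pi> F = measure \<pi> ({w. fst w \<in> {..<a}} \<inter> F) + measure \<pi> ({w. fst w \<in> {a..b}} \<inter> F) +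
      measure \<pi> ({w. fst w \<in> {b<..}} \<inter> F)" if F: "F \<in> sets \<pi>" for F
  proof -
    have s: "{w. fst w \<in> {..<a}} \<inter> F \<in> sets \<pi>" "{w. fst w \<in> {a..b}} \<inter> F \<in> sets \<pi>" "{w. fst w \<in> {b<..}} \<inter> F \<in> sets \<pi>"
      using F by (auto intro!: sets.Int setP)
    have "measure \<pi> ({w. fst w \<in> {..<a}} \<inter> F) + measure \<pi> ({w. fst w \<in> {a..b}} \<inter> F) =
        measure \<pi> (({w. fst w \<in> {..<a}} \<inter> F) \<union> ({w. fst w \<in> {a..b}} \<inter> F))"
      using s by (intro \<pi>.finite_measure_Union[symmetric]) auto
    also have "\<dots> + measure \<pi> ({w. fst w \<in> {b<..}} \<inter> F) =
        measure \<pi> ((({w. fst w \<in> {..<a}} \<inter> F) \<union> ({w. fst w \<in> {a..b}} \<inter> F)) \<union> ({w. fst w \<in> {b<..}} \<inter> F))"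
      using s a_le_b by (intro \<pi>.finite_measure_Union[symmetric]) auto
    also have "(({w. fst w \<in> {..<a}} \<inter> F) \<union> ({w. fst w \<in> {a..b}} \<inter> F)) \<union> ({w. fst w \<in> {b<..}} \<inter> F) = F"
      using a_le_b by auto
    finally show ?thesis by simp
  qed
  have piece_e: "emeasure (piece S) F = ennreal (measure \<pi> ({w. fst w \<in> S} \<inter> F))"
    if "S \<in> sets borel" "F \<in> sets \<pi>" for S F
    unfolding piece_def using that by (subst emeasure_restr_measure) (auto intro!: setP simp: \<pi>.emeasure_eq_measure)
  have snd_z: "distr (piece {a..b}) borel snd = chi_zero \<mu> \<nu>"
  proof (rule measure_eqI)
    fix E assume "E \<in> sets (distr (piece {a..b}) borel snd)"
    then have E[measurable]: "E \<in> sets borel" by simp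
    have eq: "{w. fst w \<in> S} \<inter> {w. snd w \<in> E} = {w. fst w \<in> S \<and> snd w \<in> E}" for S by auto
    have n: "0 \<le> atom_a * indicator E a" "0 \<le> atom_b * indicator E b"
      using atom_nonneg by (auto simp: indicator_def)
    have "emeasure \<pi> {w. fst w \<in> {..<a} \<and> snd w \<in> E} = emeasure (chi_minus \<mu> \<nu>) E"
      using piece_snd[of "{..<a}" E] unfolding snd_m by simp
    then have m: "measure \<pi> {w. fst w \<in> {..<a} \<and> snd w \<in> E} = measure \<nu> (E \<inter> {..<a}) + atom_a * indicator E a"
      unfolding emeasure_chi_minus[OF E] \<pi>.emeasure_eq_measure using n by (subst (asm) ennreal_inj) auto
    have "emeasure \<pi> {w. fst w \<in> {b<..} \<and> snd w \<in> E} = emeasure (chi_plus \<mu> \<nu>) E"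
      using piece_snd[of "{b<..}" E] unfolding snd_p by simp
    then have p: "measure \<pi> {w. fst w \<in> {b<..} \<and> snd w \<in> E} = measure \<nu> (E \<inter> {b<..}) + atom_b * indicator E b"
      unfolding emeasure_chi_plus[OF E] \<pi>.emeasure_eq_measure using n by (subst (asm) ennreal_inj) auto
    have "{w. snd w \<in> E} \<in> sets \<pi>" by (intro setP) measurable
    from split[OF this] have "measure \<pi> {w. fst w \<in> {a..b} \<and> snd w \<in> E} =
        measure \<nu> (E \<inter> {a..b}) - atom_a * indicator E a - atom_b * indicator E b"
      unfolding eq m p m\<nu>[OF E] measure_\<nu>_split[OF E] by simp
    then show "emeasure (distr (piece {a..b}) borel snd) E = emeasure (chi_zero \<mu> \<nu>) E"
      using piece_snd[of "{a..b}" E] emeasure_chi_zero[OF E] \<pi>.emeasure_eq_measure by simp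
  qed simp
  have "\<pi> = add_measure (add_measure (piece {..<a}) (piece {a..b})) (piece {b<..})"
  proof (rule measure_eqI)
    fix F assume F: "F \<in> sets \<pi>"
    show "emeasure \<pi> F = emeasure (add_measure (add_measure (piece {..<a}) (piece {a..b})) (piece {b<..})) F"
      using F sets_\<pi> sets_piece split[OF F]
      by (simp add: emeasure_add_measure piece_e \<pi>.emeasure_eq_measure flip: ennreal_plus)
  qed (simp add: sets_piece sets_\<pi>)
  moreover have "piece {..<a} \<in> submartingale_couplings (eta_minus \<mu> \<nu>) (chi_minus \<mu> \<nu>)"
    unfolding submartingale_couplings_def couplings_def mem_Collect_eq
  proof (intro conjI exI)
    show "AE x in eta_minus \<mu> \<nu>. x \<le> barycenter \<kappa> x"
      unfolding eta_minus_def using ae_a(1) by (subst AE_restr_measure) (auto elim!: AE_mp)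
  qed (use piece_d piece_fst snd_m sets_piece in \<open>simp_all add: eta_minus_def\<close>)
  moreover have "piece {a..b} \<in> martingale_couplings (eta_zero \<mu> \<nu>) (chi_zero \<mu> \<nu>)"
    unfolding martingale_couplings_def couplings_def mem_Collect_eq
  proof (intro conjI exI)
    have "AE x in \<mu>. x = b \<longrightarrow> barycenter \<kappa> x = b"
      using AE_disintegrates[OF d c at_b]
    proof (rule AE_mp, intro AE_I2[of \<mu>] impI)
      fix x assume *: "AE y in \<kappa> x. fst (x, y) = b \<longrightarrow> snd (x, y) = b" "x = b"
      interpret \<kappa>: prob_space "\<kappa> x" by (rule disintegrates_kernel(2)[OF d])
      have "AE y in \<kappa> x. y = b" using *(1) by eventually_elim (simp add: *(2))
      then have "(\<integral>y. y \<partial>\<kappa> x) = (\<integral>y. b \<partial>\<kappa> x)"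
        by (intro integral_cong_AE measurable_ident_sets[OF disintegrates_kernel(3)[OF d]] borel_measurable_const)
      then show "barycenter \<kappa> x = b" using \<kappa>.prob_space by (simp add: barycenter_def)
    qed
    with ae_a(1) ae_b(1) have "AE x in \<mu>. x \<in> {a..b} \<longrightarrow> barycenter \<kappa> x = x"
      by eventually_elim force
    then show "AE x in eta_zero \<mu> \<nu>. barycenter \<kappa> x = x"
      unfolding eta_zero_def by (subst AE_restr_measure) auto
  qed (use piece_d piece_fst snd_z sets_piece in \<open>simp_all add: eta_zero_def\<close>)
  moreover have "piece {b<..} \<in> supermartingale_couplings (eta_plus \<mu> \<nu>) (chi_plus \<mu> \<nu>)"
    unfolding supermartingale_couplings_def couplings_def mem_Collect_eq
  proof (intro conjI exI)
    show "AE x in eta_plus \<mu> \<nu>. barycenter \<kappa> x \<le> x"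
      unfolding eta_plus_def using ae_b(1) by (subst AE_restr_measure) (auto elim!: AE_mp)
  qed (use piece_d piece_fst snd_p sets_piece in \<open>simp_all add: eta_plus_def\<close>)
  ultimately show ?thesis unfolding glued_couplings_def by blast
qed

lemma optimal_couplings_eq:
  assumes "glued_couplings \<noteq> {}"
  shows "optimal_couplings \<mu> \<nu> = glued_couplings"
proof (intro equalityI subsetI glued_imp_optimal)
  fix \<pi> assume "\<pi> \<in> optimal_couplings \<mu> \<nu>"
  then obtain \<kappa> where \<pi>: "\<pi> \<in> couplings \<mu> \<nu>" "disintegrates \<mu> \<pi> \<kappa>"
    and le: "\<And>\<pi>' \<kappa>'. \<pi>' \<in> couplings \<mu> \<nu> \<Longrightarrow> disintegrates \<mu> \<pi>' \<kappa>' \<Longrightarrow>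
      (\<integral>x. \<bar>x - barycenter \<kappa> x\<bar> \<partial>\<mu>) \<le> (\<integral>x. \<bar>x - barycenter \<kappa>' x\<bar> \<partial>\<mu>)"
    unfolding optimal_couplings_def by blast
  obtain \<pi>0 where "\<pi>0 \<in> glued_couplings" using assms by blast
  with glued_coupling_deviation[of \<pi>0] le have "(\<integral>x. \<bar>x - barycenter \<kappa> x\<bar> \<partial>\<mu>) \<le> min_deviation" by metis
  then have "(\<integral>x. \<bar>x - barycenter \<kappa> x\<bar> \<partial>\<mu>) = min_deviation"
    using mean_deviation_ge[OF \<pi> \<mu>.finite_measure_axioms int\<mu> int\<nu>, of a] by simp
  then show "\<pi> \<in> glued_couplings" by (rule minimal_deviation_imp_glued[OF \<pi>])
qed

end

section \<open>The covariance of a glued coupling\<close>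

text \<open>The positive part of \<open>f\<close> may have infinite integral, but its negative part is dominated by the one
  of \<open>L\<close>. Integrating the identity \<open>f\<^sup>+ + L\<^sup>- = N + (L\<^sup>+ + f\<^sup>-)\<close> of nonnegative functions avoids any
  subtraction of infinities.\<close>
lemma nn_integral_signed_split:
  fixes f N L :: "'a \<Rightarrow> real"
  assumes [measurable]: "f \<in> borel_measurable M" "N \<in> borel_measurable M"
    and L: "integrable M L"
    and eq: "AE z in M. f z = N z + L z" and nonneg: "AE z in M. 0 \<le> N z"
  shows "\<exists>r. (\<integral>\<^sup>+z. ennreal (- f z) \<partial>M) = ennreal r \<and> 0 \<le> r \<and>
    enn2ereal (\<integral>\<^sup>+z. ennreal (f z) \<partial>M) = enn2ereal (\<integral>\<^sup>+z. ennreal (N z) \<partial>M) + ereal (integral\<^sup>L M L + r)"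
proof -
  have [measurable]: "L \<in> borel_measurable M" using L by (rule borel_measurable_integrable)
  obtain p n where p: "(\<integral>\<^sup>+z. ennreal (L z) \<partial>M) = ennreal p" "0 \<le> p"
    and n: "(\<integral>\<^sup>+z. ennreal (- L z) \<partial>M) = ennreal n" "0 \<le> n" and pn: "integral\<^sup>L M L = p - n"
    using L by (rule integrableE)
  have "(\<integral>\<^sup>+z. ennreal (- f z) \<partial>M) \<le> (\<integral>\<^sup>+z. ennreal (- L z) \<partial>M)"
  proof (rule nn_integral_mono_AE)
    show "AE z in M. ennreal (- f z) \<le> ennreal (- L z)"
      using eq nonneg by eventually_elim (auto intro!: ennreal_leI)
  qed
  then have "(\<integral>\<^sup>+z. ennreal (- f z) \<partial>M) < top" unfolding n(1) by (rule le_less_trans) simp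
  then obtain r where r: "(\<integral>\<^sup>+z. ennreal (- f z) \<partial>M) = ennreal r" "0 \<le> r"
    by (cases "\<integral>\<^sup>+z. ennreal (- f z) \<partial>M") auto
  have "(\<integral>\<^sup>+z. ennreal (f z) + ennreal (- L z) \<partial>M) =
      (\<integral>\<^sup>+z. ennreal (N z) + (ennreal (L z) + ennreal (- f z)) \<partial>M)"
  proof (rule nn_integral_cong_AE)
    have *: "ennreal (u + v) + ennreal (- v) = ennreal u + (ennreal v + ennreal (- (u + v)))"
      if "0 \<le> u" for u v :: real
    proof -
      have "ennreal (max 0 (u + v)) + ennreal (max 0 (- v)) = ennreal (max 0 (u + v) + max 0 (- v))"
        by (rule ennreal_plus[symmetric]) auto
      also have "max 0 (u + v) + max 0 (- v) = u + (max 0 v + max 0 (- (u + v)))"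
        using that by (auto simp: max_def)
      also have "ennreal \<dots> = ennreal u + ennreal (max 0 v + max 0 (- (u + v)))"
        using that by (intro ennreal_plus) auto
      also have "ennreal (max 0 v + max 0 (- (u + v))) = ennreal (max 0 v) + ennreal (max 0 (- (u + v)))"
        by (rule ennreal_plus) auto
      finally show ?thesis by simp
    qed
    show "AE z in M. ennreal (f z) + ennreal (- L z) = ennreal (N z) + (ennreal (L z) + ennreal (- f z))"
      using eq nonneg by eventually_elim (simp only: *)
  qed
  then have "(\<integral>\<^sup>+z. ennreal (f z) \<partial>M) + ennreal n = (\<integral>\<^sup>+z. ennreal (N z) \<partial>M) + (ennreal p + ennreal r)"
    by (simp add: nn_integral_add p n r)
  then have "enn2ereal ((\<integral>\<^sup>+z. ennreal (f z) \<partial>M) + ennreal n) =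
      enn2ereal ((\<integral>\<^sup>+z. ennreal (N z) \<partial>M) + (ennreal p + ennreal r))" by (rule arg_cong)
  then have sum: "enn2ereal (\<integral>\<^sup>+z. ennreal (f z) \<partial>M) + ereal n =
      enn2ereal (\<integral>\<^sup>+z. ennreal (N z) \<partial>M) + (ereal p + ereal r)"
    using p n r by (simp add: plus_ennreal.rep_eq)
  have "enn2ereal (\<integral>\<^sup>+z. ennreal (f z) \<partial>M) =
      enn2ereal (\<integral>\<^sup>+z. ennreal (N z) \<partial>M) + ereal (integral\<^sup>L M L + r)"
    using sum unfolding pn
    by (cases "enn2ereal (\<integral>\<^sup>+z. ennreal (f z) \<partial>M)"; cases "enn2ereal (\<integral>\<^sup>+z. ennreal (N z) \<partial>M)") auto
  with r show ?thesis by blast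
qed

lemma integral_coupling_affine:
  fixes c d :: real
  assumes \<pi>: "\<pi> \<in> couplings \<eta> \<theta>" and fin: "finite_measure \<eta>"
    and int: "integrable \<eta> (\<lambda>x. x)" "integrable \<theta> (\<lambda>y. y)"
  shows "integrable \<pi> (\<lambda>z. c * fst z + c * snd z + d)"
    and "(\<integral>z. c * fst z + c * snd z + d \<partial>\<pi>) = c * (\<integral>x. x \<partial>\<eta>) + c * (\<integral>y. y \<partial>\<theta>) + d * measure \<eta> UNIV"
proof -
  interpret finite_measure \<pi> using couplings_finite_measure[OF \<pi> fin] .
  have m: "measure \<pi> (space \<pi>) = measure \<eta> UNIV"
    using emeasure_coupling_fst[OF \<pi>, of UNIV] couplings_space[OF \<pi>] by (simp add: measure_def)
  have i: "integrable \<pi> (\<lambda>z. fst z)" "integrable \<pi> (\<lambda>z. snd z)"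
    using integrable_coupling_fst[OF \<pi> measurable_ident] integrable_coupling_snd[OF \<pi> measurable_ident] int
    unfolding id_def by blast+
  have e: "(\<integral>z. fst z \<partial>\<pi>) = (\<integral>x. x \<partial>\<eta>)" "(\<integral>z. snd z \<partial>\<pi>) = (\<integral>y. y \<partial>\<theta>)"
    using integral_coupling_fst[OF \<pi> measurable_ident] integral_coupling_snd[OF \<pi> measurable_ident]
    unfolding id_def by blast+
  show "integrable \<pi> (\<lambda>z. c * fst z + c * snd z + d)"
    using i by (intro Bochner_Integration.integrable_add integrable_mult_right integrable_const)
  show "(\<integral>z. c * fst z + c * snd z + d \<partial>\<pi>) = c * (\<integral>x. x \<partial>\<eta>) + c * (\<integral>y. y \<partial>\<theta>) + d * measure \<eta> UNIV"
    using i e m by simp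
qed

context balanced_gaps
begin

text \<open>The share of the covariance that is determined by the marginals of the three parts.\<close>
definition fixed_part :: real where
  "fixed_part =
     (a * (\<integral>x. x \<partial>eta_minus \<mu> \<nu>) + a * (\<integral>y. y \<partial>chi_minus \<mu> \<nu>) + - a\<^sup>2 * measure (eta_minus \<mu> \<nu>) UNIV) +
     (\<integral>x. indicator {a..b} x * x * x \<partial>eta_zero \<mu> \<nu>) +
     (b * (\<integral>x. x \<partial>eta_plus \<mu> \<nu>) + b * (\<integral>y. y \<partial>chi_plus \<mu> \<nu>) + - b\<^sup>2 * measure (eta_plus \<mu> \<nu>) UNIV) -
     (\<integral>x. x \<partial>\<mu>) * (\<integral>y. y \<partial>\<nu>)"

text \<open>On the outer parts \<open>x * y = (a - x) * (a - y) + (a * x + a * y - a\<^sup>2)\<close>, and likewise with \<open>b\<close>; on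
  the middle part \<open>x\<close> is bounded, so the martingale property allows to replace \<open>y\<close> by \<open>x\<close>.\<close>
lemma covar_glued:
  assumes m: "\<pi>m \<in> couplings (eta_minus \<mu> \<nu>) (chi_minus \<mu> \<nu>)"
    and z: "\<pi>z \<in> martingale_couplings (eta_zero \<mu> \<nu>) (chi_zero \<mu> \<nu>)"
    and p: "\<pi>p \<in> couplings (eta_plus \<mu> \<nu>) (chi_plus \<mu> \<nu>)"
  shows "covar (add_measure (add_measure \<pi>m \<pi>z) \<pi>p) =
    enn2ereal (\<integral>\<^sup>+w. ennreal ((a - fst w) * (a - snd w)) \<partial>\<pi>m) +
    enn2ereal (\<integral>\<^sup>+w. ennreal ((fst w - b) * (snd w - b)) \<partial>\<pi>p) + ereal fixed_part"
proof -
  obtain \<kappa> where zc: "\<pi>z \<in> couplings (eta_zero \<mu> \<nu>) (chi_zero \<mu> \<nu>)" and zd: "disintegrates (eta_zero \<mu> \<nu>) \<pi>z \<kappa>"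
    and mart: "AE x in eta_zero \<mu> \<nu>. barycenter \<kappa> x = x"
    using z by (auto simp: martingale_couplings_def)
  let ?\<pi> = "add_measure (add_measure \<pi>m \<pi>z) \<pi>p"
  have c: "?\<pi> \<in> couplings \<mu> \<nu>" by (rule add_pieces_coupling[OF m zc p])
  note [measurable_cong] = couplings_sets[OF m] couplings_sets[OF zc] couplings_sets[OF p]
  note [measurable] = borel_measurable_barycenter[OF zd]
  have sets: "sets \<pi>m = sets \<pi>z" "sets (add_measure \<pi>m \<pi>z) = sets \<pi>p"
    using couplings_sets[OF m] couplings_sets[OF zc] couplings_sets[OF p] by auto
  have nn: "(\<integral>\<^sup>+w. h w \<partial>?\<pi>) = (\<integral>\<^sup>+w. h w \<partial>\<pi>m) + (\<integral>\<^sup>+w. h w \<partial>\<pi>z) + (\<integral>\<^sup>+w. h w \<partial>\<pi>p)"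
    if h [measurable]: "h \<in> borel_measurable (borel \<Otimes>\<^sub>M borel)" for h
  proof -
    have "h \<in> borel_measurable (add_measure \<pi>m \<pi>z)" "h \<in> borel_measurable \<pi>m" by measurable
    then show ?thesis by (simp add: nn_integral_add_measure[OF sets(1)] nn_integral_add_measure[OF sets(2)])
  qed
  let ?xy = "\<lambda>w::real \<times> real. fst w * snd w"
  obtain rm where rm: "(\<integral>\<^sup>+w. ennreal (- ?xy w) \<partial>\<pi>m) = ennreal rm" "0 \<le> rm"
    "enn2ereal (\<integral>\<^sup>+w. ennreal (?xy w) \<partial>\<pi>m) = enn2ereal (\<integral>\<^sup>+w. ennreal ((a - fst w) * (a - snd w)) \<partial>\<pi>m) +
      ereal ((a * (\<integral>x. x \<partial>eta_minus \<mu> \<nu>) + a * (\<integral>y. y \<partial>chi_minus \<mu> \<nu>) + - a\<^sup>2 * measure (eta_minus \<mu> \<nu>) UNIV) + rm)"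
  proof -
    note aff = integral_coupling_affine[OF m finite_measure_pieces(1) integrable_pieces(1,4), of a "- a\<^sup>2"]
    have "AE w in \<pi>m. 0 \<le> (a - fst w) * (a - snd w)"
      using AE_coupling_fst[OF m AE_eta(1)] AE_coupling_snd[OF m AE_chi(1)] by eventually_elim auto
    then have "\<exists>r. (\<integral>\<^sup>+w. ennreal (- ?xy w) \<partial>\<pi>m) = ennreal r \<and> 0 \<le> r \<and>
      enn2ereal (\<integral>\<^sup>+w. ennreal (?xy w) \<partial>\<pi>m) = enn2ereal (\<integral>\<^sup>+w. ennreal ((a - fst w) * (a - snd w)) \<partial>\<pi>m) +
      ereal ((\<integral>w. a * fst w + a * snd w + - a\<^sup>2 \<partial>\<pi>m) + r)"
      by (intro nn_integral_signed_split aff(1)) (measurable, auto simp: algebra_simps power2_eq_square)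
    then show thesis using that unfolding aff(2) by blast
  qed
  obtain rp where rp: "(\<integral>\<^sup>+w. ennreal (- ?xy w) \<partial>\<pi>p) = ennreal rp" "0 \<le> rp"
    "enn2ereal (\<integral>\<^sup>+w. ennreal (?xy w) \<partial>\<pi>p) = enn2ereal (\<integral>\<^sup>+w. ennreal ((fst w - b) * (snd w - b)) \<partial>\<pi>p) +
      ereal ((b * (\<integral>x. x \<partial>eta_plus \<mu> \<nu>) + b * (\<integral>y. y \<partial>chi_plus \<mu> \<nu>) + - b\<^sup>2 * measure (eta_plus \<mu> \<nu>) UNIV) + rp)"
  proof -
    note aff = integral_coupling_affine[OF p finite_measure_pieces(3) integrable_pieces(3,6), of b "- b\<^sup>2"]
    have "AE w in \<pi>p. 0 \<le> (fst w - b) * (snd w - b)"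
      using AE_coupling_fst[OF p AE_eta(3)] AE_coupling_snd[OF p AE_chi(3)] by eventually_elim auto
    then have "\<exists>r. (\<integral>\<^sup>+w. ennreal (- ?xy w) \<partial>\<pi>p) = ennreal r \<and> 0 \<le> r \<and>
      enn2ereal (\<integral>\<^sup>+w. ennreal (?xy w) \<partial>\<pi>p) = enn2ereal (\<integral>\<^sup>+w. ennreal ((fst w - b) * (snd w - b)) \<partial>\<pi>p) +
      ereal ((\<integral>w. b * fst w + b * snd w + - b\<^sup>2 \<partial>\<pi>p) + r)"
      by (intro nn_integral_signed_split aff(1)) (measurable, auto simp: algebra_simps power2_eq_square)
    then show thesis using that unfolding aff(2) by blast
  qed
  obtain rz where rz: "(\<integral>\<^sup>+w. ennreal (- ?xy w) \<partial>\<pi>z) = ennreal rz" "0 \<le> rz"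
    "enn2ereal (\<integral>\<^sup>+w. ennreal (?xy w) \<partial>\<pi>z) = ereal ((\<integral>x. indicator {a..b} x * x * x \<partial>eta_zero \<mu> \<nu>) + rz)"
  proof -
    define g where "g x = indicator {a..b} x * x" for x :: real
    have [measurable]: "g \<in> borel_measurable borel" unfolding g_def by measurable
    have g: "\<bar>g x\<bar> \<le> max \<bar>a\<bar> \<bar>b\<bar>" for x by (auto simp: g_def indicator_def)
    note mult = integrable_coupling_mult_snd[OF zd zc integrable_pieces(5) _ g]
      integral_barycenter_mult[OF zd zc integrable_pieces(5) _ g]
    have "(\<integral>x. g x * barycenter \<kappa> x \<partial>eta_zero \<mu> \<nu>) = (\<integral>x. g x * x \<partial>eta_zero \<mu> \<nu>)"
    proof (rule integral_cong_AE)
      show "AE x in eta_zero \<mu> \<nu>. g x * barycenter \<kappa> x = g x * x"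
        using mart by eventually_elim simp
    qed measurable
    then have val: "(\<integral>w. g (fst w) * snd w \<partial>\<pi>z) = (\<integral>x. indicator {a..b} x * x * x \<partial>eta_zero \<mu> \<nu>)"
      using mult(2) by (simp add: g_def)
    have "AE w in \<pi>z. ?xy w = 0 + g (fst w) * snd w"
      using AE_coupling_fst[OF zc AE_eta(2)] by eventually_elim (auto simp: g_def)
    then have "\<exists>r. (\<integral>\<^sup>+w. ennreal (- ?xy w) \<partial>\<pi>z) = ennreal r \<and> 0 \<le> r \<and>
      enn2ereal (\<integral>\<^sup>+w. ennreal (?xy w) \<partial>\<pi>z) = enn2ereal (\<integral>\<^sup>+w. ennreal 0 \<partial>\<pi>z) +
      ereal ((\<integral>w. g (fst w) * snd w \<partial>\<pi>z) + r)"
      by (intro nn_integral_signed_split mult(1)) auto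
    then show thesis using that unfolding val by (auto simp: zero_ennreal.rep_eq)
  qed
  have fst_snd: "(\<integral>w. fst w \<partial>?\<pi>) = (\<integral>x. x \<partial>\<mu>)" "(\<integral>w. snd w \<partial>?\<pi>) = (\<integral>y. y \<partial>\<nu>)"
    using integral_coupling_fst[OF c measurable_ident] integral_coupling_snd[OF c measurable_ident]
    unfolding id_def by blast+
  have "covar ?\<pi> = enn2ereal (\<integral>\<^sup>+w. ennreal (?xy w) \<partial>?\<pi>) - enn2ereal (\<integral>\<^sup>+w. ennreal (- ?xy w) \<partial>?\<pi>)
      - ereal ((\<integral>x. x \<partial>\<mu>) * (\<integral>y. y \<partial>\<nu>))"
    unfolding covar_def fst_snd by (simp add: case_prod_beta')
  also have "(\<integral>\<^sup>+w. ennreal (- ?xy w) \<partial>?\<pi>) = ennreal (rm + rz + rp)"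
    using rm(2) rz(2) rp(2) by (subst nn) (simp_all add: rm(1) rz(1) rp(1))
  also have "(\<integral>\<^sup>+w. ennreal (?xy w) \<partial>?\<pi>) =
      (\<integral>\<^sup>+w. ennreal (?xy w) \<partial>\<pi>m) + (\<integral>\<^sup>+w. ennreal (?xy w) \<partial>\<pi>z) + (\<integral>\<^sup>+w. ennreal (?xy w) \<partial>\<pi>p)"
    by (rule nn) measurable
  finally have cov: "covar ?\<pi> =
      (enn2ereal (\<integral>\<^sup>+w. ennreal (?xy w) \<partial>\<pi>m) + enn2ereal (\<integral>\<^sup>+w. ennreal (?xy w) \<partial>\<pi>z) +
       enn2ereal (\<integral>\<^sup>+w. ennreal (?xy w) \<partial>\<pi>p)) - ereal (rm + rz + rp) - ereal ((\<integral>x. x \<partial>\<mu>) * (\<integral>y. y \<partial>\<nu>))"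
    using rm(2) rz(2) rp(2) by (simp add: plus_ennreal.rep_eq enn2ereal_ennreal del: ennreal_plus)
  have arith: "(A + ereal (u + r1)) + ereal (v + r2) + (B + ereal (w + r3)) - ereal (r1 + r2 + r3) - ereal e =
      A + B + ereal (u + v + w - e)" for A B :: ereal and u v w r1 r2 r3 e :: real
    by (cases A; cases B) auto
  show ?thesis unfolding cov rm(3) rz(3) rp(3) arith fixed_part_def ..
qed

end

section \<open>The extremal couplings\<close>

theorem proposition4p1:
  fixes \<mu> \<nu> :: "real measure"
    and sub_D sub_I super_D super_I \<pi>M :: "(real \<times> real) measure"
  assumes "real_distribution \<mu>" and "real_distribution \<nu>"
    and "integrable \<mu> (\<lambda>x. x)" and "integrable \<nu> (\<lambda>x. x)"
    and "min (p_gap \<mu> \<nu>) (c_gap \<mu> \<nu>) > 0"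
    and "decreasing_submartingale_coupling (eta_minus \<mu> \<nu>) (chi_minus \<mu> \<nu>) sub_D"
    and "increasing_submartingale_coupling (eta_minus \<mu> \<nu>) (chi_minus \<mu> \<nu>) sub_I"
    and "decreasing_supermartingale_coupling (eta_plus \<mu> \<nu>) (chi_plus \<mu> \<nu>) super_D"
    and "increasing_supermartingale_coupling (eta_plus \<mu> \<nu>) (chi_plus \<mu> \<nu>) super_I"
    and "\<pi>M \<in> martingale_couplings (eta_zero \<mu> \<nu>) (chi_zero \<mu> \<nu>)"
  shows "is_arg_min covar (\<lambda>\<pi>. \<pi> \<in> optimal_couplings \<mu> \<nu>)
           (add_measure (add_measure sub_D \<pi>M) super_I) \<and>
         is_arg_max covar (\<lambda>\<pi>. \<pi> \<in> optimal_couplings \<mu> \<nu>)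
           (add_measure (add_measure sub_I \<pi>M) super_D)"
proof -
  have D: "sub_D \<in> submartingale_couplings (eta_minus \<mu> \<nu>) (chi_minus \<mu> \<nu>)"
    "super_D \<in> supermartingale_couplings (eta_plus \<mu> \<nu>) (chi_plus \<mu> \<nu>)"
    and I: "sub_I \<in> submartingale_couplings (eta_minus \<mu> \<nu>) (chi_minus \<mu> \<nu>)"
    "super_I \<in> supermartingale_couplings (eta_plus \<mu> \<nu>) (chi_plus \<mu> \<nu>)"
    using assms(6-9) by (simp_all add: decreasing_submartingale_coupling_def increasing_submartingale_coupling_def
      decreasing_supermartingale_coupling_def increasing_supermartingale_coupling_def)
  have mass: "emeasure (eta_minus \<mu> \<nu>) UNIV = emeasure (chi_minus \<mu> \<nu>) UNIV"
    "emeasure (eta_plus \<mu> \<nu>) UNIV = emeasure (chi_plus \<mu> \<nu>) UNIV"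
    using D by (auto simp: submartingale_couplings_def supermartingale_couplings_def intro: couplings_mass_eq)
  interpret \<mu>: real_distribution \<mu> by fact
  interpret \<nu>: real_distribution \<nu> by fact
  interpret balanced_gaps \<mu> \<nu>
    by unfold_locales (use assms(3-5) mass in simp_all)
  let ?min = "add_measure (add_measure sub_D \<pi>M) super_I"
  let ?max = "add_measure (add_measure sub_I \<pi>M) super_D"
  have glued: "?min \<in> glued_couplings" "?max \<in> glued_couplings"
    unfolding glued_couplings_def using D I assms(10) by blast+
  then have opt: "optimal_couplings \<mu> \<nu> = glued_couplings" by (intro optimal_couplings_eq) blast
  have bounds: "covar ?min \<le> covar \<pi>" "covar \<pi> \<le> covar ?max" if optimal: "\<pi> \<in> optimal_couplings \<mu> \<nu>" for \<pi>
  proof -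
    obtain \<pi>m \<pi>z \<pi>p where \<pi>: "\<pi> = add_measure (add_measure \<pi>m \<pi>z) \<pi>p"
      and m: "\<pi>m \<in> submartingale_couplings (eta_minus \<mu> \<nu>) (chi_minus \<mu> \<nu>)"
      and z: "\<pi>z \<in> martingale_couplings (eta_zero \<mu> \<nu>) (chi_zero \<mu> \<nu>)"
      and p: "\<pi>p \<in> supermartingale_couplings (eta_plus \<mu> \<nu>) (chi_plus \<mu> \<nu>)"
      using optimal unfolding opt glued_couplings_def by blast
    have sub: "\<And>\<rho>. \<rho> \<in> submartingale_couplings (eta_minus \<mu> \<nu>) (chi_minus \<mu> \<nu>) \<Longrightarrow>
        \<rho> \<in> couplings (eta_minus \<mu> \<nu>) (chi_minus \<mu> \<nu>)"
      and super: "\<And>\<rho>. \<rho> \<in> supermartingale_couplings (eta_plus \<mu> \<nu>) (chi_plus \<mu> \<nu>) \<Longrightarrow>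
        \<rho> \<in> couplings (eta_plus \<mu> \<nu>) (chi_plus \<mu> \<nu>)"
      by (simp_all add: submartingale_couplings_def supermartingale_couplings_def)
    note covar = covar_glued[OF sub _ super]
    note left = finite_measure_pieces(1,4) integrable_pieces(1,4) AE_chi(1) m
    note right = finite_measure_pieces(3,6) integrable_pieces(3,6) AE_chi(3) p
    show "covar ?min \<le> covar \<pi>"
      unfolding \<pi> covar[OF D(1) assms(10) I(2)] covar[OF m z p]
      using decreasing_submartingale_coupling_le[OF left assms(6)]
        increasing_supermartingale_coupling_le[OF right assms(9)]
      by (intro add_mono order_refl) (simp_all add: less_eq_ennreal.rep_eq)
    show "covar \<pi> \<le> covar ?max"
      unfolding \<pi> covar[OF I(1) assms(10) D(2)] covar[OF m z p]
      using increasing_submartingale_coupling_ge[OF left assms(7)]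
        decreasing_supermartingale_coupling_ge[OF right assms(8)]
      by (intro add_mono order_refl) (simp_all add: less_eq_ennreal.rep_eq)
  qed
  show ?thesis
    unfolding is_arg_min_def is_arg_max_def using bounds glued opt by (auto simp: not_less)
qed

end
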